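(* Let $G$ be a group which is virtually special. Then there is a finite index subgroup $H\le G$ such that there exist an injective group homomorphism $H\to\operatorname{Diff}^\infty_+(\mathbb{R})$ and an injective group homomorphism $H\to\operatorname{PL}_+(\mathbb{R})$.
   Context: $\operatorname{Diff}^\infty_+(\mathbb{R})$ denotes the group of orientation preserving $C^\infty$ diffeomorphisms of $\mathbb{R}$. $\operatorname{PL}_+(\mathbb{R})$ denotes the group of orientation preserving piecewise-linear homeomorphisms of $\mathbb{R}$, where infinitely many domains of linearity are allowed (the set of breakpoints is a closed discrete, possibly infinite, subset of $\mathbb{R}$). A group $G$ is virtually special if it has a finite index subgroup $H_0$ which acts freely, properly and cocompactly by cubical automorphisms on a CAT(0) cube complex $X$ such that the quotient $Y=H_0\backslash X$ is a special cube complex in the sense of Haglund and Wise, as follows. Let $Y$ be a nonpositively curved cube complex. Hyperplanes of $Y$ correspond to the equivalence classes of edges of $Y$ under the equivalence relation generated by being opposite edges of a square; an edge in the class is said to be dual to the hyperplane. Two distinct oriented edges with the same initial vertex $v$ are said to form the corner of a square at $v$ if the corresponding vertices of the link of $v$ are adjacent. Two hyperplanes cross if some dual edges of them form the corner of a square (a hyperplane crossing itself is said to self-intersect). $Y$ is special if: (1) no hyperplane self-intersects; (2) every hyperplane is two-sided, i.e. its dual edges can be oriented so that opposite edges of each square are oriented consistently; (3) no hyperplane directly self-osculates, i.e. with the orientations in (2), there are no two distinct edges dual to the same hyperplane which have the same initial vertex, or the same terminal vertex, and which do not form the corner of a square there; (4) no two hyperplanes inter-osculate, i.e. there are no two distinct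 hyperplanes which cross and which also have dual edges that, suitably oriented, share an initial vertex but do not form the corner of a square there. *)

theory Defs
  imports "HOL-Analysis.Analysis" "HOL-Algebra.Group_Action"
begin

section \<open>Isometric face inclusions of standard cubes\<close>

text \<open>
  A list \<open>f\<close> of length \<open>n\<close> satisfying \<open>face_map m n f\<close> encodes an isometric identification of
  \<open>[0,1]\<^sup>m\<close> with a face of \<open>[0,1]\<^sup>n\<close>: the \<open>j\<close>-th coordinate of the image point is the constant
  0 or 1 (\<open>End\<close>), or the \<open>i\<close>-th coordinate of the argument, reflected if \<open>b\<close> holds (\<open>Coord i b\<close>).
  For \<open>m = n\<close> these are the symmetries of the \<open>n\<close>-cube.
\<close>

datatype coord = End bool | Coord nat bool

definition face_map :: "nat \<Rightarrow> nat \<Rightarrow> coord list \<Rightarrow> bool" where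
  "face_map m n f \<longleftrightarrow>
     length f = n \<and>
     (\<forall>i b. Coord i b \<in> set f \<longrightarrow> i < m) \<and>
     (\<forall>i<m. \<exists>!j. j < n \<and> (\<exists>b. f ! j = Coord i b))"

definition id_face :: "nat \<Rightarrow> coord list" where
  "id_face n = map (\<lambda>i. Coord i False) [0..<n]"

fun reflect :: "coord \<Rightarrow> coord" where
  "reflect (End b) = End (\<not> b)"
| "reflect (Coord i b) = Coord i (\<not> b)"

fun subst_coord :: "coord list \<Rightarrow> coord \<Rightarrow> coord" where
  "subst_coord g (End b) = End b"
| "subst_coord g (Coord i b) = (if b then reflect (g ! i) else g ! i)"

definition comp_face :: "coord list \<Rightarrow> coord list \<Rightarrow> coord list" where
  "comp_face f g = map (subst_coord g) f"

definition std_cube :: "nat \<Rightarrow> real list set" where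
  "std_cube n = {t. length t = n \<and> set t \<subseteq> {0..1}}"

fun eval_coord :: "real list \<Rightarrow> coord \<Rightarrow> real" where
  "eval_coord t (End b) = (if b then 1 else 0)"
| "eval_coord t (Coord i b) = (if b then 1 - t ! i else t ! i)"

definition apply_face :: "coord list \<Rightarrow> real list \<Rightarrow> real list" where
  "apply_face f t = map (eval_coord t) f"

definition eucl_dist :: "real list \<Rightarrow> real list \<Rightarrow> real" where
  "eucl_dist t t' = L2_set (\<lambda>i. t ! i - t' ! i) {..<length t}"


section \<open>Cube complexes\<close>

text \<open>
  A cube complex is given by all parametrizations (charts) of its cubes by standard cubes.
  An \<open>n\<close>-cube has \<open>2\<^sup>n n!\<close> charts, permuted simply transitively by the symmetries of the standard
  cube; vertices are charts of dimension 0 and oriented edges are charts of dimension 1.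
  \<open>restr X c f\<close> is the chart \<open>c\<close> precomposed with the face inclusion \<open>f\<close>. Faces of a cube may be
  identified with each other, so cubes need not be embedded.
\<close>

record 'c cube_complex =
  charts :: "'c set"
  cdim :: "'c \<Rightarrow> nat"
  restr :: "'c \<Rightarrow> coord list \<Rightarrow> 'c"

definition is_cube_complex :: "'c cube_complex \<Rightarrow> bool" where
  "is_cube_complex X \<longleftrightarrow>
     (\<forall>c\<in>charts X. \<forall>m f. face_map m (cdim X c) f \<longrightarrow>
        restr X c f \<in> charts X \<and> cdim X (restr X c f) = m) \<and>
     (\<forall>c\<in>charts X. restr X c (id_face (cdim X c)) = c) \<and>
     (\<forall>c\<in>charts X. \<forall>m k f g. face_map m (cdim X c) f \<and> face_map k m g \<longrightarrow>
        restr X (restr X c f) g = restr X c (comp_face f g)) \<and>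
     (\<forall>c\<in>charts X. \<forall>f. face_map (cdim X c) (cdim X c) f \<and> restr X c f = c \<longrightarrow>
        f = id_face (cdim X c))"

definition vertices :: "'c cube_complex \<Rightarrow> 'c set" where
  "vertices X = {c \<in> charts X. cdim X c = 0}"

definition oriented_edges :: "'c cube_complex \<Rightarrow> 'c set" where
  "oriented_edges X = {c \<in> charts X. cdim X c = 1}"

definition squares :: "'c cube_complex \<Rightarrow> 'c set" where
  "squares X = {c \<in> charts X. cdim X c = 2}"

definition rev_edge :: "'c cube_complex \<Rightarrow> 'c \<Rightarrow> 'c" where
  "rev_edge X e = restr X e [Coord 0 True]"

definition initial :: "'c cube_complex \<Rightarrow> 'c \<Rightarrow> 'c" where
  "initial X e = restr X e [End False]"

definition terminal :: "'c cube_complex \<Rightarrow> 'c \<Rightarrow> 'c" where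
  "terminal X e = restr X e [End True]"


subsection \<open>Links and nonpositive curvature\<close>

text \<open>
  The vertices of the link of \<open>v\<close> are the oriented edges with initial vertex \<open>v\<close>. A chart \<open>c\<close> with
  origin \<open>v\<close> represents a corner of a cube at \<open>v\<close>, that is, a simplex of the link, with vertices
  \<open>axes X c\<close>. Since the charts at one corner differ by permutations of the coordinates,
  the link is a simplicial complex iff the axes of each chart are distinct and determine the chart.
\<close>

definition origin :: "'c cube_complex \<Rightarrow> 'c \<Rightarrow> 'c" where
  "origin X c = restr X c (replicate (cdim X c) (End False))"

definition axes :: "'c cube_complex \<Rightarrow> 'c \<Rightarrow> 'c list" where
  "axes X c = map (\<lambda>i. restr X c ((replicate (cdim X c) (End False))[i := Coord 0 False]))
                  [0..<cdim X c]"

definition form_corner :: "'c cube_complex \<Rightarrow> 'c \<Rightarrow> 'c \<Rightarrow> bool" where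
  "form_corner X e e' \<longleftrightarrow> e \<noteq> e' \<and> (\<exists>s\<in>squares X. axes X s = [e, e'])"

definition link_vertices :: "'c cube_complex \<Rightarrow> 'c \<Rightarrow> 'c set" where
  "link_vertices X v = {e \<in> oriented_edges X. initial X e = v}"

definition link_simplices :: "'c cube_complex \<Rightarrow> 'c \<Rightarrow> 'c set set" where
  "link_simplices X v = {set (axes X c) | c. c \<in> charts X \<and> cdim X c > 0 \<and> origin X c = v}"

definition simplicial_link :: "'c cube_complex \<Rightarrow> 'c \<Rightarrow> bool" where
  "simplicial_link X v \<longleftrightarrow>
     (\<forall>c\<in>charts X. origin X c = v \<longrightarrow> distinct (axes X c)) \<and>
     (\<forall>c\<in>charts X. \<forall>c'\<in>charts X.
        origin X c = v \<and> origin X c' = v \<and> axes X c = axes X c' \<longrightarrow> c = c')"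

definition flag_link :: "'c cube_complex \<Rightarrow> 'c \<Rightarrow> bool" where
  "flag_link X v \<longleftrightarrow>
     (\<forall>S. finite S \<and> S \<noteq> {} \<and> S \<subseteq> link_vertices X v \<and>
          (\<forall>e\<in>S. \<forall>e'\<in>S. e \<noteq> e' \<longrightarrow> form_corner X e e') \<longrightarrow> S \<in> link_simplices X v)"

definition nonpositively_curved :: "'c cube_complex \<Rightarrow> bool" where
  "nonpositively_curved X \<longleftrightarrow>
     is_cube_complex X \<and> (\<forall>v\<in>vertices X. simplicial_link X v \<and> flag_link X v)"


subsection \<open>Hyperplanes and special cube complexes\<close>

text \<open>
  \<open>parallel X e e'\<close>: opposite edges of a square, oriented consistently. A hyperplane is the
  set of all its dual edges, each with both orientations.
\<close>

definition parallel :: "'c cube_complex \<Rightarrow> 'c \<Rightarrow> 'c \<Rightarrow> bool" where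
  "parallel X e e' \<longleftrightarrow>
     (\<exists>s\<in>squares X. e = restr X s [Coord 0 False, End False] \<and>
                     e' = restr X s [Coord 0 False, End True])"

definition same_hyperplane :: "'c cube_complex \<Rightarrow> 'c \<Rightarrow> 'c \<Rightarrow> bool" where
  "same_hyperplane X =
     equivclp (\<lambda>e e'. parallel X e e' \<or> (e \<in> oriented_edges X \<and> e' = rev_edge X e))"

definition hyperplanes :: "'c cube_complex \<Rightarrow> 'c set set" where
  "hyperplanes X = {{e'. same_hyperplane X e e'} | e. e \<in> oriented_edges X}"

definition cross :: "'c cube_complex \<Rightarrow> 'c set \<Rightarrow> 'c set \<Rightarrow> bool" where
  "cross X A B \<longleftrightarrow> (\<exists>e\<in>A. \<exists>e'\<in>B. form_corner X e e')"

definition consistent_orientation :: "'c cube_complex \<Rightarrow> 'c set \<Rightarrow> 'c set \<Rightarrow> bool" where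
  "consistent_orientation X A S \<longleftrightarrow>
     S \<subseteq> A \<and> (\<forall>e\<in>A. (e \<in> S) \<noteq> (rev_edge X e \<in> S)) \<and>
     (\<forall>e e'. e \<in> S \<and> parallel X e e' \<longrightarrow> e' \<in> S)"

definition two_sided :: "'c cube_complex \<Rightarrow> 'c set \<Rightarrow> bool" where
  "two_sided X A \<longleftrightarrow> (\<exists>S. consistent_orientation X A S)"

definition directly_self_osculates :: "'c cube_complex \<Rightarrow> 'c set \<Rightarrow> bool" where
  "directly_self_osculates X A \<longleftrightarrow>
     (\<exists>S. consistent_orientation X A S \<and>
       (\<exists>e\<in>S. \<exists>e'\<in>S. e \<noteq> e' \<and>
         (initial X e = initial X e' \<and> \<not> form_corner X e e' \<or>
          terminal X e = terminal X e' \<and> \<not> form_corner X (rev_edge X e) (rev_edge X e'))))"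

definition inter_osculate :: "'c cube_complex \<Rightarrow> 'c set \<Rightarrow> 'c set \<Rightarrow> bool" where
  "inter_osculate X A B \<longleftrightarrow>
     A \<noteq> B \<and> cross X A B \<and>
     (\<exists>e\<in>A. \<exists>e'\<in>B. initial X e = initial X e' \<and> \<not> form_corner X e e')"

definition special :: "'c cube_complex \<Rightarrow> bool" where
  "special X \<longleftrightarrow>
     nonpositively_curved X \<and>
     (\<forall>A\<in>hyperplanes X. \<not> cross X A A) \<and>
     (\<forall>A\<in>hyperplanes X. two_sided X A) \<and>
     (\<forall>A\<in>hyperplanes X. \<not> directly_self_osculates X A) \<and>
     (\<forall>A\<in>hyperplanes X. \<forall>B\<in>hyperplanes X. \<not> inter_osculate X A B)"


subsection \<open>Geometric realization and its length metric\<close>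

definition glue :: "'c cube_complex \<Rightarrow> 'c \<times> real list \<Rightarrow> 'c \<times> real list \<Rightarrow> bool" where
  "glue X p q \<longleftrightarrow>
     (\<exists>c\<in>charts X. \<exists>m f t. face_map m (cdim X c) f \<and> t \<in> std_cube m \<and>
        p = (restr X c f, t) \<and> q = (c, apply_face f t))"

definition point :: "'c cube_complex \<Rightarrow> 'c \<Rightarrow> real list \<Rightarrow> ('c \<times> real list) set" where
  "point X c t = {q. equivclp (glue X) (c, t) q}"

definition realization :: "'c cube_complex \<Rightarrow> ('c \<times> real list) set set" where
  "realization X = {point X c t | c t. c \<in> charts X \<and> t \<in> std_cube (cdim X c)}"

text \<open>\<open>strung X p l q\<close>: some string of points from \<open>p\<close> to \<open>q\<close>, any two consecutive ones lying in a
  common cube, has length \<open>l\<close>.\<close>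

inductive strung ::
    "'c cube_complex \<Rightarrow> ('c \<times> real list) set \<Rightarrow> real \<Rightarrow> ('c \<times> real list) set \<Rightarrow> bool"
  for X where
  refl: "p \<in> realization X \<Longrightarrow> strung X p 0 p"
| step: "\<lbrakk>strung X p l (point X c t); c \<in> charts X; t \<in> std_cube (cdim X c);
          t' \<in> std_cube (cdim X c)\<rbrakk> \<Longrightarrow> strung X p (l + eucl_dist t t') (point X c t')"

definition cube_connected :: "'c cube_complex \<Rightarrow> bool" where
  "cube_connected X \<longleftrightarrow> (\<forall>p\<in>realization X. \<forall>q\<in>realization X. \<exists>l. strung X p l q)"

text \<open>The locale \<open>Metric_space\<close> constrains distances off the carrier too, hence the value 0 there.\<close>

definition cube_dist ::
    "'c cube_complex \<Rightarrow> ('c \<times> real list) set \<Rightarrow> ('c \<times> real list) set \<Rightarrow> real" where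
  "cube_dist X p q =
     (if p \<in> realization X \<and> q \<in> realization X then Inf {l. strung X p l q} else 0)"


subsection \<open>CAT(0) cube complexes\<close>

definition geodesic :: "'p set \<Rightarrow> ('p \<Rightarrow> 'p \<Rightarrow> real) \<Rightarrow> 'p \<Rightarrow> 'p \<Rightarrow> (real \<Rightarrow> 'p) \<Rightarrow> bool" where
  "geodesic M d x y \<gamma> \<longleftrightarrow>
     \<gamma> \<in> {0..d x y} \<rightarrow> M \<and> \<gamma> 0 = x \<and> \<gamma> (d x y) = y \<and>
     (\<forall>s\<in>{0..d x y}. \<forall>t\<in>{0..d x y}. d (\<gamma> s) (\<gamma> t) = \<bar>s - t\<bar>)"

text \<open>Any two points on different sides of a geodesic triangle lie on the two sides at
  some vertex \<open>x\<close>; \<open>a, b, c\<close> are the vertices of a comparison triangle.\<close>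

definition CAT0 :: "'p set \<Rightarrow> ('p \<Rightarrow> 'p \<Rightarrow> real) \<Rightarrow> bool" where
  "CAT0 M d \<longleftrightarrow>
     Metric_space M d \<and>
     (\<forall>x\<in>M. \<forall>y\<in>M. \<exists>\<gamma>. geodesic M d x y \<gamma>) \<and>
     (\<forall>x\<in>M. \<forall>y\<in>M. \<forall>z\<in>M. \<forall>\<gamma> \<sigma>. geodesic M d x y \<gamma> \<and> geodesic M d x z \<sigma> \<longrightarrow>
       (\<forall>a b c :: real^2. dist a b = d x y \<and> dist a c = d x z \<and> dist b c = d y z \<longrightarrow>
         (\<forall>s\<in>{0..d x y}. \<forall>t\<in>{0..d x z}.
            d (\<gamma> s) (\<sigma> t) \<le> dist (a + (s / d x y) *\<^sub>R (b - a)) (a + (t / d x z) *\<^sub>R (c - a)))))"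

definition CAT0_cube_complex :: "'c cube_complex \<Rightarrow> bool" where
  "CAT0_cube_complex X \<longleftrightarrow>
     is_cube_complex X \<and> charts X \<noteq> {} \<and> cube_connected X \<and> CAT0 (realization X) (cube_dist X)"


section \<open>Group actions on cube complexes\<close>

definition cubical_action ::
    "('a, 'b) monoid_scheme \<Rightarrow> 'c cube_complex \<Rightarrow> ('a \<Rightarrow> 'c \<Rightarrow> 'c) \<Rightarrow> bool" where
  "cubical_action H X \<phi> \<longleftrightarrow>
     group_action H (charts X) \<phi> \<and>
     (\<forall>g\<in>carrier H. \<forall>c\<in>charts X. cdim X (\<phi> g c) = cdim X c \<and>
        (\<forall>m f. face_map m (cdim X c) f \<longrightarrow> \<phi> g (restr X c f) = restr X (\<phi> g c) f))"

definition act_point ::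
    "('a \<Rightarrow> 'c \<Rightarrow> 'c) \<Rightarrow> 'a \<Rightarrow> ('c \<times> real list) set \<Rightarrow> ('c \<times> real list) set" where
  "act_point \<phi> g p = (\<lambda>(c, t). (\<phi> g c, t)) ` p"

definition free_action ::
    "('a, 'b) monoid_scheme \<Rightarrow> 'c cube_complex \<Rightarrow> ('a \<Rightarrow> 'c \<Rightarrow> 'c) \<Rightarrow> bool" where
  "free_action H X \<phi> \<longleftrightarrow>
     (\<forall>g\<in>carrier H. \<forall>p\<in>realization X. act_point \<phi> g p = p \<longrightarrow> g = \<one>\<^bsub>H\<^esub>)"

definition compact_in_complex :: "'c cube_complex \<Rightarrow> ('c \<times> real list) set set \<Rightarrow> bool" where
  "compact_in_complex X K \<longleftrightarrow>
     compactin (Metric_space.mtopology (realization X) (cube_dist X)) K"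

definition proper_action ::
    "('a, 'b) monoid_scheme \<Rightarrow> 'c cube_complex \<Rightarrow> ('a \<Rightarrow> 'c \<Rightarrow> 'c) \<Rightarrow> bool" where
  "proper_action H X \<phi> \<longleftrightarrow>
     (\<forall>K. compact_in_complex X K \<longrightarrow> finite {g \<in> carrier H. act_point \<phi> g ` K \<inter> K \<noteq> {}})"

definition cocompact_action ::
    "('a, 'b) monoid_scheme \<Rightarrow> 'c cube_complex \<Rightarrow> ('a \<Rightarrow> 'c \<Rightarrow> 'c) \<Rightarrow> bool" where
  "cocompact_action H X \<phi> \<longleftrightarrow>
     (\<exists>K. compact_in_complex X K \<and> (\<Union>g\<in>carrier H. act_point \<phi> g ` K) = realization X)"

text \<open>For a free action an orbit of charts is a chart of the quotient. All members of an
  orbit have the same dimension, and restriction maps orbits onto orbits.\<close>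

definition quotient_complex ::
    "('a, 'b) monoid_scheme \<Rightarrow> 'c cube_complex \<Rightarrow> ('a \<Rightarrow> 'c \<Rightarrow> 'c) \<Rightarrow> 'c set cube_complex" where
  "quotient_complex H X \<phi> =
     \<lparr> charts = orbits H (charts X) \<phi>,
       cdim = (\<lambda>C. the_elem (cdim X ` C)),
       restr = (\<lambda>C f. (\<lambda>c. restr X c f) ` C) \<rparr>"


section \<open>Virtually special groups\<close>

definition finite_index_subgroup :: "'a set \<Rightarrow> ('a, 'b) monoid_scheme \<Rightarrow> bool" where
  "finite_index_subgroup H G \<longleftrightarrow> subgroup H G \<and> finite (rcosets\<^bsub>G\<^esub> H)"

text \<open>The type argument is the type from which the charts of the CAT(0) cube complex are drawn. HOL
  cannot quantify existentially over types: a theorem assuming \<open>virtually_special TYPE('c) G\<close>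
  with \<open>'c\<close> a type variable covers complexes over arbitrary types.\<close>

definition virtually_special :: "'c itself \<Rightarrow> ('a, 'b) monoid_scheme \<Rightarrow> bool" where
  "virtually_special T G \<longleftrightarrow>
     (\<exists>H\<^sub>0 (X :: 'c cube_complex) \<phi>.
        finite_index_subgroup H\<^sub>0 G \<and>
        CAT0_cube_complex X \<and>
        cubical_action (G\<lparr>carrier := H\<^sub>0\<rparr>) X \<phi> \<and>
        free_action (G\<lparr>carrier := H\<^sub>0\<rparr>) X \<phi> \<and>
        proper_action (G\<lparr>carrier := H\<^sub>0\<rparr>) X \<phi> \<and>
        cocompact_action (G\<lparr>carrier := H\<^sub>0\<rparr>) X \<phi> \<and>
        special (quotient_complex (G\<lparr>carrier := H\<^sub>0\<rparr>) X \<phi>))"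


section \<open>Homeomorphism groups of the real line\<close>

definition smooth :: "(real \<Rightarrow> real) \<Rightarrow> bool" where
  "smooth f \<longleftrightarrow> (\<forall>n x. (deriv ^^ n) f differentiable (at x))"

definition Diff_plus :: "(real \<Rightarrow> real) monoid" where
  "Diff_plus =
     \<lparr> carrier = {f. bij f \<and> strict_mono f \<and> smooth f \<and> smooth (inv_into UNIV f)},
       monoid.mult = (\<circ>), one = id \<rparr>"

definition piecewise_linear :: "(real \<Rightarrow> real) \<Rightarrow> bool" where
  "piecewise_linear f \<longleftrightarrow>
     (\<exists>B. closed B \<and> discrete B \<and>
        (\<forall>a b. a < b \<and> {a<..<b} \<inter> B = {} \<longrightarrow>
           (\<exists>m k. \<forall>x\<in>{a<..<b}. f x = m * x + k)))"

definition PL_plus :: "(real \<Rightarrow> real) monoid" where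
  "PL_plus =
     \<lparr> carrier = {f. homeomorphism UNIV UNIV f (inv_into UNIV f) \<and> strict_mono f \<and> piecewise_linear f},
       monoid.mult = (\<circ>), one = id \<rparr>"

end

theory Submission
  imports Defs
begin

text \<open>
  Let \<open>H\<close> act on the CAT(0) cube complex \<open>X\<close> with special quotient \<open>Y\<close>, and label the oriented
  edges of \<open>X\<close> by the hyperplanes of \<open>Y\<close> together with a sign. Given homeomorphisms of the line, one
  for each label and commuting when their labels cross, the ordered product along an edge path of
  \<open>X\<close> depends only on its end points: crossing the midpoints of cube coordinates defines a local
  cocycle on the points of \<open>X\<close>, which integrates along geodesics. Hence the paths from a base
  vertex \<open>v\<close> to \<open>g v\<close> define a homomorphism from \<open>H\<close> to the homeomorphisms of the line.

  It is injective for a suitable choice. Since \<open>Y\<close> is special, a path from \<open>v\<close> to \<open>g v\<close> of minimal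
  length spells a reduced word of the right-angled Artin group of the crossing graph. Following
  Baik, Kim and Koberda, such a word is detected by a chain of overlapping intervals: each letter
  that does not commute with the previous link of the chain pushes a test point into the next
  interval, and the later letters cannot bring it back. There are finitely many labels by
  cocompactness, so one chain for every word can be placed along the line. The pushes may be taken
  smooth or piecewise linear.
\<close>

section \<open>Smooth functions\<close>

text \<open>Independence of the path would usually come from simple connectivity of the 2-skeleton.
  Here CAT(0) is a condition on the metric of the realization, so no homotopies of edge paths are at
  hand, only geodesics that contract. The product over edges is therefore recast as a transport
  between arbitrary nearby points: each label gets two 1-Lipschitz functions on the realization,
  \<open>dA\<close> and \<open>dB\<close>, which tell whether a point is near the midpoint of the
  coordinate with that label, and on which side of it.

  The resulting homomorphism is the one induced by the natural map from the quotient to the Salvetti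
  complex of the crossing graph, followed by an action of the right-angled Artin group on the line.
  That group is never formed; only its reduced words occur.\<close>

definition Ck :: "nat \<Rightarrow> (real \<Rightarrow> real) \<Rightarrow> bool" where
  "Ck n f \<longleftrightarrow> (\<forall>k<n. \<forall>x. (deriv ^^ k) f differentiable (at x))"

lemma smooth_iff_Ck: "smooth f \<longleftrightarrow> (\<forall>n. Ck n f)"
  unfolding smooth_def Ck_def by blast

text \<open>The index counts how often the function can be differentiated, so 0 asks nothing, and
  continuity of the last derivative is not part of \<open>Ck\<close>.\<close>

lemma Ck_0 [simp]: "Ck 0 f"
  by (simp add: Ck_def)

lemma Ck_Suc: "Ck (Suc n) f \<longleftrightarrow> (\<forall>x. f differentiable (at x)) \<and> Ck n (deriv f)"
  unfolding Ck_def
  by (auto simp: less_Suc_eq_0_disj funpow_Suc_right simp del: funpow.simps(2))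

lemma Ck_SucI:
  assumes "\<And>x. (f has_real_derivative f' x) (at x)" "Ck n f'"
  shows "Ck (Suc n) f"
proof -
  have "deriv f = f'" using assms(1) DERIV_imp_deriv by blast
  then show ?thesis using assms by (auto simp: Ck_Suc real_differentiable_def)
qed

lemma Ck_SucD:
  assumes "Ck (Suc n) f"
  shows "(f has_real_derivative deriv f x) (at x)" "Ck n (deriv f)"
  using assms DERIV_deriv_iff_real_differentiable by (auto simp: Ck_Suc)

lemma Ck_lower: "Ck (Suc n) f \<Longrightarrow> Ck n f"
  by (simp add: Ck_def)

lemma Ck_const: "Ck n (\<lambda>x. c)"
proof (induction n arbitrary: c)
  case (Suc n) show ?case by (rule Ck_SucI[where f' = "\<lambda>x. 0"]) (auto simp: Suc)
qed simp

lemma Ck_ident: "Ck n (\<lambda>x. x)"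
  by (cases n) (auto intro!: Ck_SucI[where f' = "\<lambda>x. 1"] Ck_const)

lemma Ck_add: "Ck n f \<Longrightarrow> Ck n g \<Longrightarrow> Ck n (\<lambda>x. f x + g x)"
proof (induction n arbitrary: f g)
  case (Suc n)
  note Ck_SucD[OF Suc.prems(1)] Ck_SucD[OF Suc.prems(2)]
  then show ?case by (intro Ck_SucI[where f' = "\<lambda>x. deriv f x + deriv g x"] Suc.IH DERIV_add)
qed simp

text \<open>The derivative contains the undifferentiated factors, needed at the lower order only;
  this closes the induction on \<open>n\<close>, and likewise for composites and
  reciprocals.\<close>

lemma Ck_mult: "Ck n f \<Longrightarrow> Ck n g \<Longrightarrow> Ck n (\<lambda>x. f x * g x)"
proof (induction n arbitrary: f g)
  case (Suc n)
  note D = Ck_SucD[OF Suc.prems(1)] Ck_SucD[OF Suc.prems(2)]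
    and L = Ck_lower[OF Suc.prems(1)] Ck_lower[OF Suc.prems(2)]
  show ?case
    by (rule Ck_SucI[where f' = "\<lambda>x. deriv f x * g x + deriv g x * f x"])
      (use DERIV_mult[OF D(1) D(3)] Ck_add[OF Suc.IH[OF D(2) L(2)] Suc.IH[OF D(4) L(1)]] in auto)
qed simp

lemma Ck_sum: "finite A \<Longrightarrow> (\<And>i. i \<in> A \<Longrightarrow> Ck n (f i)) \<Longrightarrow> Ck n (\<lambda>x. \<Sum>i\<in>A. f i x)"
  by (induction A rule: finite_induct) (auto intro!: Ck_const Ck_add)

lemma Ck_compose: "Ck n f \<Longrightarrow> Ck n g \<Longrightarrow> Ck n (\<lambda>x. f (g x))"
proof (induction n arbitrary: f g)
  case (Suc n)
  note D = Ck_SucD[OF Suc.prems(1)] Ck_SucD[OF Suc.prems(2)]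
    and L = Ck_lower[OF Suc.prems(1)] Ck_lower[OF Suc.prems(2)]
  show ?case
    by (rule Ck_SucI[where f' = "\<lambda>x. deriv f (g x) * deriv g x"])
      (use DERIV_chain2[OF D(1) D(3)] Ck_mult[OF Suc.IH[OF D(2) L(2)] D(4)] in auto)
qed simp

lemma Ck_inverse:
  assumes "Ck n f" "\<And>x. f x \<noteq> 0"
  shows "Ck n (\<lambda>x. inverse (f x))"
  using assms
proof (induction n arbitrary: f)
  case (Suc n)
  note D = Ck_SucD[OF Suc.prems(1)]
  have "Ck n (\<lambda>x. (- 1) * (inverse (f x) * deriv f x * inverse (f x)))"
    by (intro Ck_mult Ck_const Suc.IH D Ck_lower[OF Suc.prems(1)] Suc.prems(2))
  then show ?case
    by (rule Ck_SucI[rotated]) (use DERIV_inverse'[OF D(1) Suc.prems(2)] in simp)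
qed simp

text \<open>Derivatives of all orders agree on an open set once the functions do. This serves the
  maps \<open>Psi\<close>, which are finite sums of smooth terms only locally.\<close>

lemma Ck_local:
  assumes "Ck n g" "open U" "x \<in> U" "\<And>y. y \<in> U \<Longrightarrow> f y = g y" "k < n"
  shows "(deriv ^^ k) f differentiable (at x)"
proof -
  have eq: "\<forall>y\<in>U. (deriv ^^ j) f y = (deriv ^^ j) g y" for j
  proof (induction j)
    case (Suc j)
    show ?case
    proof
      fix y assume "y \<in> U"
      then have "eventually (\<lambda>z. (deriv ^^ j) f z = (deriv ^^ j) g z) (nhds y)"
        using Suc assms(2) eventually_nhds by blast
      then show "(deriv ^^ Suc j) f y = (deriv ^^ Suc j) g y" by (simp add: deriv_cong_ev)
    qed
  qed (use assms in simp)
  have "(deriv ^^ k) g differentiable (at x)" using assms by (simp add: Ck_def)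
  then have "(deriv ^^ k) g differentiable (at x within U)" by (rule differentiable_at_withinI)
  then have "(deriv ^^ k) f differentiable (at x within U)"
    by (rule differentiable_transform_within[where d = 1]) (use assms(3) eq in auto)
  then show ?thesis using at_within_open[OF assms(3,2)] by simp
qed

lemma smooth_comp: "smooth f \<Longrightarrow> smooth g \<Longrightarrow> smooth (f \<circ> g)"
  using Ck_compose[of _ f g] by (simp add: smooth_iff_Ck comp_def)

text \<open>Bootstrapping in h' = 1 / f'(h): every order of differentiability already known for
  \<open>h\<close> gives one more.\<close>

lemma smooth_inverse_function:
  fixes f h :: "real \<Rightarrow> real"
  assumes f: "smooth f" and pos: "\<And>x. deriv f x > 0"
    and fh: "\<And>x. f (h x) = x" and cont: "\<And>x. isCont h x"
  shows "smooth h"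
proof -
  have fd: "(f has_real_derivative deriv f x) (at x)" for x
    using f Ck_SucD(1) smooth_iff_Ck by blast
  have hd: "(h has_real_derivative inverse (deriv f (h x))) (at x)" for x
    by (rule DERIV_inverse_function[where f = f and a = "x - 1" and b = "x + 1"])
      (use fd fh cont pos[of "h x"] in auto)
  have "Ck n h" for n
  proof (induction n)
    case (Suc n)
    show ?case
    proof (rule Ck_SucI[OF hd])
      have "Ck n (deriv f)" using f Ck_SucD(2) by (simp add: smooth_iff_Ck)
      then show "Ck n (\<lambda>x. inverse (deriv f (h x)))"
        using Suc pos by (intro Ck_inverse Ck_compose[of n "deriv f" h]) (auto simp: less_le)
    qed
  qed simp
  then show ?thesis by (simp add: smooth_iff_Ck)
qed

section \<open>A flat function, bumps and small smooth pushes of the line\<close>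

definition flat_exp :: "real \<Rightarrow> real" where
  "flat_exp x = (if x > 0 then exp (- inverse x) else 0)"

text \<open>The functions p(1/x) exp(-1/x), extended by 0, are stable under differentiation: the
  chain rule produces the factor 1/x^2, which is the polynomial \<open>[:0,0,1:]\<close>, and p -
  p'. All derivatives of \<open>flat_exp\<close> are of this form.\<close>

lemma flat_poly_deriv:
  "((\<lambda>x. if x > 0 then poly p (inverse x) * exp (- inverse x) else 0) has_real_derivative
    (if x > 0 then poly ([:0,0,1:] * (p - pderiv p)) (inverse x) * exp (- inverse x) else 0)) (at x)"
  (is "(?f has_real_derivative _) _")
proof -
  consider "x > 0" | "x < 0" | "x = 0" by linarith
  then show ?thesis
  proof cases
    case 1
    have "((\<lambda>x. poly p (inverse x) * exp (- inverse x)) has_real_derivative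
       poly ([:0,0,1:] * (p - pderiv p)) (inverse x) * exp (- inverse x)) (at x)"
      (is "(_ has_real_derivative ?D) _")
    proof -
      have i: "(inverse has_real_derivative - (inverse x * inverse x)) (at x)"
        using DERIV_inverse[of x] 1 by (simp add: power2_eq_square)
      have a: "((\<lambda>x. poly p (inverse x)) has_real_derivative
          poly (pderiv p) (inverse x) * - (inverse x * inverse x)) (at x)"
        by (rule DERIV_chain2[OF poly_DERIV i])
      have b: "((\<lambda>x. exp (- inverse x)) has_real_derivative
          exp (- inverse x) * (inverse x * inverse x)) (at x)"
        using DERIV_chain2[OF DERIV_exp DERIV_minus[OF i]] by simp
      have "poly (pderiv p) (inverse x) * - (inverse x * inverse x) * exp (- inverse x) +
          exp (- inverse x) * (inverse x * inverse x) * poly p (inverse x) = ?D"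
        by (simp add: algebra_simps)
      then show ?thesis using DERIV_mult[OF a b] by simp
    qed
    then have "(?f has_real_derivative
       poly ([:0,0,1:] * (p - pderiv p)) (inverse x) * exp (- inverse x)) (at x)"
      by (rule has_field_derivative_transform_within_open[of _ _ _ "{0<..}"]) (use 1 in auto)
    then show ?thesis using 1 by simp
  next
    case 2
    have "(?f has_real_derivative 0) (at x)"
      by (rule has_field_derivative_transform_within_open[of "\<lambda>x. 0" _ _ "{..<0}"]) (use 2 in auto)
    then show ?thesis using 2 by simp
  next
    case 3
    \<comment> \<open>With t = 1/x the right difference quotient at 0 becomes t p(t) / exp t;
      \<open>pCons 0 p\<close> is X p.\<close>
    have "((\<lambda>t. poly (pCons 0 p) t / exp t) \<longlongrightarrow> 0) at_top"
    proof -
      have "((\<lambda>t. \<Sum>i\<le>degree (pCons 0 p). coeff (pCons 0 p) i * (t ^ i / exp t)) \<longlongrightarrow> 0) at_top"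
        by (intro tendsto_null_sum tendsto_mult_right_zero tendsto_power_div_exp_0)
      then show ?thesis by (simp add: poly_altdef sum_divide_distrib del: poly_pCons)
    qed
    then have "((\<lambda>y. poly (pCons 0 p) (inverse y) / exp (inverse y)) \<longlongrightarrow> 0) (at_right (0::real))"
      by (rule filterlim_compose[OF _ filterlim_inverse_at_top_right])
    then have "((\<lambda>y. (?f y - ?f 0) / (y - 0)) \<longlongrightarrow> 0) (at_right (0::real))"
      by (rule Lim_transform_eventually)
        (auto simp: eventually_at_right_field exp_minus field_simps intro!: exI[of _ 1])
    moreover have "((\<lambda>y. (?f y - ?f 0) / (y - 0)) \<longlongrightarrow> 0) (at_left (0::real))"
      by (rule Lim_transform_eventually[of "\<lambda>y. 0"])
        (auto simp: eventually_at_left_field intro!: exI[of _ "-1"])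
    ultimately have "((\<lambda>y. (?f y - ?f 0) / (y - 0)) \<longlongrightarrow> 0) (at 0)"
      by (simp add: filterlim_split_at)
    then have "(?f has_real_derivative 0) (at 0)"
      by (simp add: has_field_derivative_iff)
    then show ?thesis using 3 by simp
  qed
qed

lemma smooth_flat_exp: "smooth flat_exp"
proof -
  have "Ck n (\<lambda>x. if x > 0 then poly p (inverse x) * exp (- inverse x) else 0)" for n p
    by (induction n arbitrary: p) (auto intro!: Ck_SucI[OF flat_poly_deriv])
  from this[of _ 1] have "Ck n flat_exp" for n
    unfolding flat_exp_def[abs_def] by (simp cong: if_cong)
  then show ?thesis by (simp add: smooth_iff_Ck)
qed

lemma strict_mono_surj_continuous:
  fixes f :: "real \<Rightarrow> real"
  assumes "strict_mono f" "surj f"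
  shows "continuous_on UNIV f"
proof (rule continuous_onI_mono)
  show "open (range f)" using assms(2) by simp
  show "f x \<le> f y" if "x \<le> y" for x y using assms(1) that by (simp add: strict_mono_less_eq)
qed

text \<open>A right inverse is enough: strict monotonicity makes \<open>f\<close> injective, so the
  inverse is two-sided, and an increasing surjection of the line is continuous. For this reason
  pushes carry a single inverse law.\<close>

lemma increasing_bij_inverse:
  fixes f h :: "real \<Rightarrow> real"
  assumes "strict_mono f" "\<And>x. f (h x) = x"
  shows "h (f x) = x" "strict_mono h" "bij f" "inv_into UNIV f = h"
    "continuous_on UNIV f" "continuous_on UNIV h"
proof -
  show hf: "h (f x) = x" for x
    by (rule injD[OF strict_mono_imp_inj_on[OF assms(1)]]) (rule assms(2))
  show m: "strict_mono h"
  proof (rule strict_monoI)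
    fix x y :: real assume "x < y"
    then have "f (h x) < f (h y)" by (simp add: assms(2))
    then show "h x < h y" using strict_mono_less[OF assms(1)] by blast
  qed
  show b: "bij f" by (rule o_bij[of h]) (auto simp: assms hf fun_eq_iff)
  show "inv_into UNIV f = h" by (rule inv_unique_comp) (auto simp: assms hf fun_eq_iff)
  show "continuous_on UNIV f" using strict_mono_surj_continuous[OF assms(1)] b by (simp add: bij_is_surj)
  have "surj h" using hf by (metis surjI)
  then show "continuous_on UNIV h" using strict_mono_surj_continuous m by blast
qed

lemma smooth_bump_function:
  obtains \<phi> :: "real \<Rightarrow> real" and M where "smooth \<phi>" "\<And>x. x \<in> {0<..<3} \<Longrightarrow> \<phi> x > 0"
    "\<And>x. x \<notin> {0<..<3} \<Longrightarrow> \<phi> x = 0" "\<And>x. \<bar>deriv \<phi> x\<bar> \<le> M"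
proof -
  define \<phi> where "\<phi> = (\<lambda>x. flat_exp x * flat_exp (3 - x))"
  have "Ck n (\<lambda>x. 3 + (- 1) * x)" for n
    by (intro Ck_add Ck_mult Ck_const Ck_ident)
  then have C: "Ck n \<phi>" for n
    using Ck_mult[OF _ Ck_compose[of n flat_exp "\<lambda>x. 3 + (- 1) * x"]] smooth_flat_exp
    unfolding \<phi>_def smooth_iff_Ck by simp
  have pos: "\<phi> x > 0" if "x \<in> {0<..<3}" for x using that by (auto simp: \<phi>_def flat_exp_def)
  have zero: "\<phi> x = 0" if "x \<notin> {0<..<3}" for x using that by (auto simp: \<phi>_def flat_exp_def)
  have d0: "deriv \<phi> x = 0" if "x \<notin> {0..3}" for x
  proof -
    have "eventually (\<lambda>y. \<phi> y = 0) (nhds x)"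
      by (rule eventually_nhds_in_open[of "- {0..3}", THEN eventually_mono]) (use that zero in auto)
    then show ?thesis using deriv_cong_ev[of \<phi> "\<lambda>_. 0" x x] by simp
  qed
  have "Ck 1 (deriv \<phi>)" using C[of "Suc 1"] Ck_SucD(2) by blast
  then have "isCont (deriv \<phi>) x" for x using Ck_SucD(1)[of 0 "deriv \<phi>"] DERIV_isCont by (metis One_nat_def)
  then have "continuous_on {0..3} (deriv \<phi>)" by (simp add: continuous_at_imp_continuous_on)
  then have "bounded (deriv \<phi> ` {0..3})" by (intro compact_imp_bounded compact_continuous_image) auto
  then obtain M where M: "\<And>x. x \<in> {0..3} \<Longrightarrow> \<bar>deriv \<phi> x\<bar> \<le> M" unfolding bounded_iff by (auto simp del: atLeastAtMost_iff)
  have "\<bar>deriv \<phi> x\<bar> \<le> M" for x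
    using M[of x] M[of 0] d0[of x] by (cases "x \<in> {0..3}") auto
  then show ?thesis using that C pos zero smooth_iff_Ck by blast
qed

lemma smooth_small_push:
  obtains g h :: "real \<Rightarrow> real" where "smooth g" "smooth h" "strict_mono g" "\<And>x. g (h x) = x"
    "\<And>x. x \<notin> {0<..<3} \<Longrightarrow> g x = x" "\<And>x. x \<in> {0<..<3} \<Longrightarrow> g x > x"
proof -
  obtain \<phi> :: "real \<Rightarrow> real" and M where \<phi>: "smooth \<phi>" "\<And>x. x \<in> {0<..<3} \<Longrightarrow> \<phi> x > 0"
    "\<And>x. x \<notin> {0<..<3} \<Longrightarrow> \<phi> x = 0" "\<And>x. \<bar>deriv \<phi> x\<bar> \<le> M"
    using smooth_bump_function by blast
  have M: "M \<ge> 0" using \<phi>(4)[of 0] by linarith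
  \<comment> \<open>With this factor the slope of the added bump is at most M / (M + 1) < 1 in
    absolute value, so adding it to the identity leaves an increasing map.\<close>
  define \<epsilon> where "\<epsilon> = 1 / (M + 1)"
  have \<epsilon>: "\<epsilon> > 0" "\<epsilon> * M < 1" using M by (auto simp: \<epsilon>_def field_simps)
  define g where "g = (\<lambda>x. x + \<epsilon> * \<phi> x)"
  have gC: "smooth g" using \<phi>(1) unfolding g_def smooth_iff_Ck by (auto intro!: Ck_add Ck_mult Ck_const Ck_ident)
  have gd: "(g has_real_derivative 1 + \<epsilon> * deriv \<phi> x) (at x)" for x
  proof -
    have "(\<phi> has_real_derivative deriv \<phi> x) (at x)" using \<phi>(1) smooth_iff_Ck Ck_SucD(1) by blast
    then show ?thesis unfolding g_def by (auto intro!: derivative_eq_intros)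
  qed
  have pos: "1 + \<epsilon> * deriv \<phi> x > 0" for x
  proof -
    have "\<epsilon> * \<bar>deriv \<phi> x\<bar> \<le> \<epsilon> * M" using \<phi>(4) \<epsilon>(1) by simp
    moreover have "\<bar>\<epsilon> * deriv \<phi> x\<bar> = \<epsilon> * \<bar>deriv \<phi> x\<bar>" using \<epsilon> by (simp add: abs_mult)
    ultimately show ?thesis using \<epsilon>(2) by linarith
  qed
  have mono: "strict_mono g"
  proof (rule strict_monoI)
    fix x y :: real assume "x < y"
    then show "g x < g y" by (rule DERIV_pos_imp_increasing) (use gd pos in blast)
  qed
  have out: "g x = x" if "x \<notin> {0<..<3}" for x using \<phi>(3) that by (simp add: g_def)
  have "\<exists>x. g x = y" for y
  proof (cases "y \<in> {0..3}")
    case True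
    have "continuous_on {0..3} g"
      by (rule DERIV_continuous_on) (rule DERIV_subset[OF gd], simp)
    then show ?thesis using IVT'[of g 0 y 3] out[of 0] out[of 3] True by auto
  next
    case False
    then show ?thesis using out[of y] by auto
  qed
  then obtain h where h: "\<And>y. g (h y) = y" by metis
  have "isCont h x" for x using increasing_bij_inverse(6)[OF mono h] by (simp add: continuous_on_eq_continuous_at)
  moreover have "deriv g x > 0" for x using gd[THEN DERIV_imp_deriv] pos by simp
  ultimately have "smooth h" using smooth_inverse_function gC h by blast
  moreover have "g x > x" if "x \<in> {0<..<3}" for x using \<phi>(2)[OF that] \<epsilon> by (simp add: g_def)
  ultimately show ?thesis using that gC mono h out by blast
qed

section \<open>Chains of bumps\<close>

definition slot :: "nat \<Rightarrow> real set" where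
  "slot k = {2 * real k <..< 2 * real k + 3}"

lemma slot_overlap: "y \<in> slot j \<Longrightarrow> y \<in> slot k \<Longrightarrow> j = k \<or> k = Suc j \<or> j = Suc k"
  unfolding slot_def by auto

text \<open>Slots have length 3 and spacing 2, so a point at 5/2 or beyond in one slot stands at 1/2
  or beyond in the next. The bound \<open>half\<close> thus lets each push hand its point over to
  the following slot.\<close>

locale push =
  fixes \<beta> \<beta>' :: "real \<Rightarrow> real"
  assumes mono: "strict_mono \<beta>" and inv: "\<And>x. \<beta> (\<beta>' x) = x"
    and out: "\<And>x. x \<notin> {0<..<3} \<Longrightarrow> \<beta> x = x" and half: "\<beta> (1/2) \<ge> 5/2"
begin

definition bb :: "bool \<Rightarrow> real \<Rightarrow> real" where
  "bb s = (if s then \<beta> else \<beta>')"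

lemma bb_cancel: "bb s (bb (\<not> s) x) = x"
  unfolding bb_def using inv increasing_bij_inverse(1)[OF mono inv] by auto

lemma bb_mono: "strict_mono (bb s)"
  unfolding bb_def using mono increasing_bij_inverse(2)[OF mono inv] by auto

lemma bb_out: "x \<notin> {0<..<3} \<Longrightarrow> bb s x = x"
  unfolding bb_def using out increasing_bij_inverse(1)[OF mono inv] by metis

lemma bb_in: "x \<in> {0<..<3} \<Longrightarrow> bb s x \<in> {0<..<3}"
  using bb_mono[of s] bb_out[of 0 s] bb_out[of 3 s] unfolding strict_mono_def by fastforce

lemma bb_push: "x \<ge> 1/2 \<Longrightarrow> bb True x \<ge> 5/2"
  using mono half strict_mono_less_eq[of \<beta> "1/2" x] unfolding bb_def by simp

end

text \<open>
  A code assigns labelled, signed bumps to the slots; consecutive slots overlap and all others are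
  disjoint. Labels that cross have to receive disjoint supports, so that they commute.
\<close>

locale push_code = push \<beta> \<beta>' for \<beta> \<beta>' +
  fixes crs :: "'l \<Rightarrow> 'l \<Rightarrow> bool" and code :: "nat \<Rightarrow> ('l \<times> bool) option"
  assumes crs_sym: "crs x y \<Longrightarrow> crs y x" and crs_irrefl: "\<not> crs x x"
    and code_adj: "code k = Some (x, s) \<Longrightarrow> code (Suc k) = Some (x', s') \<Longrightarrow> x \<noteq> x' \<and> \<not> crs x x'"
begin

text \<open>The displacement of one bump rather than the bump itself, so that the bumps of a label
  combine by addition. The test \<open>s = \<sigma>\<close> makes the map for sign \<sigma> push
  forward in the slots that store \<sigma>, and backward in the other slots of the label.\<close>

definition term_at :: "bool \<Rightarrow> 'l \<Rightarrow> nat \<Rightarrow> real \<Rightarrow> real" where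
  "term_at \<sigma> x k y = (case code k of None \<Rightarrow> 0 | Some (x', s) \<Rightarrow>
     if x' = x then bb (s = \<sigma>) (y - 2 * real k) - (y - 2 * real k) else 0)"

text \<open>Slot \<open>k\<close> meets the point \<open>y\<close> only if 2 k < y, so the bound on
  \<open>k\<close> omits only zero terms and the sum is the total displacement by all bumps labelled
  \<open>x\<close>.\<close>

definition Psi :: "bool \<Rightarrow> 'l \<Rightarrow> real \<Rightarrow> real" where
  "Psi \<sigma> x y = y + (\<Sum>k<nat \<lceil>y\<rceil>. term_at \<sigma> x k y)"

definition supp :: "'l \<Rightarrow> real set" where
  "supp x = {y. \<exists>k s. code k = Some (x, s) \<and> y \<in> slot k}"

lemma term_at_nonzero: "term_at \<sigma> x k y \<noteq> 0 \<Longrightarrow> y \<in> slot k \<and> (\<exists>s. code k = Some (x, s))"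
proof -
  assume nz: "term_at \<sigma> x k y \<noteq> 0"
  then obtain s where s: "code k = Some (x, s)" "bb (s = \<sigma>) (y - 2 * real k) \<noteq> y - 2 * real k"
    by (auto simp: term_at_def split: option.splits if_splits prod.splits)
  then have "y - 2 * real k \<in> {0<..<3}" using bb_out by blast
  then show ?thesis using s(1) by (auto simp: slot_def)
qed

text \<open>Overlapping slots are equal or consecutive, and consecutive slots carry different
  labels. Hence at most one term of \<open>Psi\<close> is nonzero at any point.\<close>

lemma same_label_slot:
  assumes "code j = Some (x, s)" "code k = Some (x, t)" "y \<in> slot j" "y \<in> slot k"
  shows "j = k"
  using slot_overlap[OF assms(3,4)] code_adj assms(1,2) by blast

text \<open>The number of terms in \<open>Psi\<close> depends on the point; this gives one finite
  sum valid on a whole half-line, as local regularity requires.\<close>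

lemma Psi_eq_sum:
  assumes "y < 2 * real N"
  shows "Psi \<sigma> x y = y + (\<Sum>k<N. term_at \<sigma> x k y)"
proof -
  have z: "term_at \<sigma> x k y = 0" if "k \<ge> N \<or> k \<ge> nat \<lceil>y\<rceil>" for k
  proof (rule ccontr)
    assume "term_at \<sigma> x k y \<noteq> 0"
    then have "2 * real k < y" using term_at_nonzero by (auto simp: slot_def)
    then show False using that assms by linarith
  qed
  have "(\<Sum>k<N. term_at \<sigma> x k y) = (\<Sum>k<max N (nat \<lceil>y\<rceil>). term_at \<sigma> x k y)"
    by (rule sum.mono_neutral_left) (use z in auto)
  moreover have "(\<Sum>k<nat \<lceil>y\<rceil>. term_at \<sigma> x k y) = (\<Sum>k<max N (nat \<lceil>y\<rceil>). term_at \<sigma> x k y)"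
    by (rule sum.mono_neutral_left) (use z in auto)
  ultimately show ?thesis by (simp add: Psi_def)
qed

lemma Psi_slot:
  assumes "code k = Some (x, s)" "y \<in> slot k"
  shows "Psi \<sigma> x y = bb (s = \<sigma>) (y - 2 * real k) + 2 * real k"
proof -
  define N where "N = k + 2"
  have N: "y < 2 * real N" "k \<in> {..<N}" using assms(2) by (auto simp: slot_def N_def)
  have "term_at \<sigma> x j y = 0" if "j \<noteq> k" for j
    using term_at_nonzero[of \<sigma> x j y] same_label_slot assms that by metis
  then have "(\<Sum>j<N. term_at \<sigma> x j y) = (\<Sum>j\<in>{k}. term_at \<sigma> x j y)"
    by (intro sum.mono_neutral_right) (use N in auto)
  then show ?thesis using Psi_eq_sum[OF N(1)] assms(1) by (simp add: term_at_def)
qed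

lemma Psi_out: "y \<notin> supp x \<Longrightarrow> Psi \<sigma> x y = y"
proof -
  assume "y \<notin> supp x"
  then have "term_at \<sigma> x k y = 0" for k using term_at_nonzero[of \<sigma> x k y] by (auto simp: supp_def)
  then show ?thesis by (simp add: Psi_def)
qed

lemma Psi_in_slot:
  assumes "code k = Some (x, s)" "y \<in> slot k"
  shows "Psi \<sigma> x y \<in> slot k"
  using bb_in[of "y - 2 * real k" "s = \<sigma>"] assms(2) unfolding Psi_slot[OF assms] by (auto simp: slot_def)

lemma Psi_supp: "y \<in> supp x \<Longrightarrow> Psi \<sigma> x y \<in> supp x"
  using Psi_in_slot by (auto simp: supp_def)

lemma Psi_cancel: "Psi \<sigma> x (Psi (\<not> \<sigma>) x y) = y"
proof (cases "y \<in> supp x")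
  case True
  then obtain k s where k: "code k = Some (x, s)" "y \<in> slot k" by (auto simp: supp_def)
  have "bb (s = \<sigma>) (bb (s = (\<not> \<sigma>)) z) = z" for z
    using bb_cancel[of True z] bb_cancel[of False z] by (cases s; cases \<sigma>) auto
  then show ?thesis
    using Psi_slot[OF k(1) Psi_in_slot[OF k], of \<sigma> "\<not> \<sigma>"] Psi_slot[OF k, of "\<not> \<sigma>"]
    by simp
qed (simp add: Psi_out)

text \<open>Crossing labels share no slot, as no label crosses itself, and never occupy consecutive
  slots, by \<open>code_adj\<close>; all other pairs of slots are disjoint.\<close>

lemma supp_disjoint: "crs x x' \<Longrightarrow> supp x \<inter> supp x' = {}"
proof (rule ccontr)
  assume c: "crs x x'" and "supp x \<inter> supp x' \<noteq> {}"
  then obtain y j s k t where *: "code j = Some (x, s)" "code k = Some (x', t)" "y \<in> slot j" "y \<in> slot k"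
    by (auto simp: supp_def)
  from slot_overlap[OF *(3,4)] show False
    using * c code_adj[of j x s x' t] code_adj[of k x' t x s] crs_sym crs_irrefl by auto
qed

text \<open>\<open>Psi\<close> is increasing inside each slot of its label, maps the slot into
  itself and is the identity outside. As these slots are pairwise disjoint, the order of two points
  is preserved wherever they lie.\<close>

lemma Psi_strict_mono: "strict_mono (Psi \<sigma> x)"
proof (rule strict_monoI)
  fix y z :: real assume yz: "y < z"
  have disj: "j = k \<or> 2 * real j + 3 \<le> 2 * real k \<or> 2 * real k + 3 \<le> 2 * real j"
    if "code j = Some (x, s)" "code k = Some (x, t)" for j k s t
  proof -
    have "j \<noteq> Suc k" "k \<noteq> Suc j" using that code_adj by blast+
    then show ?thesis by linarith
  qed
  consider (a) "y \<notin> supp x" "z \<notin> supp x" | (b) "y \<in> supp x" "z \<notin> supp x"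
    | (c) "y \<notin> supp x" "z \<in> supp x" | (d) "y \<in> supp x" "z \<in> supp x" by blast
  then show "Psi \<sigma> x y < Psi \<sigma> x z"
  proof cases
    case a then show ?thesis using yz by (simp add: Psi_out)
  next
    case b
    then obtain k s where k: "code k = Some (x, s)" "y \<in> slot k" by (auto simp: supp_def)
    have "z \<notin> slot k" using b k by (auto simp: supp_def)
    then have "2 * real k + 3 \<le> z" using k yz by (auto simp: slot_def)
    then show ?thesis using b Psi_in_slot[OF k, of \<sigma>] by (auto simp: Psi_out slot_def)
  next
    case c
    then obtain k s where k: "code k = Some (x, s)" "z \<in> slot k" by (auto simp: supp_def)
    have "y \<notin> slot k" using c k by (auto simp: supp_def)
    then have "y \<le> 2 * real k" using k yz by (auto simp: slot_def)
    then show ?thesis using c Psi_in_slot[OF k, of \<sigma>] by (auto simp: Psi_out slot_def)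
  next
    case d
    then obtain j s k t where j: "code j = Some (x, s)" "y \<in> slot j" and k: "code k = Some (x, t)" "z \<in> slot k"
      by (auto simp: supp_def)
    from disj[OF j(1) k(1)] show ?thesis
    proof (elim disjE)
      assume [simp]: "j = k"
      then have "s = t" using j k by simp
      then show ?thesis using Psi_slot[OF j, of \<sigma>] Psi_slot[OF k, of \<sigma>] yz bb_mono[of "t = \<sigma>"]
        by (auto simp: strict_mono_def)
    next
      assume "2 * real j + 3 \<le> 2 * real k"
      then show ?thesis using Psi_in_slot[OF j, of \<sigma>] Psi_in_slot[OF k, of \<sigma>] by (auto simp: slot_def)
    next
      assume "2 * real k + 3 \<le> 2 * real j"
      then show ?thesis using j(2) k(2) yz by (auto simp: slot_def)
    qed
  qed
qed

lemma Psi_inverse: "inv_into UNIV (Psi \<sigma> x) = Psi (\<not> \<sigma>) x" "bij (Psi \<sigma> x)"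
  using increasing_bij_inverse[OF Psi_strict_mono[of \<sigma> x] Psi_cancel[of \<sigma> x]] by blast+

end

text \<open>\<open>reduced\<close> is reducedness of words in the right-angled Artin group whose commuting generators are the
  crossing labels.\<close>

definition reduced :: "('l \<Rightarrow> 'l \<Rightarrow> bool) \<Rightarrow> ('l \<times> bool) list \<Rightarrow> bool" where
  "reduced crs w \<longleftrightarrow>
     (\<nexists>u x s v t. w = u @ (x, s) # v @ (x, \<not> s) # t \<and> (\<forall>z\<in>set v. crs x (fst z)))"

text \<open>In the product along a path the last letter acts first, so the word is read backwards
  when it is applied to a point.\<close>

lemma reduced_rev:
  assumes "reduced crs w"
  shows "reduced crs (rev w)"
  unfolding reduced_def
proof (safe)
  fix u x s v t assume w: "rev w = u @ (x, s) # v @ (x, \<not> s) # t" and v: "\<forall>z\<in>set v. crs x (fst z)"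
  have "w = rev (u @ (x, s) # v @ (x, \<not> s) # t)" using w by (metis rev_rev_ident)
  then have "w = rev t @ (x, \<not> s) # rev v @ (x, \<not> \<not> s) # rev u" by simp
  moreover have "\<forall>z\<in>set (rev v). crs x (fst z)" using v by simp
  ultimately show False using assms unfolding reduced_def by blast
qed

lemma reduced_suffix: "reduced crs (u @ w) \<Longrightarrow> reduced crs w"
  unfolding reduced_def by (metis append.assoc)

text \<open>The slots that a test point visits: letters equal to the current label or commuting with
  it leave the point where it is and add no link; any other letter opens the next link.\<close>

fun pchain :: "('l \<Rightarrow> 'l \<Rightarrow> bool) \<Rightarrow> 'l \<Rightarrow> bool \<Rightarrow> ('l \<times> bool) list \<Rightarrow> ('l \<times> bool) list" where
  "pchain crs y s [] = [(y, s)]"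
| "pchain crs y s ((x, \<sigma>) # w) =
     (if x = y \<or> crs y x then pchain crs y s w else (y, s) # pchain crs x \<sigma> w)"

text \<open>Once the point has reached the slot of the current label, only an opposite letter of
  that label could pull it back; hence the condition on signs.\<close>

fun persistent :: "('l \<Rightarrow> 'l \<Rightarrow> bool) \<Rightarrow> 'l \<Rightarrow> bool \<Rightarrow> ('l \<times> bool) list \<Rightarrow> bool" where
  "persistent crs y s [] = True"
| "persistent crs y s ((x, \<sigma>) # w) =
     (if x = y then \<sigma> = s \<and> persistent crs y s w
      else if crs y x then persistent crs y s w else persistent crs x \<sigma> w)"

text \<open>\<open>v\<close> holds the letters read since the last occurrence of \<open>y\<close>.
  All commute with \<open>y\<close>, so meeting \<open>y\<close> with the opposite sign would
  complete a forbidden pair. A repeated or new current letter restarts with \<open>v\<close> empty,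
  by passing to a suffix.\<close>

lemma reduced_persistent:
  assumes "reduced crs ((y, s) # v @ w)" "\<forall>z\<in>set v. crs y (fst z)"
  shows "persistent crs y s w"
  using assms
proof (induction w arbitrary: y s v)
  case (Cons a w)
  obtain x \<sigma> where a: "a = (x, \<sigma>)" by force
  consider "x = y" | "x \<noteq> y" "crs y x" | "x \<noteq> y" "\<not> crs y x" by blast
  then show ?case
  proof cases
    case 1
    have "\<sigma> = s"
    proof (rule ccontr)
      assume "\<sigma> \<noteq> s"
      then have "(y, s) # v @ a # w = [] @ (y, s) # v @ (y, \<not> s) # w" using a 1 by simp
      then show False using Cons.prems unfolding reduced_def by blast
    qed
    moreover have "reduced crs ((y, s) # [] @ w)"
      using reduced_suffix[of crs "(y, s) # v" "a # w"] Cons.prems(1) a 1 \<open>\<sigma> = s\<close> by simp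
    ultimately show ?thesis using Cons.IH[of y s "[]"] a 1 by simp
  next
    case 2
    then show ?thesis using Cons.IH[of y s "v @ [a]"] Cons.prems a by simp
  next
    case 3
    have "reduced crs ((x, \<sigma>) # [] @ w)"
      using reduced_suffix[of crs "(y, s) # v" "a # w"] Cons.prems(1) a by simp
    then show ?thesis using Cons.IH[of x \<sigma> "[]"] a 3 by simp
  qed
qed simp

lemma pchain_Cons: "\<exists>r. pchain crs y s w = (y, s) # r"
  by (induction w arbitrary: y s) auto

lemma pchain_adj:
  "Suc i < length (pchain crs y s w) \<Longrightarrow>
     fst (pchain crs y s w ! i) \<noteq> fst (pchain crs y s w ! Suc i) \<and>
     \<not> crs (fst (pchain crs y s w ! i)) (fst (pchain crs y s w ! Suc i))"
proof (induction w arbitrary: y s i)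
  case (Cons a w)
  obtain x \<sigma> where a: "a = (x, \<sigma>)" by force
  obtain r where r: "pchain crs x \<sigma> w = (x, \<sigma>) # r" using pchain_Cons[of crs x \<sigma> w] by blast
  show ?case
  proof (cases i)
    case 0
    then show ?thesis using Cons a r by auto
  next
    case (Suc j)
    then show ?thesis using Cons.IH[of j x \<sigma>] Cons.IH[of i y s] Cons.prems a by auto
  qed
qed simp

context push_code
begin

text \<open>The point waits in the right part of the slot of the current label until the first letter not
  commuting with that label pushes it on; letters crossing the current label live elsewhere.\<close>

lemma chain_push:
  assumes "persistent crs y s w" "\<And>i. i < length (pchain crs y s w) \<Longrightarrow> code (K + i) = Some (pchain crs y s w ! i)"
    and "p \<in> {2 * real K + 5/2 ..< 2 * real K + 3}"
  shows "fold (\<lambda>(x, \<sigma>). Psi \<sigma> x) w p \<ge> 2 * real K + 5/2"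
  using assms
proof (induction w arbitrary: y s K p)
  case (Cons a w)
  obtain x \<sigma> where a: "a = (x, \<sigma>)" by force
  obtain r where r: "pchain crs y s (a # w) = (y, s) # r" using pchain_Cons[of crs y s "a # w"] by blast
  have K: "code K = Some (y, s)" using Cons.prems(2)[of 0] r by simp
  have pK: "p \<in> slot K" using Cons.prems(3) by (auto simp: slot_def)
  \<comment> \<open>The slot stores the sign of the letter, so \<open>Psi\<close> acts there by the
    forward push \<beta> for either sign.\<close>
  have push: "Psi \<sigma> x q \<in> {2 * real J + 5/2 ..< 2 * real J + 3}"
    if "code J = Some (x, \<sigma>)" "q \<in> slot J" "q \<ge> 2 * real J + 1/2" for q J
    using Psi_slot[OF that(1,2), of \<sigma>] Psi_in_slot[OF that(1,2), of \<sigma>] bb_push[of "q - 2 * real J"] that(3)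
    by (auto simp: slot_def)
  consider (same) "x = y" | (com) "x \<noteq> y" "crs y x" | (new) "x \<noteq> y" "\<not> crs y x" by blast
  then show ?case
  proof cases
    case same
    then have "\<sigma> = s" using Cons.prems(1) a by simp
    then have "Psi \<sigma> x p \<in> {2 * real K + 5/2 ..< 2 * real K + 3}"
      using push[of K p] K same pK Cons.prems(3) by auto
    then show ?thesis using Cons.IH[of y s K] Cons.prems a same by simp
  next
    case com
    have "p \<notin> supp x"
    proof
      assume "p \<in> supp x"
      then have "p \<in> supp x \<inter> supp y" using K pK by (auto simp: supp_def)
      then show False using supp_disjoint[OF crs_sym[OF com(2)]] by blast
    qed
    then show ?thesis using Cons.IH[of y s K p] Cons.prems a com by (simp add: Psi_out)
  next
    case new
    have c: "code (Suc K + i) = Some (pchain crs x \<sigma> w ! i)" if "i < length (pchain crs x \<sigma> w)" for i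
      using Cons.prems(2)[of "Suc i"] that a new by simp
    obtain r' where r': "pchain crs x \<sigma> w = (x, \<sigma>) # r'" using pchain_Cons[of crs x \<sigma> w] by blast
    have "code (Suc K) = Some (x, \<sigma>)" using c[of 0] r' by simp
    \<comment> \<open>The waiting zone of slot \<open>K\<close> is the part of slot
      \<open>Suc K\<close> between 1/2 and 1, where the next push takes hold.\<close>
    then have "Psi \<sigma> x p \<in> {2 * real (Suc K) + 5/2 ..< 2 * real (Suc K) + 3}"
      using Cons.prems(3) by (intro push) (auto simp: slot_def)
    then have "fold (\<lambda>(x, \<sigma>). Psi \<sigma> x) w (Psi \<sigma> x p) \<ge> 2 * real (Suc K) + 5/2"
      using Cons.IH[of x \<sigma> "Suc K"] Cons.prems(1) a new c by simp
    then show ?thesis using a by simp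
  qed
qed simp

lemma chain_moves:
  assumes "reduced crs ((y, s) # w)"
    and "\<And>i. i < length (pchain crs y s w) \<Longrightarrow> code (K + i) = Some (pchain crs y s w ! i)"
  shows "fold (\<lambda>(x, \<sigma>). Psi \<sigma> x) ((y, s) # w) (2 * real K + 1/2) \<noteq> 2 * real K + 1/2"
proof -
  obtain r where r: "pchain crs y s w = (y, s) # r" using pchain_Cons[of crs y s w] by blast
  have K: "code K = Some (y, s)" using assms(2)[of 0] r by simp
  let ?p = "2 * real K + 1/2"
  have pK: "?p \<in> slot K" by (auto simp: slot_def)
  have "Psi s y ?p \<in> {2 * real K + 5/2 ..< 2 * real K + 3}"
    using Psi_slot[OF K pK, of s] Psi_in_slot[OF K pK, of s] bb_push[of "1/2"] by (auto simp: slot_def)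
  then have "fold (\<lambda>(x, \<sigma>). Psi \<sigma> x) w (Psi s y ?p) \<ge> 2 * real K + 5/2"
    using chain_push[OF reduced_persistent[of crs y s "[]" w]] assms by simp
  then show ?thesis by simp
qed

end

text \<open>There are only countably many words, so their chains can be laid side by side: one code,
  hence one action, detects all of them.\<close>

lemma universal_code:
  fixes crs :: "'l \<Rightarrow> 'l \<Rightarrow> bool" and L :: "'l set"
  assumes "countable L"
  obtains code where
    "\<And>k x s x' s'. code k = Some (x, s) \<Longrightarrow> code (Suc k) = Some (x', s') \<Longrightarrow> x \<noteq> x' \<and> \<not> crs x x'"
    "\<And>y s w. fst ` set ((y, s) # w) \<subseteq> L \<Longrightarrow>
        \<exists>K. \<forall>i<length (pchain crs y s w). code (K + i) = Some (pchain crs y s w ! i)"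
proof (cases "L = {}")
  case True
  show ?thesis by (rule that[of "\<lambda>_. None"]) (auto simp: True)
next
  case False
  have cw: "countable (lists (L \<times> (UNIV :: bool set)))" using assms by (intro countable_lists countable_SIGMA) auto
  define W :: "nat \<Rightarrow> ('l \<times> bool) list" where "W n = from_nat_into (lists (L \<times> UNIV)) n" for n
  define ch where "ch n = (case W n of [] \<Rightarrow> [] | (y, s) # w \<Rightarrow> pchain crs y s w)" for n
  \<comment> \<open>\<open>Suc\<close> leaves an empty slot after each chain, so that the last link
    of one and the first of the next, whose labels may agree or cross, are never
    consecutive.\<close>
  define off where "off n = (\<Sum>m<n. Suc (length (ch m)))" for n
  have off_Suc: "off (Suc n) = off n + Suc (length (ch n))" for n by (simp add: off_def)
  have off_mono: "off m + Suc (length (ch m)) \<le> off n" if "m < n" for m n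
  proof -
    have "off (Suc m) \<le> off n" unfolding off_def by (rule sum_mono2) (use that in auto)
    then show ?thesis by (simp add: off_Suc)
  qed
  \<comment> \<open>The non-strict upper bounds count the empty slot as part of its block; thus the
    successor of a coded slot still lies in the same block.\<close>
  have uniq: "m = n" if "off m \<le> k" "k \<le> off m + length (ch m)" "off n \<le> k" "k \<le> off n + length (ch n)" for m n k
  proof (rule ccontr)
    assume "m \<noteq> n"
    then consider "m < n" | "n < m" by linarith
    then show False by cases (use off_mono that in force)+
  qed
  define code where "code k = (if \<exists>n i. k = off n + i \<and> i < length (ch n)
     then Some (let n = (THE n. off n \<le> k \<and> k \<le> off n + length (ch n)) in ch n ! (k - off n)) else None)" for k
  have the: "(THE n. off n \<le> k \<and> k \<le> off n + length (ch n)) = n" if "off n \<le> k" "k \<le> off n + length (ch n)" for n k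
    using uniq that by blast
  have code_at: "code (off n + i) = Some (ch n ! i)" if "i < length (ch n)" for n i
    using the[of n "off n + i"] that by (auto simp: code_def Let_def)
  have code_Some: "\<exists>n i. k = off n + i \<and> i < length (ch n)" if "code k = Some z" for k z
    using that unfolding code_def by (metis option.distinct(1))
  show ?thesis
  proof (rule that[of code])
    fix k x s x' s' assume 1: "code k = Some (x, s)" and 2: "code (Suc k) = Some (x', s')"
    obtain n i where n: "k = off n + i" "i < length (ch n)" using code_Some[OF 1] by blast
    obtain m j where m: "Suc k = off m + j" "j < length (ch m)" using code_Some[OF 2] by blast
    have [simp]: "m = n" by (rule uniq[of _ "Suc k"]) (use n m in auto)
    have j: "j = Suc i" using n m by simp
    have e: "ch n ! i = (x, s)" "ch n ! Suc i = (x', s')"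
      using 1 2 n m j code_at[of i n] code_at[of "Suc i" n] by auto
    obtain y t w where "W n = (y, t) # w" using n(2) by (cases "W n") (auto simp: ch_def)
    then have "ch n = pchain crs y t w" by (simp add: ch_def)
    then show "x \<noteq> x' \<and> \<not> crs x x'" using pchain_adj[of i crs y t w] m j e by simp
  next
    fix y s and w :: "('l \<times> bool) list" assume "fst ` set ((y, s) # w) \<subseteq> L"
    then have "(y, s) # w \<in> lists (L \<times> UNIV)" by (auto simp: in_lists_conv_set image_subset_iff)
    then obtain n where "W n = (y, s) # w" unfolding W_def using cw from_nat_into_surj by metis
    then have "ch n = pchain crs y s w" by (simp add: ch_def)
    then show "\<exists>K. \<forall>i<length (pchain crs y s w). code (K + i) = Some (pchain crs y s w ! i)"
      using code_at by metis
  qed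
qed

section \<open>Membership in Diff and PL\<close>

lemma (in push_code) term_at_cases:
  obtains s where "term_at \<sigma> x k = (\<lambda>y. bb s (y - 2 * real k) - (y - 2 * real k))"
  | "term_at \<sigma> x k = (\<lambda>y. 0)"
proof (cases "\<exists>s. code k = Some (x, s)")
  case True
  then show ?thesis using that(1) unfolding term_at_def by auto
next
  case False
  then have "term_at \<sigma> x k = (\<lambda>y. 0)" unfolding term_at_def by (auto split: option.split)
  then show ?thesis by (rule that(2))
qed

lemma (in push_code) Psi_smooth:
  assumes "smooth \<beta>" "smooth \<beta>'"
  shows "smooth (Psi \<sigma> x)"
proof -
  have shift: "Ck n (\<lambda>y. y + c)" for n and c :: real
    by (rule Ck_add[OF Ck_ident Ck_const])
  have bb: "Ck n (bb s)" for n s using assms unfolding bb_def smooth_iff_Ck by simp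
  have "Ck n (\<lambda>y. bb s (y + - 2 * real k) + (- 1) * (y + - 2 * real k))" for n s k
    by (rule Ck_add[OF Ck_compose[OF bb shift] Ck_mult[OF Ck_const shift]])
  then have t: "Ck n (term_at \<sigma> x k)" for n k
    using Ck_const[of n 0] by (cases rule: term_at_cases[of \<sigma> x k]) (auto simp: algebra_simps)
  show ?thesis
    unfolding smooth_def
  proof (intro allI)
    fix n y
    obtain N :: nat where N: "y < real N" using reals_Archimedean2 by blast
    show "(deriv ^^ n) (Psi \<sigma> x) differentiable (at y)"
    proof (rule Ck_local[of "Suc n" "\<lambda>y. y + (\<Sum>k<N. term_at \<sigma> x k y)" "{..<2 * real N}"])
      show "Ck (Suc n) (\<lambda>y. y + (\<Sum>k<N. term_at \<sigma> x k y))"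
        by (intro Ck_add Ck_ident Ck_sum t) simp
    qed (use N Psi_eq_sum in auto)
  qed
qed

lemma id_in_Diff_plus: "id \<in> carrier Diff_plus"
  by (simp add: Diff_plus_def strict_mono_def smooth_iff_Ck Ck_ident id_def
      inv_id[unfolded id_def] bij_id[unfolded id_def])

lemma Diff_plus_comp:
  assumes "f \<in> carrier Diff_plus" "g \<in> carrier Diff_plus"
  shows "f \<circ> g \<in> carrier Diff_plus"
  using assms by (auto simp: Diff_plus_def o_inv_distrib bij_comp smooth_comp strict_mono_def)

lemma (in push_code) Psi_in_Diff_plus:
  assumes "smooth \<beta>" "smooth \<beta>'"
  shows "Psi \<sigma> x \<in> carrier Diff_plus"
  using Psi_smooth[OF assms] Psi_strict_mono Psi_inverse by (simp add: Diff_plus_def)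

text \<open>A single small push may move points too little, its size being limited by the need for a
  positive slope. Iterating it works: between 1/2 and 5/2 the displacement has a positive minimum by
  compactness, so 1/2 passes 5/2 after finitely many steps.\<close>

lemma smooth_push:
  obtains \<beta> \<beta>' :: "real \<Rightarrow> real" where "smooth \<beta>" "smooth \<beta>'" "push \<beta> \<beta>'"
proof -
  obtain g h :: "real \<Rightarrow> real" where g: "smooth g" "smooth h" "strict_mono g" "\<And>x. g (h x) = x"
    "\<And>x. x \<notin> {0<..<3} \<Longrightarrow> g x = x" "\<And>x. x \<in> {0<..<3} \<Longrightarrow> g x > x"
    using smooth_small_push by blast
  have id: "smooth id" by (simp add: smooth_iff_Ck id_def Ck_ident)
  have sm: "smooth (g ^^ n)" "smooth (h ^^ n)" for n
    by (induction n) (auto simp: id g smooth_comp)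
  have 1: "strict_mono (g ^^ n)" for n
    by (induction n) (use g(3) in \<open>auto simp: strict_mono_def\<close>)
  have 2: "(g ^^ n) ((h ^^ n) x) = x" for n x
  proof (induction n)
    case (Suc n)
    have "(g ^^ Suc n) ((h ^^ Suc n) x) = (g ^^ n) (g (h ((h ^^ n) x)))"
      by (metis comp_apply funpow.simps(2) funpow_swap1)
    then show ?case using Suc g(4) by simp
  qed simp
  have 3: "(g ^^ n) x = x" if "x \<notin> {0<..<3}" for n x
    by (induction n) (use g(5) that in auto)
  have "\<exists>n. (g ^^ n) (1/2) \<ge> 5/2"
  proof (rule ccontr)
    assume "\<not> ?thesis"
    then have less: "(g ^^ n) (1/2) < 5/2" for n by (auto simp: not_le)
    have cont: "continuous_on {1/2..5/2} (\<lambda>x. g x - x)"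
      by (rule continuous_on_diff[OF continuous_on_subset[OF increasing_bij_inverse(5)[OF g(3,4)] subset_UNIV]
            continuous_on_id])
    obtain x0 where x0: "x0 \<in> {1/2..5/2}" "\<And>x. x \<in> {1/2..5/2} \<Longrightarrow> g x0 - x0 \<le> g x - x"
      using continuous_attains_inf[OF _ _ cont] by auto
    define m where "m = g x0 - x0"
    have m: "m > 0" using g(6)[of x0] x0(1) by (auto simp: m_def)
    have ge: "(g ^^ n) (1/2) \<ge> 1/2 + real n * m" for n
    proof (induction n)
      case (Suc n)
      have "real n * m \<ge> 0" using m by simp
      then have "(g ^^ n) (1/2) \<in> {1/2..5/2}" using Suc less[of n] by auto
      then have "m \<le> g ((g ^^ n) (1/2)) - (g ^^ n) (1/2)" unfolding m_def by (rule x0(2))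
      then show ?case using Suc by (simp add: algebra_simps)
    qed simp
    obtain n where "real n * m > 2" using ex_less_of_nat_mult[OF m] by blast
    then show False using less[of n] ge[of n] by linarith
  qed
  then obtain n where "(g ^^ n) (1/2) \<ge> 5/2" by blast
  then have "push (g ^^ n) (h ^^ n)" by (intro push.intro 1 2 3)
  then show ?thesis using that sm by blast
qed

text \<open>A fixed common set of possible breakpoints makes sums immediate. The half integers serve
  because the push below and its inverse break only at 0, 1/2, 5/2 and 3, and slots are shifted by
  integers.\<close>

definition half_affine :: "(real \<Rightarrow> real) \<Rightarrow> bool" where
  "half_affine f \<longleftrightarrow> (\<forall>n::int. \<exists>m k. \<forall>x\<in>{of_int n / 2<..<(of_int n + 1) / 2}. f x = m * x + k)"

lemma half_affine_add: "half_affine f \<Longrightarrow> half_affine g \<Longrightarrow> half_affine (\<lambda>x. f x + g x)"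
  unfolding half_affine_def
proof
  fix n :: int
  let ?I = "{of_int n / 2<..<(of_int n + 1) / 2 :: real}"
  assume "\<forall>n::int. \<exists>m k. \<forall>x\<in>{of_int n / 2<..<(of_int n + 1) / 2}. f x = m * x + k"
    and "\<forall>n::int. \<exists>m k. \<forall>x\<in>{of_int n / 2<..<(of_int n + 1) / 2}. g x = m * x + k"
  then obtain m k m' k' where "\<forall>x\<in>?I. f x = m * x + k" "\<forall>x\<in>?I. g x = m' * x + k'" by meson
  then have "\<forall>x\<in>?I. f x + g x = (m + m') * x + (k + k')" by (simp add: algebra_simps)
  then show "\<exists>m k. \<forall>x\<in>?I. f x + g x = m * x + k" by blast
qed

lemma half_affine_linear: "half_affine (\<lambda>x. m * x + k)"
  unfolding half_affine_def by blast

lemma half_affine_sum: "finite A \<Longrightarrow> (\<And>i. i \<in> A \<Longrightarrow> half_affine (f i)) \<Longrightarrow> half_affine (\<lambda>x. \<Sum>i\<in>A. f i x)"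
proof (induction A rule: finite_induct)
  case empty
  then show ?case using half_affine_linear[of 0 0] by simp
qed (simp add: half_affine_add)

lemma half_affine_shift:
  assumes "half_affine f"
  shows "half_affine (\<lambda>x. f (x - 2 * real k))"
  unfolding half_affine_def
proof
  fix n :: int
  \<comment> \<open>A translation by 2 k moves the grid of half integers by 4 k steps.\<close>
  obtain m c where mc: "\<forall>x\<in>{of_int (n - 4 * int k) / 2<..<(of_int (n - 4 * int k) + 1) / 2}. f x = m * x + c"
    using assms unfolding half_affine_def by meson
  have "\<forall>x\<in>{of_int n / 2<..<(of_int n + 1) / 2}. f (x - 2 * real k) = m * x + (c - m * (2 * real k))"
  proof
    fix x :: real assume "x \<in> {of_int n / 2<..<(of_int n + 1) / 2}"
    then have "x - 2 * real k \<in> {of_int (n - 4 * int k) / 2<..<(of_int (n - 4 * int k) + 1) / 2}" by auto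
    from mc[rule_format, OF this] show "f (x - 2 * real k) = m * x + (c - m * (2 * real k))"
      by (simp add: algebra_simps)
  qed
  then show "\<exists>m c. \<forall>x\<in>{of_int n / 2<..<(of_int n + 1) / 2}. f (x - 2 * real k) = m * x + c" by blast
qed

lemma half_integers_no_limpt: "\<not> x islimpt range (\<lambda>n::int. of_int n / 2 :: real)"
proof
  assume l: "x islimpt range (\<lambda>n::int. of_int n / 2 :: real)"
  define r where "r = range (\<lambda>n::int. of_int n / 2 :: real)"
  have fin: "finite (r \<inter> cball x 1)"
  proof (rule finite_subset)
    show "r \<inter> cball x 1 \<subseteq> (\<lambda>n::int. of_int n / 2) ` {\<lfloor>2 * x - 2\<rfloor>..\<lceil>2 * x + 2\<rceil>}"
    proof
      fix y assume "y \<in> r \<inter> cball x 1"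
      then obtain n :: int where n: "y = of_int n / 2" "\<bar>x - of_int n / 2\<bar> \<le> 1"
        by (auto simp: r_def dist_real_def)
      then have "2 * x - 2 \<le> of_int n" "of_int n \<le> 2 * x + 2" by linarith+
      then have "\<lfloor>2 * x - 2\<rfloor> \<le> n" "n \<le> \<lceil>2 * x + 2\<rceil>" by linarith+
      then have "n \<in> {\<lfloor>2 * x - 2\<rfloor>..\<lceil>2 * x + 2\<rceil>}" by simp
      then show "y \<in> (\<lambda>n::int. of_int n / 2) ` {\<lfloor>2 * x - 2\<rfloor>..\<lceil>2 * x + 2\<rceil>}" using n by blast
    qed
  qed simp
  have "x islimpt r \<inter> cball x 1"
    using l unfolding r_def islimpt_approachable
    by (metis IntI dist_commute dual_order.strict_trans less_imp_le mem_cball zero_less_one linorder_less_linear)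
  then show False using fin islimpt_finite by blast
qed

text \<open>Absence of limit points is the convenient form: it passes to unions and to preimages
  under homeomorphisms, as composites require.\<close>

lemma closed_discrete_iff_no_limpt:
  fixes B :: "real set"
  shows "closed B \<and> discrete B \<longleftrightarrow> (\<forall>x. \<not> x islimpt B)"
  unfolding discrete_def closed_limpt isolated_in_islimpt_iff by blast

lemma half_affine_piecewise_linear:
  assumes "half_affine f"
  shows "piecewise_linear f"
  unfolding piecewise_linear_def
proof (intro exI[of _ "range (\<lambda>n::int. of_int n / 2 :: real)"] conjI allI impI)
  show "closed (range (\<lambda>n::int. of_int n / 2 :: real))" "discrete (range (\<lambda>n::int. of_int n / 2 :: real))"
    using closed_discrete_iff_no_limpt half_integers_no_limpt by blast+
  fix a b :: real assume ab: "a < b \<and> {a<..<b} \<inter> range (\<lambda>n::int. of_int n / 2 :: real) = {}"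
  define n where "n = \<lfloor>2 * a\<rfloor>"
  have n: "of_int n \<le> 2 * a" "2 * a < of_int n + 1" unfolding n_def by linarith+
  have "of_int (n + 1) / 2 \<notin> {a<..<b}" using ab by blast
  then have "b \<le> (of_int n + 1) / 2" using n ab by auto
  then have "{a<..<b} \<subseteq> {of_int n / 2<..<(of_int n + 1) / 2}" using n by auto
  then show "\<exists>m k. \<forall>x\<in>{a<..<b}. f x = m * x + k"
    using assms unfolding half_affine_def by (meson subsetD)
qed

lemma (in push_code) Psi_half_affine:
  assumes "half_affine \<beta>" "half_affine \<beta>'"
  shows "half_affine (Psi \<sigma> x)"
proof -
  have bb: "half_affine (bb s)" for s using assms unfolding bb_def by simp
  have "half_affine (\<lambda>y. bb s (y - 2 * real k) - (y - 2 * real k))" for s k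
    using half_affine_add[OF half_affine_shift[OF bb] half_affine_linear[of "- 1" "2 * real k"]]
    by (simp add: algebra_simps)
  then have t: "half_affine (term_at \<sigma> x k)" for k
    using half_affine_linear[of 0 0] by (cases rule: term_at_cases[of \<sigma> x k]) auto
  show ?thesis
    unfolding half_affine_def
  proof
    fix n :: int
    obtain N :: nat where N: "(of_int n + 1) / 2 < real N" using reals_Archimedean2 by blast
    have "half_affine (\<lambda>y. (1 * y + 0) + (\<Sum>k<N. term_at \<sigma> x k y))"
      by (intro half_affine_add half_affine_linear half_affine_sum t) simp
    then obtain m c where
      "\<forall>y\<in>{of_int n / 2<..<(of_int n + 1) / 2}. (1 * y + 0) + (\<Sum>k<N. term_at \<sigma> x k y) = m * y + c"
      unfolding half_affine_def by meson
    moreover have "Psi \<sigma> x y = (1 * y + 0) + (\<Sum>k<N. term_at \<sigma> x k y)"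
      if "y \<in> {of_int n / 2<..<(of_int n + 1) / 2}" for y
      using Psi_eq_sum[of y N] that N by auto
    ultimately show "\<exists>m c. \<forall>y\<in>{of_int n / 2<..<(of_int n + 1) / 2}. Psi \<sigma> x y = m * y + c" by metis
  qed
qed

lemma strict_mono_bij_homeomorphism:
  fixes f :: "real \<Rightarrow> real"
  assumes "strict_mono f" "bij f"
  shows "homeomorphism UNIV UNIV f (inv_into UNIV f)"
proof -
  have "f (inv_into UNIV f x) = x" for x using assms(2) by (simp add: bij_is_surj surj_f_inv_f)
  note * = increasing_bij_inverse[OF assms(1) this]
  show ?thesis
    unfolding homeomorphism_def using * assms(2)
    by (auto simp: bij_is_surj surj_f_inv_f bij_imp_bij_inv)
qed

lemma (in push_code) Psi_in_PL_plus:
  assumes "half_affine \<beta>" "half_affine \<beta>'"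
  shows "Psi \<sigma> x \<in> carrier PL_plus"
  using half_affine_piecewise_linear[OF Psi_half_affine[OF assms]] Psi_strict_mono Psi_inverse(2)
    strict_mono_bij_homeomorphism by (simp add: PL_plus_def)

lemma id_in_PL_plus: "id \<in> carrier PL_plus"
proof -
  have "half_affine (id :: real \<Rightarrow> real)" using half_affine_linear[of 1 0] by (simp add: id_def)
  moreover have m: "strict_mono (id :: real \<Rightarrow> real)" by (simp add: strict_mono_def)
  ultimately show ?thesis
    using half_affine_piecewise_linear strict_mono_bij_homeomorphism[OF m] by (simp add: PL_plus_def)
qed

text \<open>Breakpoints of the composite lie among those of \<open>g\<close> and the preimages of
  those of \<open>f\<close>. A limit point of the preimages would be carried by the continuous
  injective \<open>g\<close> to a limit point of breakpoints of \<open>f\<close>.\<close>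

lemma PL_plus_comp:
  assumes "f \<in> carrier PL_plus" "g \<in> carrier PL_plus"
  shows "f \<circ> g \<in> carrier PL_plus"
proof -
  have bij: "bij h" "strict_mono h" "piecewise_linear h" "homeomorphism UNIV UNIV h (inv_into UNIV h)"
    if "h \<in> carrier PL_plus" for h
  proof -
    show h: "strict_mono h" "piecewise_linear h" "homeomorphism UNIV UNIV h (inv_into UNIV h)"
      using that by (auto simp: PL_plus_def)
    then have "surj h" by (auto simp: homeomorphism_def)
    then show "bij h" using strict_mono_imp_inj_on[OF h(1)] by (simp add: bij_def)
  qed
  note f = bij[OF assms(1)] and g = bij[OF assms(2)]
  have sm: "strict_mono (f \<circ> g)" using f(2) g(2) by (auto simp: strict_mono_def)
  obtain Bf where Bf: "\<forall>x. \<not> x islimpt Bf"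
    "\<And>a b. a < b \<Longrightarrow> {a<..<b} \<inter> Bf = {} \<Longrightarrow> \<exists>m k. \<forall>x\<in>{a<..<b}. f x = m * x + k"
    using f(3) closed_discrete_iff_no_limpt unfolding piecewise_linear_def by metis
  obtain Bg where Bg: "\<forall>x. \<not> x islimpt Bg"
    "\<And>a b. a < b \<Longrightarrow> {a<..<b} \<inter> Bg = {} \<Longrightarrow> \<exists>m k. \<forall>x\<in>{a<..<b}. g x = m * x + k"
    using g(3) closed_discrete_iff_no_limpt unfolding piecewise_linear_def by metis
  have "\<not> x islimpt g -` Bf" for x
  proof
    assume "x islimpt g -` Bf"
    moreover have "isCont g x"
      using g(4) by (simp add: homeomorphism_def continuous_on_eq_continuous_at)
    moreover have "eventually (\<lambda>y. g y \<noteq> g x) (at x)"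
      unfolding eventually_at_topological using strict_mono_eq[OF g(2)] by auto
    ultimately have "g x islimpt g ` (g -` Bf)" by (rule islimpt_isCont_image)
    then show False using Bf(1) islimpt_subset[of "g x" "g ` (g -` Bf)" Bf] by blast
  qed
  then have B: "\<forall>x. \<not> x islimpt (Bg \<union> g -` Bf)" using Bg(1) by (simp add: islimpt_Un)
  have "\<exists>m k. \<forall>x\<in>{a<..<b}. (f \<circ> g) x = m * x + k" if ab: "a < b" "{a<..<b} \<inter> (Bg \<union> g -` Bf) = {}" for a b
  proof -
    obtain m k where mk: "\<forall>x\<in>{a<..<b}. g x = m * x + k" using Bg(2)[of a b] ab by blast
    have im: "y \<in> g ` {a<..<b}" if "y \<in> {g a<..<g b}" for y
    proof -
      obtain x where "y = g x" using g(1) by (metis bij_pointE)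
      then show ?thesis using that strict_mono_less[OF g(2)] by auto
    qed
    then have "{g a<..<g b} \<inter> Bf = {}" using ab(2) by fastforce
    moreover have "g a < g b" using g(2) ab(1) by (simp add: strict_mono_def)
    ultimately obtain m' k' where "\<forall>y\<in>{g a<..<g b}. f y = m' * y + k'" using Bf(2) by blast
    then have "\<forall>x\<in>{a<..<b}. f (g x) = m' * g x + k'" using g(2) by (simp add: strict_mono_def)
    then have "\<forall>x\<in>{a<..<b}. (f \<circ> g) x = (m' * m) * x + (m' * k + k')" using mk by (simp add: algebra_simps)
    then show ?thesis by blast
  qed
  then have "piecewise_linear (f \<circ> g)"
    unfolding piecewise_linear_def using closed_discrete_iff_no_limpt B by meson
  then show ?thesis
    using strict_mono_bij_homeomorphism[OF sm bij_comp[OF g(1) f(1)]] sm by (simp add: PL_plus_def)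
qed

lemma piecewise_linear_push:
  obtains \<beta> \<beta>' :: "real \<Rightarrow> real" where "half_affine \<beta>" "half_affine \<beta>'" "push \<beta> \<beta>'"
proof -
  \<comment> \<open>The graph of \<beta> joins (0,0), (1/2,5/2) and (3,3) by segments of slopes 5
    and 1/5, so \<open>half\<close> holds with equality.\<close>
  define \<beta> \<beta>' :: "real \<Rightarrow> real"
    where "\<beta> x = (if x \<le> 0 then x else if x \<le> 1/2 then 5 * x else if x \<le> 3 then x / 5 + 12/5 else x)"
      and "\<beta>' x = (if x \<le> 0 then x else if x \<le> 5/2 then x / 5 else if x \<le> 3 then 5 * x - 12 else x)" for x
  have pick: "\<exists>m k. \<forall>x\<in>I. h x = m * x + k" if "\<And>x. x \<in> I \<Longrightarrow> h x = m * x + k" for h :: "real \<Rightarrow> real" and I m k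
    using that by blast
  have "half_affine \<beta>"
    unfolding half_affine_def
  proof
    fix n :: int
    consider "n \<le> - 1" | "n = 0" | "1 \<le> n" "n \<le> 5" | "6 \<le> n" by linarith
    then show "\<exists>m k. \<forall>x\<in>{of_int n / 2<..<(of_int n + 1) / 2}. \<beta> x = m * x + k"
    proof cases
      case 1 then show ?thesis by (intro pick[of _ _ 1 0]) (auto simp: \<beta>_def)
    next
      case 2 then show ?thesis by (intro pick[of _ _ 5 0]) (auto simp: \<beta>_def)
    next
      case 3 then show ?thesis by (intro pick[of _ _ "1/5" "12/5"]) (auto simp: \<beta>_def)
    next
      case 4 then show ?thesis by (intro pick[of _ _ 1 0]) (auto simp: \<beta>_def)
    qed
  qed
  moreover have "half_affine \<beta>'"
    unfolding half_affine_def
  proof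
    fix n :: int
    consider "n \<le> - 1" | "0 \<le> n" "n \<le> 4" | "n = 5" | "6 \<le> n" by linarith
    then show "\<exists>m k. \<forall>x\<in>{of_int n / 2<..<(of_int n + 1) / 2}. \<beta>' x = m * x + k"
    proof cases
      case 1 then show ?thesis by (intro pick[of _ _ 1 0]) (auto simp: \<beta>'_def)
    next
      case 2 then show ?thesis by (intro pick[of _ _ "1/5" 0]) (auto simp: \<beta>'_def)
    next
      case 3 then show ?thesis by (intro pick[of _ _ 5 "-12"]) (auto simp: \<beta>'_def)
    next
      case 4 then show ?thesis by (intro pick[of _ _ 1 0]) (auto simp: \<beta>'_def)
    qed
  qed
  moreover have "push \<beta> \<beta>'"
    by standard (auto simp: \<beta>_def \<beta>'_def strict_mono_def diff_divide_distrib)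
  ultimately show ?thesis using that by blast
qed

section \<open>Cocycles on CAT(0) spaces\<close>

text \<open>\<open>CAT0\<close> quantifies over all comparison triangles, so its inequality says
  something only once one is known to exist.\<close>

lemma comparison_triangle_exists:
  fixes \<alpha> \<beta> \<kappa> :: real
  assumes "0 \<le> \<alpha>" "0 \<le> \<beta>" "0 \<le> \<kappa>" "\<alpha> \<le> \<beta> + \<kappa>" "\<beta> \<le> \<alpha> + \<kappa>" "\<kappa> \<le> \<alpha> + \<beta>"
  obtains a b c :: "real^2" where "dist a b = \<alpha>" "dist a c = \<beta>" "dist b c = \<kappa>"
proof (cases "\<alpha> = 0")
  case True
  then have "\<beta> = \<kappa>" using assms by linarith
  then show ?thesis
    using that[of 0 0 "vector [\<beta>, 0]"] assms True
    by (simp add: dist_norm norm_vec_def L2_set_def UNIV_2 vector_2)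
next
  case False
  \<comment> \<open>First coordinate of the third vertex, from the law of cosines. The triangle
    inequalities bound it by \<beta> in absolute value, so the second coordinate \<open>v\<close>
    has the right square.\<close>
  define u where "u = (\<alpha>\<^sup>2 + \<beta>\<^sup>2 - \<kappa>\<^sup>2) / (2*\<alpha>)"
  define v where "v = sqrt (\<beta>\<^sup>2 - u\<^sup>2)"
  have \<alpha>: "\<alpha> > 0" using False assms by simp
  have k1: "\<kappa>\<^sup>2 \<le> (\<alpha>+\<beta>)\<^sup>2" using assms by (intro power_mono) auto
  have k2: "(\<alpha>-\<beta>)\<^sup>2 \<le> \<kappa>\<^sup>2" using assms by (intro abs_le_square_iff[THEN iffD1]) auto
  have "\<bar>u\<bar> \<le> \<beta>"
    unfolding u_def using \<alpha> k1 k2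
    by (auto simp: abs_le_iff field_simps power2_eq_square)
  then have le: "u\<^sup>2 \<le> \<beta>\<^sup>2" using assms(2) abs_le_square_iff by fastforce
  then have v2: "v\<^sup>2 = \<beta>\<^sup>2 - u\<^sup>2" unfolding v_def by simp
  have "2*\<alpha>*u = \<alpha>\<^sup>2 + \<beta>\<^sup>2 - \<kappa>\<^sup>2" unfolding u_def using \<alpha> by simp
  then have "(\<alpha> - u)\<^sup>2 + v\<^sup>2 = \<kappa>\<^sup>2" unfolding v2 by (simp add: power2_eq_square algebra_simps)
  then show ?thesis
    using that[of 0 "vector [\<alpha>, 0]" "vector [u, v]"] assms \<alpha> v2
    by (simp add: dist_norm norm_vec_def L2_set_def UNIV_2 vector_2)
qed

text \<open>Geodesics from \<open>x0\<close> are reparametrized by the unit interval. Points at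
  equal parameter \<open>s\<close> on two of them correspond to points of the comparison triangle at
  distance \<open>s\<close> times the opposite side, which gives the last, contracting
  property.\<close>

lemma CAT0_combing:
  assumes "CAT0 M d" "x0 \<in> M"
  obtains c :: "'p \<Rightarrow> real \<Rightarrow> 'p" where
    "\<And>x s. x \<in> M \<Longrightarrow> s \<in> {0..1} \<Longrightarrow> c x s \<in> M"
    "\<And>x. x \<in> M \<Longrightarrow> c x 0 = x0"
    "\<And>x. x \<in> M \<Longrightarrow> c x 1 = x"
    "\<And>x s t. x \<in> M \<Longrightarrow> s \<in> {0..1} \<Longrightarrow> t \<in> {0..1} \<Longrightarrow> d (c x s) (c x t) = \<bar>s - t\<bar> * d x0 x"
    "\<And>x y s. x \<in> M \<Longrightarrow> y \<in> M \<Longrightarrow> s \<in> {0..1} \<Longrightarrow> d (c x s) (c y s) \<le> d x y"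
proof -
  interpret Metric_space M d using assms(1) by (simp add: CAT0_def)
  have "\<forall>x\<in>M. \<exists>\<gamma>. geodesic M d x0 x \<gamma>" using assms by (auto simp: CAT0_def)
  then obtain \<gamma> where \<gamma>: "\<And>x. x \<in> M \<Longrightarrow> geodesic M d x0 x (\<gamma> x)" by metis
  have mem: "s * d x0 x \<in> {0..d x0 x}" if "s \<in> {0..1}" for s x
    using that by (auto simp: mult_left_le_one_le)
  show ?thesis
  proof (rule that[of "\<lambda>x s. \<gamma> x (s * d x0 x)"])
    fix x s assume "x \<in> M" "s \<in> {0..1::real}"
    then show "\<gamma> x (s * d x0 x) \<in> M" using \<gamma>[of x] mem[of s x] unfolding geodesic_def by blast
  next
    fix x assume "x \<in> M"
    then show "\<gamma> x (0 * d x0 x) = x0" "\<gamma> x (1 * d x0 x) = x"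
      using \<gamma>[of x] unfolding geodesic_def by auto
  next
    fix x s t assume *: "x \<in> M" "s \<in> {0..1::real}" "t \<in> {0..1::real}"
    have "d (\<gamma> x (s * d x0 x)) (\<gamma> x (t * d x0 x)) = \<bar>s * d x0 x - t * d x0 x\<bar>"
      using \<gamma>[of x] * mem unfolding geodesic_def by blast
    also have "\<dots> = \<bar>s - t\<bar> * d x0 x" by (simp flip: left_diff_distrib add: abs_mult)
    finally show "d (\<gamma> x (s * d x0 x)) (\<gamma> x (t * d x0 x)) = \<bar>s - t\<bar> * d x0 x" .
  next
    fix x y s assume *: "x \<in> M" "y \<in> M" "s \<in> {0..1::real}"
    have t: "d x0 x \<le> d x0 y + d x y" "d x0 y \<le> d x0 x + d x y" "d x y \<le> d x0 x + d x0 y"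
      using triangle[of x0 y x] triangle[of x0 x y] triangle[of x x0 y] assms(2) *
      by (auto simp: commute)
    obtain a b c :: "real^2" where abc: "dist a b = d x0 x" "dist a c = d x0 y" "dist b c = d x y"
      using comparison_triangle_exists[of "d x0 x" "d x0 y" "d x y"] t by auto
    \<comment> \<open>For a side of length 0 the quotient is 0 by convention, and the identity holds
      since then b = a.\<close>
    have e1: "((s * d x0 x) / d x0 x) *\<^sub>R (b - a) = s *\<^sub>R (b - a)" using abc(1) by (cases "d x0 x = 0") auto
    have e2: "((s * d x0 y) / d x0 y) *\<^sub>R (c - a) = s *\<^sub>R (c - a)" using abc(2) by (cases "d x0 y = 0") auto
    have "d (\<gamma> x (s * d x0 x)) (\<gamma> y (s * d x0 y))
        \<le> dist (a + ((s * d x0 x) / d x0 x) *\<^sub>R (b - a)) (a + ((s * d x0 y) / d x0 y) *\<^sub>R (c - a))"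
      using assms(1) assms(2) * \<gamma>[of x] \<gamma>[of y] abc mem[of s x] mem[of s y] unfolding CAT0_def by blast
    also have "\<dots> = dist (s *\<^sub>R b) (s *\<^sub>R c)"
      unfolding e1 e2 by (simp add: dist_norm algebra_simps)
    also have "\<dots> = s * dist b c" using * by (simp add: dist_norm flip: scaleR_diff_right)
    also have "\<dots> \<le> d x y" using * abc(3) by (auto simp: mult_left_le_one_le)
    finally show "d (\<gamma> x (s * d x0 x)) (\<gamma> y (s * d x0 y)) \<le> d x y" .
  qed
qed

text \<open>
  Functions under composition serve as the monoid of values, so a local cocycle is a locally
  trivial flat bundle. It is integrated along the geodesics issuing from \<open>x0\<close>: by the CAT(0)
  inequality, geodesics to nearby points form a thin ladder.
\<close>

lemma CAT0_integrate_cocycle: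
  fixes T :: "'p \<Rightarrow> 'p \<Rightarrow> 'v \<Rightarrow> 'v"
  assumes "CAT0 M d" "x0 \<in> M" "\<delta> > 0"
    and Tid: "\<And>p. p \<in> M \<Longrightarrow> T p p = id"
    and Tco: "\<And>p q r. \<lbrakk>p \<in> M; q \<in> M; r \<in> M; d p q < \<delta>; d q r < \<delta>; d p r < \<delta>\<rbrakk> \<Longrightarrow> T p q \<circ> T q r = T p r"
  obtains F where "F x0 = id"
    "\<And>p q. \<lbrakk>p \<in> M; q \<in> M; d p q < \<delta>\<rbrakk> \<Longrightarrow> F p \<circ> T p q = F q"
proof -
  interpret Metric_space M d using assms(1) by (simp add: CAT0_def)
  obtain c where cM: "\<And>x s. x \<in> M \<Longrightarrow> s \<in> {0..1} \<Longrightarrow> c x s \<in> M"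
    and c0: "\<And>x. x \<in> M \<Longrightarrow> c x 0 = x0"
    and c1: "\<And>x. x \<in> M \<Longrightarrow> c x 1 = x"
    and cd: "\<And>x s t. x \<in> M \<Longrightarrow> s \<in> {0..1} \<Longrightarrow> t \<in> {0..1} \<Longrightarrow> d (c x s) (c x t) = \<bar>s - t\<bar> * d x0 x"
    and cc: "\<And>x y s. x \<in> M \<Longrightarrow> y \<in> M \<Longrightarrow> s \<in> {0..1} \<Longrightarrow> d (c x s) (c y s) \<le> d x y"
    using CAT0_combing[OF assms(1,2)] by blast
  \<comment> \<open>Ordered product of the transports over the first \<open>k\<close> of
    \<open>N\<close> equal pieces of the geodesic to \<open>x\<close>.\<close>
  define P where "P x N = rec_nat id (\<lambda>k h. h \<circ> T (c x (real k / real N)) (c x (real (Suc k) / real N)))"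
    for x and N :: nat
  have P0: "P x N 0 = id" for x N by (simp add: P_def)
  have PS: "P x N (Suc k) = P x N k \<circ> T (c x (real k / real N)) (c x (real (Suc k) / real N))" for x N k
    by (simp add: P_def)
  \<comment> \<open>Splitting each piece into \<open>K\<close> parts does not change the product
    once the pieces are shorter than \<delta>: within one piece the cocycle law telescopes. Two
    subdivisions are then compared through their common refinement.\<close>
  have refine: "P x (N*K) (k*K) = P x N k"
    if x: "x \<in> M" and N: "d x0 x < \<delta> * real N" and K: "K > 0" and "k \<le> N" for x N K k
    using \<open>k \<le> N\<close>
  proof (induction k)
    case 0 show ?case by (simp add: P0)
  next
    case (Suc k)
    have N0: "N > 0" using Suc.prems by simp
    let ?s = "\<lambda>j. (real k * real K + real j) / (real N * real K)"
    have sj: "?s j \<in> {0..1}" if "j \<le> K" for j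
    proof -
      have "k * K + j \<le> N * K" using that Suc.prems mult_le_mono1[of "Suc k" N K] by simp
      then have "real k * real K + real j \<le> real N * real K" by (metis of_nat_add of_nat_le_iff of_nat_mult)
      then show ?thesis using N0 K by (simp add: divide_le_eq_1)
    qed
    have short: "d (c x (?s i)) (c x (?s j)) < \<delta>" if "i \<le> K" "j \<le> K" for i j
    proof -
      have "\<bar>?s i - ?s j\<bar> = \<bar>real i - real j\<bar> / (real N * real K)"
        by (simp add: abs_divide flip: diff_divide_distrib)
      also have "\<dots> \<le> 1 / real N" using that K N0 by (auto simp: field_simps abs_le_iff)
      finally have "\<bar>?s i - ?s j\<bar> * d x0 x \<le> 1 / real N * d x0 x" by (intro mult_right_mono) auto
      also have "\<dots> < \<delta>" using N N0 by (simp add: field_simps)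
      finally show ?thesis using cd[OF x sj[OF that(1)] sj[OF that(2)]] by simp
    qed
    have s0: "?s 0 = real k / real N" using K by simp
    have sK: "?s K = real (Suc k) / real N" using K N0 by (simp add: field_simps)
    have "P x (N*K) (k*K + j) = P x N k \<circ> T (c x (?s 0)) (c x (?s j))" if "j \<le> K" for j
      using that
    proof (induction j)
      case 0
      then show ?case using Suc.IH Suc.prems Tid cM[OF x sj[of 0]] by simp
    next
      case (Suc j)
      have "P x (N*K) (k*K + Suc j) = P x (N*K) (k*K + j) \<circ> T (c x (?s j)) (c x (?s (Suc j)))"
        using PS[of x "N*K" "k*K+j"] by (simp add: add_ac)
      also have "\<dots> = P x N k \<circ> (T (c x (?s 0)) (c x (?s j)) \<circ> T (c x (?s j)) (c x (?s (Suc j))))"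
        using Suc by (simp add: fun_eq_iff)
      also have "\<dots> = P x N k \<circ> T (c x (?s 0)) (c x (?s (Suc j)))"
        using Suc.prems
        by (subst Tco[OF cM[OF x sj] cM[OF x sj] cM[OF x sj] short short short]) auto
      finally show ?case .
    qed
    from this[of K] show ?case unfolding s0 sK by (simp add: PS add.commute)
  qed
  have indep: "P x N N = P x N' N'"
    if "x \<in> M" "d x0 x < \<delta> * real N" "d x0 x < \<delta> * real N'" for x N N'
  proof -
    have "K > 0" if "d x0 x < \<delta> * real K" for K
    proof (rule Nat.gr0I)
      assume "K = 0"
      then have "d x0 x < 0" using that by simp
      then show False using nonneg[of x0 x] by linarith
    qed
    then have "N > 0" "N' > 0" using that by auto
    then show ?thesis
      using refine[of x N N' N] refine[of x N' N N'] that by (simp add: mult.commute)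
  qed
  \<comment> \<open>Induction along the rungs: a diagonal cuts each cell into two triangles to which
    the cocycle law applies. The diagonal is at most a rung plus a step, hence the form of the
    bounds.\<close>
  have ladder: "P x N k \<circ> T (c x (real k / real N)) (c y (real k / real N)) = P y N k"
    if x: "x \<in> M" and y: "y \<in> M" and dx: "d x y + d x0 x / real N < \<delta>" and dy: "d x y + d x0 y / real N < \<delta>"
      and "k \<le> N" for x y N k
    using \<open>k \<le> N\<close>
  proof (induction k)
    case 0
    then show ?case using c0 x y Tid assms(2) by (simp add: P0)
  next
    case (Suc k)
    have N0: "N > 0" using Suc.prems by simp
    define s t where "s = real k / real N" and "t = real (Suc k) / real N"
    have st: "s \<in> {0..1}" "t \<in> {0..1}" "t - s = 1 / real N"
      using Suc.prems N0 by (auto simp: s_def t_def field_simps)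
    note M = cM[OF x st(1)] cM[OF x st(2)] cM[OF y st(1)] cM[OF y st(2)]
    have nn: "d x0 x / real N \<ge> 0" "d x0 y / real N \<ge> 0" by auto
    have e: "d (c x s) (c x t) = d x0 x / real N" "d (c y s) (c y t) = d x0 y / real N"
      using cd[OF x st(1,2)] cd[OF y st(1,2)] st(3) by (auto simp: abs_minus_commute[of s t])
    have d1: "d (c x s) (c x t) < \<delta>" "d (c y s) (c y t) < \<delta>"
      using e dx dy nonneg[of x y] by linarith+
    have d2: "d (c x s) (c y s) < \<delta>" "d (c x t) (c y t) < \<delta>"
      using cc[OF x y st(1)] cc[OF x y st(2)] dx nn by linarith+
    have d3: "d (c x s) (c y t) < \<delta>"
      using triangle[OF M(1,3,4)] cc[OF x y st(1)] e(2) dy by linarith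
    have "P x N (Suc k) \<circ> T (c x t) (c y t) = P x N k \<circ> (T (c x s) (c x t) \<circ> T (c x t) (c y t))"
      by (simp only: PS s_def t_def comp_assoc)
    also have "\<dots> = P x N k \<circ> (T (c x s) (c y s) \<circ> T (c y s) (c y t))"
      using Tco M d1 d2 d3 by metis
    also have "\<dots> = P y N k \<circ> T (c y s) (c y t)"
      using Suc by (simp add: s_def fun_eq_iff)
    finally show ?case by (simp only: PS s_def t_def)
  qed
  define Nx where "Nx x = (SOME N::nat. d x0 x < \<delta> * real N)" for x
  have Nx: "d x0 x < \<delta> * real (Nx x)" for x
  proof -
    have "\<exists>N::nat. d x0 x < \<delta> * real N"
      using ex_less_of_nat_mult[OF assms(3), of "d x0 x"] by (simp add: mult.commute)
    then show ?thesis unfolding Nx_def by (rule someI_ex)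
  qed
  define F where "F x = P x (Nx x) (Nx x)" for x
  have "F x0 = id"
  proof -
    have "F x0 = P x0 1 1" unfolding F_def by (rule indep) (use assms Nx[of x0] in auto)
    then show ?thesis using c0[OF assms(2)] c1[OF assms(2)] Tid assms(2) PS[of x0 1 0] P0[of x0 1] by simp
  qed
  moreover have "F p \<circ> T p q = F q" if "p \<in> M" "q \<in> M" "d p q < \<delta>" for p q
  proof -
    \<comment> \<open>What a rung leaves below \<delta>; the number \<open>N\<close> of steps is
      then taken so large that each step is shorter than this.\<close>
    define \<eta> where "\<eta> = \<delta> - d p q"
    have \<eta>: "\<eta> > 0" "\<eta> \<le> \<delta>" using that by (auto simp: \<eta>_def)
    obtain N :: nat where N: "max (d x0 p) (d x0 q) < real N * \<eta>"
      using ex_less_of_nat_mult[OF \<eta>(1)] by blast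
    have N0: "N > 0"
    proof (rule Nat.gr0I)
      assume "N = 0"
      then have "d x0 p < 0" using N by auto
      then show False using nonneg[of x0 p] by linarith
    qed
    have "d x0 p < \<delta> * real N" "d x0 q < \<delta> * real N"
      using N mult_left_mono[OF \<eta>(2), of "real N"] by (auto simp: mult.commute)
    then have "F p = P p N N" "F q = P q N N" unfolding F_def by (auto intro!: indep that Nx)
    moreover have "P p N N \<circ> T (c p (real N / real N)) (c q (real N / real N)) = P q N N"
      by (rule ladder) (use that N N0 in \<open>auto simp: \<eta>_def field_simps\<close>)
    ultimately show ?thesis using N0 c1 that by simp
  qed
  ultimately show ?thesis using that by blast
qed

section \<open>Cube complexes with labelled edges\<close>

text \<open>\<open>S\<close> lists the coordinates fixed at 1; a member in the free direction is
  ignored. Naming corners by sets lets one move through a cube by inserting one index at a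
  time.\<close>

definition edge_face :: "nat \<Rightarrow> nat \<Rightarrow> bool \<Rightarrow> nat set \<Rightarrow> coord list" where
  "edge_face n i b S = map (\<lambda>k. if k = i then Coord 0 b else End (k \<in> S)) [0..<n]"

definition square_face :: "nat \<Rightarrow> nat \<Rightarrow> nat \<Rightarrow> nat set \<Rightarrow> coord list" where
  "square_face n i j S =
     map (\<lambda>k. if k = i then Coord 0 False else if k = j then Coord 1 False else End (k \<in> S)) [0..<n]"

definition vertex_face :: "nat \<Rightarrow> nat set \<Rightarrow> coord list" where
  "vertex_face n S = map (\<lambda>k. End (k \<in> S)) [0..<n]"

lemma face_map_edge_face: "i < n \<Longrightarrow> face_map 1 n (edge_face n i b S)"
  by (auto simp: face_map_def edge_face_def split: if_splits)

lemma face_map_square_face: "i < n \<Longrightarrow> j < n \<Longrightarrow> i \<noteq> j \<Longrightarrow> face_map 2 n (square_face n i j S)"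
proof -
  assume *: "i < n" "j < n" "i \<noteq> j"
  have "\<exists>!l. l < n \<and> (\<exists>b. square_face n i j S ! l = Coord k b)" if "k < 2" for k
    by (rule ex1I[of _ "if k = 0 then i else j"])
      (use * that in \<open>auto simp: square_face_def less_2_cases_iff split: if_splits\<close>)
  then show ?thesis by (auto simp: face_map_def square_face_def)
qed

lemma face_map_vertex_face: "face_map 0 n (vertex_face n S)"
  by (auto simp: face_map_def vertex_face_def)

lemma edge_face_axis: "i < n \<Longrightarrow> (replicate n (End False))[i := Coord 0 False] = edge_face n i False {}"
  by (rule nth_equalityI) (auto simp: edge_face_def nth_list_update)

lemma vertex_face_origin: "replicate n (End False) = vertex_face n {}"
  by (rule nth_equalityI) (auto simp: vertex_face_def)

lemma edge_face_1: "edge_face 1 0 False {} = id_face 1"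
  by (simp add: edge_face_def id_face_def)

lemma comp_square_edge:
  assumes "i < n" "j < n" "i \<noteq> j"
  shows "comp_face (square_face n i j S) [Coord 0 False, End b] = edge_face n i False (if b then insert j S else S - {j})"
    "comp_face (square_face n i j S) [End b, Coord 0 False] = edge_face n j False (if b then insert i S else S - {i})"
  using assms by (auto intro!: nth_equalityI simp: comp_face_def square_face_def edge_face_def)

lemma comp_edge_reverse: "comp_face (edge_face n i b S) [Coord 0 True] = edge_face n i (\<not> b) S"
  by (auto intro!: nth_equalityI simp: comp_face_def edge_face_def)

lemma comp_edge_end:
  "comp_face (edge_face n i b S) [End b'] = vertex_face n (if b \<noteq> b' then insert i S else S - {i})"
  by (auto intro!: nth_equalityI simp: comp_face_def edge_face_def vertex_face_def)

text \<open>The corner of the cube to which the origin of the face is sent: a reflected coordinate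
  takes the value 1 there. Indices beyond the list are harmless, since the faces built from this set
  read only those below the dimension.\<close>

definition true_set :: "coord list \<Rightarrow> nat set" where
  "true_set f = {k. f ! k = End True \<or> (\<exists>i. f ! k = Coord i True)}"

lemma face_map_coord_unique:
  assumes "face_map m n f" "j < n" "k < n" "f ! j = Coord i b" "f ! k = Coord i b'"
  shows "j = k"
proof -
  have "i < m" using assms unfolding face_map_def by (metis nth_mem)
  then show ?thesis using assms unfolding face_map_def by blast
qed

lemma face_map_coord_ex:
  assumes "face_map m n f" "i < m"
  obtains j b where "j < n" "f ! j = Coord i b"
  using assms unfolding face_map_def by blast

lemma face_map_coord_less: "face_map m n f \<Longrightarrow> j < n \<Longrightarrow> f ! j = Coord i b \<Longrightarrow> i < m"
  unfolding face_map_def by (metis nth_mem)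

lemma comp_face_axis:
  assumes f: "face_map m n f" and j: "j < n" "f ! j = Coord i b"
  shows "comp_face f (edge_face m i False {}) = edge_face n j b (true_set f)"
proof (rule nth_equalityI)
  have len: "length f = n" using f by (simp add: face_map_def)
  then show "length (comp_face f (edge_face m i False {})) = length (edge_face n j b (true_set f))"
    by (simp add: comp_face_def edge_face_def)
  fix k assume "k < length (comp_face f (edge_face m i False {}))"
  then have k: "k < n" using len by (simp add: comp_face_def)
  show "comp_face f (edge_face m i False {}) ! k = edge_face n j b (true_set f) ! k"
  proof (cases "f ! k")
    case (End e)
    then show ?thesis using k j len by (auto simp: comp_face_def edge_face_def true_set_def)
  next
    case (Coord i' b')
    have i': "i' < m" using face_map_coord_less[OF f k Coord] .
    have "k = j \<longleftrightarrow> i' = i" using face_map_coord_unique[OF f k j(1) Coord] j Coord by auto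
    then show ?thesis using k j len i' Coord
      by (auto simp: comp_face_def edge_face_def true_set_def)
  qed
qed

lemma comp_face_origin:
  assumes f: "face_map m n f"
  shows "comp_face f (vertex_face m {}) = vertex_face n (true_set f)"
proof (rule nth_equalityI)
  have len: "length f = n" using f by (simp add: face_map_def)
  then show "length (comp_face f (vertex_face m {})) = length (vertex_face n (true_set f))"
    by (simp add: comp_face_def vertex_face_def)
  fix k assume "k < length (comp_face f (vertex_face m {}))"
  then have k: "k < n" using len by (simp add: comp_face_def)
  then show "comp_face f (vertex_face m {}) ! k = vertex_face n (true_set f) ! k"
    using len face_map_coord_less[OF f k]
    by (cases "f ! k") (auto simp: comp_face_def vertex_face_def true_set_def)
qed

lemma face_map_small:
  "face_map 1 1 [Coord 0 b]" "face_map 0 1 [End b]"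
  "face_map 1 2 [Coord 0 b, End b']" "face_map 1 2 [End b', Coord 0 b]"
proof -
  show "face_map 1 2 [Coord 0 b, End b']" "face_map 1 2 [End b', Coord 0 b]"
    using face_map_edge_face[of 0 2 b "if b' then {1} else {}"] face_map_edge_face[of 1 2 b "if b' then {0} else {}"]
    by (cases b'; simp add: edge_face_def upt_rec numeral_2_eq_2 del: One_nat_def; simp)+
qed (auto simp: face_map_def)

locale complex =
  fixes X :: "'c cube_complex"
  assumes is_complex: "is_cube_complex X"
begin

lemma restr_in [simp]:
  assumes "c \<in> charts X" "face_map m (cdim X c) f"
  shows "restr X c f \<in> charts X" "cdim X (restr X c f) = m"
  using is_complex assms unfolding is_cube_complex_def by blast+

lemma restr_restr:
  assumes "c \<in> charts X" "face_map m (cdim X c) f" "face_map k m g"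
  shows "restr X (restr X c f) g = restr X c (comp_face f g)"
  using is_complex assms unfolding is_cube_complex_def by blast

lemma restr_id: "c \<in> charts X \<Longrightarrow> restr X c (id_face (cdim X c)) = c"
  using is_complex unfolding is_cube_complex_def by blast

lemma axes_eq: "axes X c = map (\<lambda>i. restr X c (edge_face (cdim X c) i False {})) [0..<cdim X c]"
  unfolding axes_def by (auto simp: edge_face_axis)

lemma origin_eq: "origin X c = restr X c (vertex_face (cdim X c) {})"
  by (simp add: origin_def vertex_face_origin)

lemma square_axes:
  assumes "s \<in> squares X"
  shows "axes X s = [restr X s [Coord 0 False, End False], restr X s [End False, Coord 0 False]]"
  using assms unfolding axes_eq squares_def
  by (simp add: upt_rec numeral_2_eq_2 edge_face_def)

lemma edge_in: "e \<in> oriented_edges X \<Longrightarrow> e \<in> charts X" "e \<in> oriented_edges X \<Longrightarrow> cdim X e = 1"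
  by (auto simp: oriented_edges_def)

lemma edge_faces:
  assumes "c \<in> charts X" "i < cdim X c"
  shows "restr X c (edge_face (cdim X c) i b S) \<in> oriented_edges X"
    "rev_edge X (restr X c (edge_face (cdim X c) i b S)) = restr X c (edge_face (cdim X c) i (\<not> b) S)"
    "initial X (restr X c (edge_face (cdim X c) i b S)) =
       restr X c (vertex_face (cdim X c) (if b then insert i S else S - {i}))"
    "terminal X (restr X c (edge_face (cdim X c) i b S)) =
       restr X c (vertex_face (cdim X c) (if b then S - {i} else insert i S))"
  using assms restr_in[OF assms(1) face_map_edge_face[OF assms(2)]]
    restr_restr[OF assms(1) face_map_edge_face[OF assms(2)] face_map_small(1)]
    restr_restr[OF assms(1) face_map_edge_face[OF assms(2)] face_map_small(2)]
  by (auto simp: oriented_edges_def rev_edge_def initial_def terminal_def comp_edge_reverse comp_edge_end)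

lemma square_edges:
  assumes "s \<in> squares X"
  shows "restr X s [Coord 0 b, End b'] = restr X s (edge_face 2 0 b (if b' then {1} else {}))"
    "restr X s [End b', Coord 0 b] = restr X s (edge_face 2 1 b (if b' then {0} else {}))"
  by (auto simp: edge_face_def upt_rec numeral_2_eq_2)

lemma edge_as_face:
  assumes "e \<in> oriented_edges X"
  shows "restr X e (edge_face 1 0 False {}) = e"
  using restr_id[of e] edge_in[OF assms] by (simp add: edge_face_1 del: One_nat_def)

lemma rev_in:
  assumes "e \<in> oriented_edges X"
  shows "rev_edge X e \<in> oriented_edges X" "rev_edge X (rev_edge X e) = e"
    "initial X (rev_edge X e) = terminal X e" "terminal X (rev_edge X e) = initial X e"
    "initial X e \<in> vertices X" "terminal X e \<in> vertices X"
proof -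
  note e = edge_in[OF assms]
  have r: "rev_edge X e = restr X e (edge_face (cdim X e) 0 True {})"
    unfolding rev_edge_def e(2) by (simp add: edge_face_def)
  have e': "e = restr X e (edge_face (cdim X e) 0 False {})" using edge_as_face[OF assms] e by simp
  have 0: "0 < cdim X e" using e by simp
  note F = edge_faces[OF e(1) 0]
  show "rev_edge X e \<in> oriented_edges X" unfolding r by (rule F)
  show "rev_edge X (rev_edge X e) = e" unfolding r F using e' by simp
  have i: "initial X e = restr X e (vertex_face (cdim X e) {})"
    "terminal X e = restr X e (vertex_face (cdim X e) {0})"
    using F(3,4)[of False "{}"] e' by auto
  show "initial X (rev_edge X e) = terminal X e" "terminal X (rev_edge X e) = initial X e"
    unfolding r F(3,4) i by auto
  show "initial X e \<in> vertices X" "terminal X e \<in> vertices X"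
    unfolding i vertices_def using e restr_in[OF e(1) face_map_vertex_face] by auto
qed

end

fun epath :: "'c cube_complex \<Rightarrow> 'c \<Rightarrow> 'c list \<Rightarrow> 'c \<Rightarrow> bool" where
  "epath X v [] w \<longleftrightarrow> v = w"
| "epath X v (e # es) w \<longleftrightarrow> e \<in> oriented_edges X \<and> initial X e = v \<and> epath X (terminal X e) es w"

lemma epath_append: "epath X v (es @ fs) w \<longleftrightarrow> (\<exists>u. epath X v es u \<and> epath X u fs w)"
  by (induction es arbitrary: v) auto

lemma map_eq_append_ConsE:
  assumes "map f es = u @ y # r"
  obtains U a R where "es = U @ a # R" "map f U = u" "f a = y" "map f R = r"
proof -
  obtain U V where UV: "es = U @ V" "map f U = u" "map f V = y # r"
    using assms by (auto simp: map_eq_append_conv)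
  then obtain a R where "V = a # R" "f a = y" "map f R = r" by auto
  then show ?thesis using that UV by blast
qed

text \<open>What a special quotient gives after lifting to its cover: the signs in
  \<open>rev_label\<close> and \<open>parallel_label\<close> come from two-sidedness,
  \<open>crs_irrefl\<close> from the absence of self-crossing, \<open>edge_unique\<close> from that
  of direct self-osculation and \<open>crs_corner\<close> from that of inter-osculation.\<close>

locale labelled_complex = complex X for X :: "'c cube_complex" +
  fixes lab :: "'c \<Rightarrow> 'l" and pos :: "'c \<Rightarrow> bool" and crs :: "'l \<Rightarrow> 'l \<Rightarrow> bool"
  assumes rev_label: "e \<in> oriented_edges X \<Longrightarrow> lab (rev_edge X e) = lab e \<and> pos (rev_edge X e) = (\<not> pos e)"
    and parallel_label: "parallel X e e' \<Longrightarrow> lab e' = lab e \<and> pos e' = pos e"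
    and corner_crs: "s \<in> squares X \<Longrightarrow> axes X s = [e, e'] \<Longrightarrow> crs (lab e) (lab e')"
    and crs_sym: "crs x y \<Longrightarrow> crs y x" and crs_irrefl: "\<not> crs x x"
    and edge_unique: "\<lbrakk>e \<in> oriented_edges X; e' \<in> oriented_edges X; initial X e = initial X e';
          lab e = lab e'; pos e = pos e'\<rbrakk> \<Longrightarrow> e = e'"
    and crs_corner: "\<lbrakk>e \<in> oriented_edges X; e' \<in> oriented_edges X; initial X e = initial X e';
          crs (lab e) (lab e')\<rbrakk> \<Longrightarrow> \<exists>s\<in>squares X. axes X s = [e, e']"
begin

definition lb :: "'c \<Rightarrow> nat \<Rightarrow> 'l" where
  "lb c i = lab (restr X c (edge_face (cdim X c) i False {}))"

definition ps :: "'c \<Rightarrow> nat \<Rightarrow> bool" where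
  "ps c i = pos (restr X c (edge_face (cdim X c) i False {}))"

text \<open>Parallel edges of a cube differ in the set \<open>S\<close>; adding an index
  \<open>j\<close> to it crosses the square in directions \<open>i\<close> and \<open>j\<close>,
  whose opposite edges have equal labels. Reversal flips the sign.\<close>

lemma label_edge_face:
  assumes c: "c \<in> charts X" "i < cdim X c"
  shows "lab (restr X c (edge_face (cdim X c) i b S)) = lb c i \<and>
    pos (restr X c (edge_face (cdim X c) i b S)) = (ps c i \<noteq> b)"
proof -
  let ?n = "cdim X c"
  have fin: "lab (restr X c (edge_face ?n i False S)) = lb c i \<and>
    pos (restr X c (edge_face ?n i False S)) = ps c i" if "finite S" for S
    using that
  proof (induction S rule: finite_induct)
    case empty
    then show ?case by (simp add: lb_def ps_def)
  next
    case (insert j S)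
    show ?case
    proof (cases "j < ?n \<and> j \<noteq> i")
      case False
      then have "edge_face ?n i False (insert j S) = edge_face ?n i False S"
        by (auto simp: edge_face_def)
      then show ?thesis using insert by simp
    next
      case True
      let ?s = "restr X c (square_face ?n i j S)"
      have fm: "face_map 2 ?n (square_face ?n i j S)" by (rule face_map_square_face) (use True c in auto)
      have s: "?s \<in> squares X" using restr_in[OF c(1) fm] by (simp add: squares_def)
      have "parallel X (restr X ?s [Coord 0 False, End False]) (restr X ?s [Coord 0 False, End True])"
        using s unfolding parallel_def by blast
      moreover have "restr X ?s [Coord 0 False, End b] =
          restr X c (edge_face ?n i False (if b then insert j S else S - {j}))" for b
        using restr_restr[OF c(1) fm face_map_small(3)] comp_square_edge(1)[of i ?n j] True c by auto
      ultimately have "parallel X (restr X c (edge_face ?n i False S)) (restr X c (edge_face ?n i False (insert j S)))"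
        using insert.hyps by simp
      then show ?thesis using parallel_label insert.IH by metis
    qed
  qed
  have "edge_face ?n i b S = edge_face ?n i b (S \<inter> {..<?n})" by (auto simp: edge_face_def)
  moreover have "lab (restr X c (edge_face ?n i b (S \<inter> {..<?n}))) = lb c i \<and>
    pos (restr X c (edge_face ?n i b (S \<inter> {..<?n}))) = (ps c i \<noteq> b)"
    using fin[of "S \<inter> {..<?n}"] edge_faces(1,2)[OF c, of False "S \<inter> {..<?n}"]
      rev_label[of "restr X c (edge_face ?n i False (S \<inter> {..<?n}))"]
    by (cases b) auto
  ultimately show ?thesis by simp
qed

lemma label_face:
  assumes c: "c \<in> charts X" and f: "face_map m (cdim X c) f" and j: "j < cdim X c" "f ! j = Coord i b"
  shows "lb (restr X c f) i = lb c j" "ps (restr X c f) i = (ps c j \<noteq> b)"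
proof -
  have i: "i < m" using face_map_coord_less[OF f j] .
  have "restr X (restr X c f) (edge_face m i False {}) = restr X c (edge_face (cdim X c) j b (true_set f))"
    using restr_restr[OF c f face_map_edge_face[OF i]] comp_face_axis[OF f j] by simp
  then show "lb (restr X c f) i = lb c j" "ps (restr X c f) i = (ps c j \<noteq> b)"
    using label_edge_face[OF c j(1)] restr_in[OF c f] unfolding lb_def[of "restr X c f"] ps_def[of "restr X c f"]
    by auto
qed

lemma coords_cross:
  assumes c: "c \<in> charts X" and ij: "i < cdim X c" "j < cdim X c" "i \<noteq> j"
  shows "crs (lb c i) (lb c j)"
proof -
  let ?n = "cdim X c"
  let ?s = "restr X c (square_face ?n i j {})"
  have fm: "face_map 2 ?n (square_face ?n i j {})" using ij by (intro face_map_square_face)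
  have s: "?s \<in> squares X" using restr_in[OF c fm] by (simp add: squares_def)
  have "axes X ?s = [restr X c (edge_face ?n i False {}), restr X c (edge_face ?n j False {})]"
    using square_axes[OF s] restr_restr[OF c fm face_map_small(3)] restr_restr[OF c fm face_map_small(4)]
      comp_square_edge[OF ij] by simp
  then show ?thesis using corner_crs[OF s] by (simp add: lb_def)
qed

text \<open>Distinct coordinates of a cube have crossing labels and no label crosses itself. So a
  label picks out at most one coordinate, which lets functions on the realization be defined label
  by label.\<close>

lemma lb_inj: "c \<in> charts X \<Longrightarrow> i < cdim X c \<Longrightarrow> j < cdim X c \<Longrightarrow> lb c i = lb c j \<Longrightarrow> i = j"
  using coords_cross crs_irrefl by metis

lemma edge_label: "e \<in> oriented_edges X \<Longrightarrow> lb e 0 = lab e \<and> ps e 0 = pos e"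
  using edge_as_face edge_in(2) by (simp add: lb_def ps_def)

text \<open>At the middle vertex the reverse of \<open>a\<close> starts together with
  \<open>c\<close>, and their labels cross, so they span a square; the new path follows its other
  two sides.\<close>

lemma square_swap:
  assumes a: "a \<in> oriented_edges X" and c: "c \<in> oriented_edges X" and ac: "terminal X a = initial X c"
    and x: "crs (lab a) (lab c)"
  obtains c' a' where "c' \<in> oriented_edges X" "a' \<in> oriented_edges X" "initial X c' = initial X a"
    "terminal X c' = initial X a'" "terminal X a' = terminal X c"
    "lab c' = lab c" "pos c' = pos c" "lab a' = lab a" "pos a' = pos a"
proof -
  note ra = rev_in[OF a] and la = rev_label[OF a]
  obtain s where s: "s \<in> squares X" "axes X s = [rev_edge X a, c]"
    using crs_corner[OF ra(1) c] ra la ac x by auto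
  have sc: "s \<in> charts X" "cdim X s = 2" using s by (auto simp: squares_def)
  have e: "rev_edge X a = restr X s (edge_face (cdim X s) 0 False {})" "c = restr X s (edge_face (cdim X s) 1 False {})"
    using s(2) square_axes[OF s(1)] square_edges[OF s(1)] sc by auto
  note F0 = edge_faces[OF sc(1), of 0] and F1 = edge_faces[OF sc(1), of 1]
  note L0 = label_edge_face[OF sc(1), of 0] and L1 = label_edge_face[OF sc(1), of 1]
  define c' where "c' = restr X s (edge_face (cdim X s) 1 False {0})"
  define a' where "a' = restr X s (edge_face (cdim X s) 0 True {1})"
  show ?thesis
  proof (rule that[of c' a'])
    show "c' \<in> oriented_edges X" "a' \<in> oriented_edges X"
      unfolding c'_def a'_def using F0 F1 sc by auto
    have "initial X a = terminal X (rev_edge X a)" using ra by simp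
    then show "initial X c' = initial X a"
      unfolding e(1) c'_def using F0(4)[of False "{}"] F1(3)[of False "{0}"] sc by simp
    show "terminal X c' = initial X a'"
      unfolding c'_def a'_def using F0(3)[of True "{1}"] F1(4)[of False "{0}"] sc by (simp add: insert_commute)
    show "terminal X a' = terminal X c"
      unfolding a'_def e(2) using F0(4)[of True "{1}"] F1(4)[of False "{}"] sc by simp
    show "lab c' = lab c" "pos c' = pos c"
      unfolding c'_def e(2) using L1[of False "{0}"] L1[of False "{}"] sc by auto
    have "lab (rev_edge X a) = lb s 0" "pos (rev_edge X a) = ps s 0"
      unfolding e(1) using L0[of False "{}"] sc by auto
    then show "lab a' = lab a" "pos a' = pos a"
      unfolding a'_def using L0[of True "{1}"] la sc by auto
  qed
qed

abbreviation word :: "'c list \<Rightarrow> ('l \<times> bool) list" where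
  "word \<equiv> map (\<lambda>e. (lab e, pos e))"

text \<open>The first \<open>x\<close> is moved to the right through squares, past letters that
  commute with it, until it meets its inverse. There \<open>edge_unique\<close> identifies the next
  edge as the reverse of this one, and both are deleted.\<close>

lemma not_reduced_shorten:
  assumes "epath X v es w" "word es = u @ (x, s) # vs @ (x, \<not> s) # t" "\<forall>z\<in>set vs. crs x (fst z)"
  shows "\<exists>es'. epath X v es' w \<and> length es' < length es"
  using assms
proof (induction vs arbitrary: es u)
  case Nil
  have "word es = u @ (x, s) # [] @ (x, \<not> s) # t" using Nil.prems(2) by simp
  then obtain U a R where 1: "es = U @ a # R" "(lab a, pos a) = (x, s)" "word R = [] @ (x, \<not> s) # t"
    by (rule map_eq_append_ConsE)
  from 1(3) obtain b T where 2: "R = b # T" "(lab b, pos b) = (x, \<not> s)"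
    by (rule map_eq_append_ConsE) auto
  have es: "es = U @ a # b # T" and ab: "lab a = x" "pos a = s" "lab b = x" "pos b = (\<not> s)"
    using 1 2 by auto
  then obtain p where p: "epath X v U p" "a \<in> oriented_edges X" "initial X a = p" "b \<in> oriented_edges X"
    "initial X b = terminal X a" "epath X (terminal X b) T w"
    using Nil.prems(1) by (auto simp: epath_append)
  have "b = rev_edge X a"
    using edge_unique[OF p(4) rev_in(1)[OF p(2)]] rev_in[OF p(2)] rev_label[OF p(2)] p ab by simp
  then have "epath X v (U @ T) w" using p rev_in[OF p(2)] by (auto simp: epath_append)
  then show ?case using es by (intro exI[of _ "U @ T"]) simp
next
  case (Cons z vs)
  from Cons.prems(2) obtain U a c V b T where es: "es = U @ a # c # V @ b # T"
    and w: "word U = u" "lab a = x" "pos a = s" "(lab c, pos c) = z" "word V = vs" "(lab b, pos b) = (x, \<not> s)" "word T = t"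
  proof -
    have "word es = u @ (x, s) # (z # vs @ (x, \<not> s) # t)" using Cons.prems(2) by simp
    then obtain U a R where 1: "es = U @ a # R" "word U = u" "(lab a, pos a) = (x, s)" "word R = z # vs @ (x, \<not> s) # t"
      by (rule map_eq_append_ConsE)
    then obtain c R' where 2: "R = c # R'" "(lab c, pos c) = z" "word R' = vs @ (x, \<not> s) # t" by auto
    from 2(3) obtain V b T where 3: "R' = V @ b # T" "word V = vs" "(lab b, pos b) = (x, \<not> s)" "word T = t"
      by (rule map_eq_append_ConsE)
    show thesis by (rule that[of U a c V b T]) (use 1 2 3 in auto)
  qed
  obtain p where p: "epath X v U p" "a \<in> oriented_edges X" "initial X a = p" "c \<in> oriented_edges X"
    "initial X c = terminal X a" "epath X (terminal X c) (V @ b # T) w"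
    using Cons.prems(1) es by (auto simp: epath_append)
  have "crs (lab a) (lab c)" using Cons.prems(3) w by auto
  then obtain c' a' where ca: "c' \<in> oriented_edges X" "a' \<in> oriented_edges X" "initial X c' = initial X a"
    "terminal X c' = initial X a'" "terminal X a' = terminal X c"
    "lab c' = lab c" "pos c' = pos c" "lab a' = lab a" "pos a' = pos a"
    using square_swap[OF p(2) p(4) p(5)[symmetric]] by blast
  have "epath X v (U @ c' # a' # V @ b # T) w"
    using p ca by (auto simp: epath_append)
  moreover have "word (U @ c' # a' # V @ b # T) = (u @ [z]) @ (x, s) # vs @ (x, \<not> s) # t"
    using w ca by auto
  ultimately obtain es' where "epath X v es' w" "length es' < length (U @ c' # a' # V @ b # T)"
    using Cons.IH[of "U @ c' # a' # V @ b # T" "u @ [z]"] Cons.prems(3) by auto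
  then show ?case using es by auto
qed

lemma reduced_path_exists:
  assumes "epath X v es w"
  obtains es' where "epath X v es' w" "reduced crs (word es')"
proof -
  define P where "P n = (\<exists>es. epath X v es w \<and> length es = n)" for n
  have "P (length es)" using assms by (auto simp: P_def)
  then have "P (LEAST n. P n)" by (rule LeastI)
  then obtain es' where es': "epath X v es' w" "length es' = (LEAST n. P n)" by (auto simp: P_def)
  have "reduced crs (word es')"
  proof (rule ccontr)
    assume "\<not> ?thesis"
    then obtain fs where "epath X v fs w" "length fs < length es'"
      using not_reduced_shorten[OF es'(1)] unfolding reduced_def by blast
    then show False using es'(2) not_less_Least[of "length fs" P] by (auto simp: P_def)
  qed
  then show ?thesis using that es' by blast
qed

end

section \<open>Lipschitz coordinate functions on the realization\<close>

definition tent :: "real \<Rightarrow> real" where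
  "tent u = min u (1 - u)"

text \<open>Two demands shape it: it vanishes at 0 and 1, to extend by 0 over cubes without this
  coordinate, and equals u - 1/2 on the middle half, where its sign tells the side of the midpoint.
  \<open>tent\<close> exceeds 1/4 exactly inside that middle half. Both are 1-Lipschitz.\<close>

definition wave :: "real \<Rightarrow> real" where
  "wave u = (if u \<le> 1/4 then - u else if u \<le> 3/4 then u - 1/2 else 1 - u)"

lemma point_eqI:
  assumes "equivclp (glue X) (c, t) (c', t')"
  shows "point X c t = point X c' t'"
  unfolding point_def
proof (intro Collect_cong iffI)
  show "equivclp (glue X) (c', t') q" if "equivclp (glue X) (c, t) q" for q
    by (rule equivclp_trans[OF equivclp_sym[OF assms] that])
  show "equivclp (glue X) (c, t) q" if "equivclp (glue X) (c', t') q" for q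
    by (rule equivclp_trans[OF assms that])
qed

lemma in_point: "(c, t) \<in> point X c t"
  by (simp add: point_def)

lemma realization_point: "c \<in> charts X \<Longrightarrow> t \<in> std_cube (cdim X c) \<Longrightarrow> point X c t \<in> realization X"
  unfolding realization_def by blast

lemma point_face:
  assumes "c \<in> charts X" "face_map m (cdim X c) f" "t \<in> std_cube m"
  shows "point X (restr X c f) t = point X c (apply_face f t)"
proof -
  have "glue X (restr X c f, t) (c, apply_face f t)" using assms unfolding glue_def by blast
  then show ?thesis by (intro point_eqI) (simp add: r_into_equivclp)
qed

lemma strung_nonneg: "strung X p l q \<Longrightarrow> l \<ge> 0"
  by (induction rule: strung.induct) (auto simp: eucl_dist_def)

lemma cube_dist_le: "strung X p l q \<Longrightarrow> p \<in> realization X \<Longrightarrow> q \<in> realization X \<Longrightarrow> cube_dist X p q \<le> l"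
  unfolding cube_dist_def by (auto intro!: cInf_lower bdd_belowI[of _ 0] strung_nonneg)

lemma cube_dist_ge:
  assumes "cube_connected X" "p \<in> realization X" "q \<in> realization X" "\<And>l. strung X p l q \<Longrightarrow> b \<le> l"
  shows "b \<le> cube_dist X p q"
  using assms unfolding cube_dist_def cube_connected_def by (auto intro!: cInf_greatest)

lemma coord_le_eucl_dist: "i < length t \<Longrightarrow> \<bar>t ! i - t' ! i\<bar> \<le> eucl_dist t t'"
proof -
  assume "i < length t"
  then have "\<bar>t ! i - t' ! i\<bar> \<le> L2_set (\<lambda>i. \<bar>t ! i - t' ! i\<bar>) {..<length t}"
    by (intro member_le_L2_set) auto
  also have "\<dots> = eucl_dist t t'" by (simp add: L2_set_def eucl_dist_def)
  finally show ?thesis .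
qed

context labelled_complex
begin

text \<open>The coordinate measured in the positive direction of its label, hence unchanged when a
  chart reflects it.\<close>

definition oc :: "'c \<Rightarrow> real list \<Rightarrow> nat \<Rightarrow> real" where
  "oc c t j = (if ps c j then t ! j else 1 - t ! j)"

definition V :: "(real \<Rightarrow> real) \<Rightarrow> 'l \<Rightarrow> 'c \<times> real list \<Rightarrow> real" where
  "V \<phi> x = (\<lambda>(c, t). if \<exists>j<cdim X c. lb c j = x then \<phi> (oc c t (THE j. j < cdim X c \<and> lb c j = x)) else 0)"

definition VV :: "(real \<Rightarrow> real) \<Rightarrow> 'l \<Rightarrow> ('c \<times> real list) set \<Rightarrow> real" where
  "VV \<phi> x p = V \<phi> x (SOME q. q \<in> p)"

lemma V_at: "c \<in> charts X \<Longrightarrow> j < cdim X c \<Longrightarrow> lb c j = x \<Longrightarrow> V \<phi> x (c, t) = \<phi> (oc c t j)"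
proof -
  assume *: "c \<in> charts X" "j < cdim X c" "lb c j = x"
  then have "(THE j. j < cdim X c \<and> lb c j = x) = j" using lb_inj by blast
  then show ?thesis using * by (auto simp: V_def)
qed

lemma V_none: "(\<And>j. j < cdim X c \<Longrightarrow> lb c j \<noteq> x) \<Longrightarrow> V \<phi> x (c, t) = 0"
  by (auto simp: V_def)

text \<open>If the cube has a coordinate labelled \<open>x\<close> that is constant on the face, its
  value there is 0 or 1, where \<phi> vanishes; this matches the default 0 for a face without such a
  coordinate. Otherwise face and cube share the oriented coordinate or both lack it.\<close>

lemma V_glue:
  assumes "glue X p q" and \<phi>: "\<phi> 0 = 0" "\<phi> 1 = 0"
  shows "V \<phi> x p = V \<phi> x q"
proof -
  obtain c m f t where c: "c \<in> charts X" and f: "face_map m (cdim X c) f" and t: "t \<in> std_cube m"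
    and pq: "p = (restr X c f, t)" "q = (c, apply_face f t)"
    using assms(1) unfolding glue_def by blast
  let ?c = "restr X c f"
  note r = restr_in[OF c f]
  have len: "length f = cdim X c" using f by (simp add: face_map_def)
  show ?thesis
  proof (cases "\<exists>i<m. lb ?c i = x")
    case True
    then obtain i where i: "i < m" "lb ?c i = x" by blast
    obtain j b where j: "j < cdim X c" "f ! j = Coord i b" using face_map_coord_ex[OF f i(1)] .
    note L = label_face[OF c f j]
    have "oc c (apply_face f t) j = oc ?c t i" using L j len by (auto simp: oc_def apply_face_def)
    then show ?thesis using V_at[OF c j(1), of x] V_at[OF r(1), of i x] i r L pq by simp
  next
    case False
    then have 0: "V \<phi> x p = 0" unfolding pq by (intro V_none) (use r in auto)
    show ?thesis
    proof (cases "\<exists>j<cdim X c. lb c j = x")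
      case True
      then obtain j where j: "j < cdim X c" "lb c j = x" by blast
      obtain e where e: "f ! j = End e"
      proof (cases "f ! j")
        case (Coord i b)
        then show ?thesis using False label_face[OF c f j(1) Coord] face_map_coord_less[OF f j(1) Coord] j by auto
      qed
      then have "oc c (apply_face f t) j \<in> {0, 1}" using j len by (auto simp: oc_def apply_face_def)
      then show ?thesis using 0 V_at[OF c j] \<phi> pq by auto
    next
      case False
      then have "V \<phi> x (c, apply_face f t) = 0" by (intro V_none) auto
      then show ?thesis using 0 pq by simp
    qed
  qed
qed

lemma V_equiv:
  assumes "equivclp (glue X) p q" "\<phi> 0 = 0" "\<phi> 1 = 0"
  shows "V \<phi> x p = V \<phi> x q"
  using assms(1) by (induction rule: equivclp_induct) (use V_glue assms(2,3) in metis)+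

lemma VV_point:
  assumes "\<phi> 0 = 0" "\<phi> 1 = 0"
  shows "VV \<phi> x (point X c t) = V \<phi> x (c, t)"
proof -
  have "(SOME q. q \<in> point X c t) \<in> point X c t" using in_point by (metis someI)
  then show ?thesis using V_equiv assms unfolding VV_def point_def by (metis mem_Collect_eq)
qed

lemma oc_range:
  assumes "t \<in> std_cube (cdim X c)" "j < cdim X c"
  shows "oc c t j \<in> {0..1}"
proof -
  have "t ! j \<in> set t" using assms by (simp add: std_cube_def)
  then have "t ! j \<in> {0..1}" using assms(1) unfolding std_cube_def by blast
  then show ?thesis by (auto simp: oc_def)
qed

text \<open>Inside one cube the function depends on a single coordinate, which changes by no more
  than the Euclidean distance. Summing over the string and taking the infimum makes the functions
  Lipschitz for \<open>cube_dist\<close>.\<close>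

lemma VV_strung:
  assumes "strung X p l q" and \<phi>: "\<phi> 0 = 0" "\<phi> 1 = 0"
    and lip: "\<And>u v. u \<in> {0..1} \<Longrightarrow> v \<in> {0..1} \<Longrightarrow> \<bar>\<phi> u - \<phi> v\<bar> \<le> \<bar>u - v\<bar>"
  shows "\<bar>VV \<phi> x p - VV \<phi> x q\<bar> \<le> l"
  using assms(1)
proof (induction rule: strung.induct)
  case (step p l c t t')
  have "\<bar>V \<phi> x (c, t) - V \<phi> x (c, t')\<bar> \<le> eucl_dist t t'"
  proof (cases "\<exists>j<cdim X c. lb c j = x")
    case True
    then obtain j where j: "j < cdim X c" "lb c j = x" by blast
    have "\<bar>V \<phi> x (c, t) - V \<phi> x (c, t')\<bar> = \<bar>\<phi> (oc c t j) - \<phi> (oc c t' j)\<bar>"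
      using V_at[OF step.hyps(2) j] by simp
    also have "\<dots> \<le> \<bar>oc c t j - oc c t' j\<bar>"
      by (rule lip) (use oc_range step.hyps j in blast)+
    also have "\<dots> = \<bar>t ! j - t' ! j\<bar>" by (auto simp: oc_def)
    also have "\<dots> \<le> eucl_dist t t'" by (rule coord_le_eucl_dist) (use step.hyps j in \<open>simp add: std_cube_def\<close>)
    finally show ?thesis .
  next
    case False
    then have "V \<phi> x (c, t) = 0" "V \<phi> x (c, t') = 0" by (auto intro!: V_none)
    then show ?thesis by (simp add: eucl_dist_def)
  qed
  then show ?case using step.IH unfolding VV_point[where \<phi> = \<phi>, OF \<phi>] by linarith
qed simp

definition dA :: "'l \<Rightarrow> ('c \<times> real list) set \<Rightarrow> real" where "dA = VV tent"
definition dB :: "'l \<Rightarrow> ('c \<times> real list) set \<Rightarrow> real" where "dB = VV wave"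

lemma dAB_point: "dA x (point X c t) = V tent x (c, t)" "dB x (point X c t) = V wave x (c, t)"
  unfolding dA_def dB_def by (rule VV_point; simp add: tent_def wave_def)+

lemma dAB_lipschitz:
  assumes "cube_connected X" "p \<in> realization X" "q \<in> realization X"
  shows "\<bar>dA x p - dA x q\<bar> \<le> cube_dist X p q" "\<bar>dB x p - dB x q\<bar> \<le> cube_dist X p q"
proof -
  have t: "\<bar>tent u - tent v\<bar> \<le> \<bar>u - v\<bar>" for u v by (auto simp: tent_def min_def)
  have w: "\<bar>wave u - wave v\<bar> \<le> \<bar>u - v\<bar>" for u v by (auto simp: wave_def)
  show "\<bar>dA x p - dA x q\<bar> \<le> cube_dist X p q"
    by (rule cube_dist_ge[OF assms]) (auto simp: dA_def tent_def intro!: VV_strung t[unfolded tent_def])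
  show "\<bar>dB x p - dB x q\<bar> \<le> cube_dist X p q"
    unfolding dB_def by (rule cube_dist_ge[OF assms], rule VV_strung) (use w in \<open>auto simp: wave_def[of 0] wave_def[of 1]\<close>)
qed

lemma dA_nonzero:
  assumes "p = point X c t" "c \<in> charts X" "dA x p \<noteq> 0"
  obtains j where "j < cdim X c" "lb c j = x"
  using assms V_none[of c x tent t] unfolding dAB_point assms(1) by metis

lemma dA_cross:
  assumes "p \<in> realization X" "dA x p \<noteq> 0" "dA x' p \<noteq> 0" "x \<noteq> x'"
  shows "crs x x'"
proof -
  obtain c t where c: "p = point X c t" "c \<in> charts X" using assms(1) by (auto simp: realization_def)
  then show ?thesis using dA_nonzero[OF c assms(2)] dA_nonzero[OF c assms(3)] coords_cross assms(4) by metis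
qed

lemma finite_active: "p \<in> realization X \<Longrightarrow> finite {x. dA x p \<noteq> 0}"
proof -
  assume "p \<in> realization X"
  then obtain c t where c: "p = point X c t" "c \<in> charts X" by (auto simp: realization_def)
  have "{x. dA x p \<noteq> 0} \<subseteq> lb c ` {..<cdim X c}" using dA_nonzero[OF c] by blast
  then show ?thesis using finite_subset by blast
qed

text \<open>Near the threshold 1/4 of \<open>dA\<close> the function \<open>dB\<close> stays away
  from 0; so the side of a point cannot change where its label is about to become inactive.\<close>

lemma dB_of_dA:
  assumes "p \<in> realization X" "dA x p > 1/4"
  shows "\<bar>dB x p\<bar> = 1/2 - dA x p"
proof -
  obtain c t where c: "p = point X c t" "c \<in> charts X" "t \<in> std_cube (cdim X c)"
    using assms(1) by (auto simp: realization_def)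
  have "dA x p \<noteq> 0" using assms(2) by simp
  then obtain j where j: "j < cdim X c" "lb c j = x" by (rule dA_nonzero[OF c(1,2)])
  show ?thesis
    using assms(2) V_at[OF c(2) j] oc_range[OF c(3) j(1)] unfolding c(1) dAB_point
    by (auto simp: tent_def wave_def min_def split: if_splits)
qed

lemma dA_edge:
  assumes "e \<in> oriented_edges X"
  shows "dA (lab e) (point X e [s]) = tent s" "x \<noteq> lab e \<Longrightarrow> dA x (point X e [s]) = 0"
    "dB (lab e) (point X e [s]) = (if pos e then wave s else wave (1 - s))"
proof -
  note e = edge_in[OF assms] edge_label[OF assms]
  have oc: "oc e [s] 0 = (if pos e then s else 1 - s)" using e by (simp add: oc_def)
  show "dA (lab e) (point X e [s]) = tent s"
    using V_at[of e 0 "lab e" tent "[s]"] e oc unfolding dAB_point by (auto simp: tent_def min_def)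
  show "dB (lab e) (point X e [s]) = (if pos e then wave s else wave (1 - s))"
    using V_at[of e 0 "lab e" wave "[s]"] e oc unfolding dAB_point by auto
  show "x \<noteq> lab e \<Longrightarrow> dA x (point X e [s]) = 0"
    unfolding dAB_point by (rule V_none) (use e in auto)
qed

lemma edge_points:
  assumes "e \<in> oriented_edges X" "s \<in> {0..1}"
  shows "point X e [s] \<in> realization X"
    "s' \<in> {0..1} \<Longrightarrow> cube_dist X (point X e [s]) (point X e [s']) \<le> \<bar>s - s'\<bar>"
    "point X e [0] = point X (initial X e) []" "point X e [1] = point X (terminal X e) []"
proof -
  note e = edge_in[OF assms(1)]
  have std: "[s] \<in> std_cube (cdim X e)" if "s \<in> {0..1}" for s using that e by (simp add: std_cube_def)
  show r: "point X e [s] \<in> realization X" by (rule realization_point[OF e(1) std[OF assms(2)]])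
  show "cube_dist X (point X e [s]) (point X e [s']) \<le> \<bar>s - s'\<bar>" if s': "s' \<in> {0..1}"
  proof -
    have "strung X (point X e [s]) (0 + eucl_dist [s] [s']) (point X e [s'])"
      by (rule strung.step[OF strung.refl[OF r]]) (use std e assms s' in auto)
    then show ?thesis
      using cube_dist_le[OF _ r realization_point[OF e(1) std[OF s']]]
      by (simp add: eucl_dist_def L2_set_def lessThan_Suc)
  qed
  have 0: "[] \<in> std_cube 0" by (simp add: std_cube_def)
  show "point X e [0] = point X (initial X e) []" "point X e [1] = point X (terminal X e) []"
    using point_face[OF e(1), of 0 "[End False]" "[]"] point_face[OF e(1), of 0 "[End True]" "[]"]
      face_map_small(2) 0 e by (auto simp: initial_def terminal_def apply_face_def)
qed

lemma vertex_point: "v \<in> vertices X \<Longrightarrow> point X v [] \<in> realization X"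
  by (rule realization_point) (auto simp: vertices_def std_cube_def)

end

section \<open>Connectedness of the 1-skeleton\<close>

context complex
begin

definition conn :: "'c \<Rightarrow> 'c \<Rightarrow> bool" where
  "conn v w \<longleftrightarrow> (\<exists>es. epath X v es w)"

lemma conn_refl: "conn v v"
  unfolding conn_def by (rule exI[of _ "[]"]) simp

lemma conn_trans: "conn u v \<Longrightarrow> conn v w \<Longrightarrow> conn u w"
  unfolding conn_def using epath_append by metis

lemma conn_edge: "e \<in> oriented_edges X \<Longrightarrow> conn (initial X e) (terminal X e)"
  unfolding conn_def by (rule exI[of _ "[e]"]) simp

lemma conn_sym: "conn v w \<Longrightarrow> conn w v"
proof -
  have "conn w v" if "epath X v es w" for es
    using that
  proof (induction es arbitrary: v)
    case (Cons e es)
    then have e: "e \<in> oriented_edges X" "initial X e = v" and "conn w (terminal X e)" by auto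
    moreover have "conn (terminal X e) v"
      using conn_edge[OF rev_in(1)[OF e(1)]] rev_in(3,4)[OF e(1)] e(2) by simp
    ultimately show ?case using conn_trans by blast
  qed (simp add: conn_refl)
  then show "conn v w \<Longrightarrow> conn w v" by (auto simp: conn_def)
qed

lemma conn_corner:
  assumes c: "c \<in> charts X"
  shows "conn (restr X c (vertex_face (cdim X c) {})) (restr X c (vertex_face (cdim X c) S))"
proof -
  let ?n = "cdim X c"
  have fin: "conn (restr X c (vertex_face ?n {})) (restr X c (vertex_face ?n S))" if "finite S" for S
    using that
  proof (induction S rule: finite_induct)
    case (insert j S)
    show ?case
    proof (cases "j < ?n")
      case True
      have "conn (restr X c (vertex_face ?n S)) (restr X c (vertex_face ?n (insert j S)))"
        using conn_edge[OF edge_faces(1)[OF c True, of False S]] edge_faces(3,4)[OF c True, of False S] insert.hyps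
        by simp
      then show ?thesis using insert.IH conn_trans by blast
    next
      case False
      then have "vertex_face ?n (insert j S) = vertex_face ?n S" by (auto simp: vertex_face_def)
      then show ?thesis using insert.IH by simp
    qed
  qed (rule conn_refl)
  have "vertex_face ?n S = vertex_face ?n (S \<inter> {..<?n})" by (auto simp: vertex_face_def)
  then show ?thesis using fin[of "S \<inter> {..<?n}"] by simp
qed

lemma conn_origin_face:
  assumes c: "c \<in> charts X" and f: "face_map m (cdim X c) f"
  shows "conn (origin X c) (origin X (restr X c f))"
  using conn_corner[OF c, of "true_set f"] restr_in[OF c f] restr_restr[OF c f face_map_vertex_face]
  by (simp add: origin_eq comp_face_origin[OF f])

lemma conn_equiv:
  assumes "equivclp (glue X) p q"
  shows "conn (origin X (fst p)) (origin X (fst q))"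
  using assms
proof (induction rule: equivclp_induct)
  case (step q r)
  then have "conn (origin X (fst q)) (origin X (fst r))"
    unfolding glue_def using conn_origin_face conn_sym by fastforce
  then show ?case using step.IH conn_trans by blast
qed (rule conn_refl)

text \<open>The component containing the origin of a chart is the same for all charts representing a
  point, and for two points of one cube; so it is constant along any string of points.\<close>

lemma vertices_connected:
  assumes "cube_connected X" "v \<in> vertices X" "w \<in> vertices X"
  shows "conn v w"
proof -
  have orig: "origin X u = u" if "u \<in> vertices X" for u
    using that restr_id[of u] by (simp add: origin_def vertices_def id_face_def)
  have r: "point X u [] \<in> realization X" if "u \<in> vertices X" for u
    using that by (intro realization_point) (auto simp: vertices_def std_cube_def)
  have "\<forall>z\<in>q. conn v (origin X (fst z))" if "strung X (point X v []) l q" for l q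
    using that
  proof (induction "point X v []" l q rule: strung.induct)
    case refl
    show ?case using conn_equiv[of "(v, [])"] orig[OF assms(2)] by (auto simp: point_def)
  next
    case (step l c t t')
    then have "conn v (origin X c)" using in_point by force
    then show ?case using conn_equiv[of "(c, t')"] conn_trans by (fastforce simp: point_def)
  qed
  moreover obtain l where "strung X (point X v []) l (point X w [])"
    using assms(1) r[OF assms(2)] r[OF assms(3)] unfolding cube_connected_def by blast
  ultimately have "conn v (origin X w)" using in_point by force
  then show ?thesis using orig[OF assms(3)] by simp
qed

lemma vertex_exists: "charts X \<noteq> {} \<Longrightarrow> \<exists>v. v \<in> vertices X"
proof -
  assume "charts X \<noteq> {}"
  then obtain c where c: "c \<in> charts X" by blast
  have "restr X c (vertex_face (cdim X c) {}) \<in> vertices X"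
    using restr_in[OF c face_map_vertex_face] by (simp add: vertices_def)
  then show ?thesis by blast
qed

end

section \<open>Developing maps\<close>

lemma equivclp_glue_image:
  assumes "cubical_action H X \<phi>" "g \<in> carrier H" "is_cube_complex X"
    and "equivclp (glue X) p q" "fst p \<in> charts X"
  shows "fst q \<in> charts X \<and> equivclp (glue X) (\<phi> g (fst p), snd p) (\<phi> g (fst q), snd q)"
  using assms(4)
proof (induction rule: equivclp_induct)
  case (step q r)
  interpret complex X by standard (rule assms(3))
  interpret group_action H "charts X" \<phi> using assms(1) by (simp add: cubical_action_def)
  have *: "a \<in> charts X \<Longrightarrow> face_map m (cdim X a) f \<Longrightarrow> \<phi> g (restr X a f) = restr X (\<phi> g a) f"
    "a \<in> charts X \<Longrightarrow> cdim X (\<phi> g a) = cdim X a" for a m f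
    using assms(1,2) by (auto simp: cubical_action_def)
  have g: "fst a \<in> charts X \<and> fst b \<in> charts X \<and> glue X (\<phi> g (fst a), snd a) (\<phi> g (fst b), snd b)"
    if ab: "glue X a b" for a b
  proof -
    obtain c m f t where c: "c \<in> charts X" "face_map m (cdim X c) f" "t \<in> std_cube m"
      "a = (restr X c f, t)" "b = (c, apply_face f t)"
      using ab unfolding glue_def by blast
    moreover have "\<phi> g c \<in> charts X" using element_image[OF assms(2) c(1)] by blast
    ultimately have "glue X (restr X (\<phi> g c) f, t) (\<phi> g c, apply_face f t)"
      unfolding glue_def using *(2)[OF c(1)] by metis
    then show ?thesis using c *(1)[OF c(1,2)] by simp
  qed
  then have "fst r \<in> charts X" using step.hyps(2) by blast
  moreover have "equivclp (glue X) (\<phi> g (fst q), snd q) (\<phi> g (fst r), snd r)"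
    using step.hyps(2) g by (metis equivclp_sym r_into_equivclp)
  ultimately show ?case using step.IH equivclp_trans by metis
qed (use assms in simp)

text \<open>\<open>act_point\<close> is only the image of a class; that this image is a whole class
  again follows by moving back with the inverse element.\<close>

lemma act_point_point:
  assumes "cubical_action H X \<phi>" "g \<in> carrier H" "is_cube_complex X" "c \<in> charts X"
  shows "act_point \<phi> g (point X c t) = point X (\<phi> g c) t"
proof
  interpret group_action H "charts X" \<phi> using assms(1) by (simp add: cubical_action_def)
  show "act_point \<phi> g (point X c t) \<subseteq> point X (\<phi> g c) t"
    using equivclp_glue_image[OF assms(1-3), of "(c, t)"] assms(4)
    by (auto simp: act_point_def point_def)
  show "point X (\<phi> g c) t \<subseteq> act_point \<phi> g (point X c t)"
  proof
    fix q assume "q \<in> point X (\<phi> g c) t"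
    then have q: "equivclp (glue X) (\<phi> g c, t) q" by (simp add: point_def)
    have gi: "inv\<^bsub>H\<^esub> g \<in> carrier H" using assms(2) by (simp add: group.inv_closed group_hom.axioms(1)[OF group_hom])
    have c: "\<phi> g c \<in> charts X" "\<phi> (inv\<^bsub>H\<^esub> g) (\<phi> g c) = c"
      using element_image[OF assms(2,4)] orbit_sym_aux[OF assms(2,4)] by auto
    have e: "fst q \<in> charts X" "equivclp (glue X) (c, t) (\<phi> (inv\<^bsub>H\<^esub> g) (fst q), snd q)"
      using equivclp_glue_image[OF assms(1) gi assms(3) q] c by auto
    have "\<phi> g (\<phi> (inv\<^bsub>H\<^esub> g) (fst q)) = fst q"
      using orbit_sym_aux[OF gi e(1)] assms(2) by (simp add: group.inv_inv group_hom.axioms(1)[OF group_hom])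
    then show "q \<in> act_point \<phi> g (point X c t)"
      using e(2) unfolding act_point_def point_def
      by (intro image_eqI[of _ _ "(\<phi> (inv\<^bsub>H\<^esub> g) (fst q), snd q)"]) auto
  qed
qed

lemma free_on_vertices:
  assumes "cubical_action H X \<phi>" "free_action H X \<phi>" "is_cube_complex X"
    and "g \<in> carrier H" "v \<in> vertices X" "\<phi> g v = v"
  shows "g = \<one>\<^bsub>H\<^esub>"
proof -
  have v: "v \<in> charts X" "[] \<in> std_cube (cdim X v)" using assms(5) by (auto simp: vertices_def std_cube_def)
  have "act_point \<phi> g (point X v []) = point X v []"
    using act_point_point[OF assms(1,4,3) v(1)] assms(6) by simp
  then show ?thesis using assms(2,4) realization_point[OF v] unfolding free_action_def by blast
qed

text \<open>All that the construction uses of the maps: opposite signs are mutually inverse, and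
  crossing labels have disjoint invariant supports. The type acted upon is arbitrary.\<close>

locale local_rep = labelled_complex X lab pos crs
  for X :: "'c cube_complex" and lab :: "'c \<Rightarrow> 'l" and pos crs +
  fixes Psi :: "bool \<Rightarrow> 'l \<Rightarrow> 'r \<Rightarrow> 'r" and supp :: "'l \<Rightarrow> 'r set"
  assumes Psi_cancel: "Psi \<sigma> x (Psi (\<not> \<sigma>) x y) = y"
    and Psi_out: "y \<notin> supp x \<Longrightarrow> Psi \<sigma> x y = y"
    and Psi_supp: "y \<in> supp x \<Longrightarrow> Psi \<sigma> x y \<in> supp x"
    and supp_disjoint: "crs x x' \<Longrightarrow> supp x \<inter> supp x' = {}"
    and CAT0: "CAT0_cube_complex X"
begin

text \<open>Transport from side \<open>a\<close> to side \<open>b\<close>, with the sign of the side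
  reached; the cocycle law holds because the two signs are mutually inverse.\<close>

definition E :: "'l \<Rightarrow> bool \<Rightarrow> bool \<Rightarrow> 'r \<Rightarrow> 'r" where
  "E x a b = (if a = b then id else Psi b x)"

lemma E_comp: "E x a b (E x b c y) = E x a c y"
  using Psi_cancel[of True] Psi_cancel[of False] by (cases a; cases b; cases c) (auto simp: E_def)

text \<open>The thresholds fit together: for points less than 1/8 apart, a label active at one has
  \<open>dA\<close> above 1/8, hence nonzero, at the other. If it is inactive at one of them,
  \<open>dA\<close> is at most 3/8 at the other, so where it is active \<open>dB\<close> has size at
  least 1/8 and keeps its sign over such a distance.\<close>

definition act :: "'l \<Rightarrow> ('c \<times> real list) set \<Rightarrow> bool" where
  "act x p \<longleftrightarrow> dA x p > 1/4"

definition side :: "'l \<Rightarrow> ('c \<times> real list) set \<Rightarrow> bool" where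
  "side x p \<longleftrightarrow> dB x p \<ge> 0"

definition Ea :: "'l \<Rightarrow> ('c \<times> real list) set \<Rightarrow> ('c \<times> real list) set \<Rightarrow> 'r \<Rightarrow> 'r" where
  "Ea x p q = (if act x p \<and> act x q then E x (side x p) (side x q) else id)"

text \<open>Crossing the midpoint of a cube coordinate labelled \<open>x\<close> contributes \<open>Psi\<close> of \<open>x\<close>. The labels crossed between two
  nearby points are coordinates of a common cube, so their supports are disjoint and the
  product of their contributions is read off pointwise.\<close>

definition T :: "('c \<times> real list) set \<Rightarrow> ('c \<times> real list) set \<Rightarrow> 'r \<Rightarrow> 'r" where
  "T p q y = (if \<exists>x. act x p \<and> act x q \<and> y \<in> supp x
     then Ea (SOME x. act x p \<and> act x q \<and> y \<in> supp x) p q y else y)"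

lemma connected: "cube_connected X" and CAT0_real: "CAT0 (realization X) (cube_dist X)"
  and charts_ne: "charts X \<noteq> {}"
  using CAT0 by (auto simp: CAT0_cube_complex_def)

text \<open>Labels nonzero at a common point cross, so at most one of them has \<open>y\<close> in
  its support. Asking only for \<open>dA\<close> nonzero covers points where the label itself is
  inactive.\<close>

lemma T_eq:
  assumes "p \<in> realization X" "dA x p \<noteq> 0" "y \<in> supp x"
  shows "T p q y = Ea x p q y"
proof (cases "\<exists>x. act x p \<and> act x q \<and> y \<in> supp x")
  case True
  then have "act (SOME x. act x p \<and> act x q \<and> y \<in> supp x) p \<and> y \<in> supp (SOME x. act x p \<and> act x q \<and> y \<in> supp x)"
    by (rule someI2_ex) blast
  moreover have "x' = x" if "act x' p" "y \<in> supp x'" for x'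
    using dA_cross[OF assms(1), of x x'] supp_disjoint[of x x'] assms that by (auto simp: act_def)
  ultimately have "(SOME x. act x p \<and> act x q \<and> y \<in> supp x) = x" by blast
  then show ?thesis using True by (simp add: T_def)
next
  case False
  then show ?thesis using assms(3) unfolding T_def Ea_def by auto
qed

lemma T_fix: "(\<And>x. act x p \<Longrightarrow> y \<notin> supp x) \<Longrightarrow> T p q y = y"
  unfolding T_def by auto

lemma same_side:
  assumes "p \<in> realization X" "r \<in> realization X" "cube_dist X p r < 1/8" "act x p" "act x r" "dA x p \<le> 3/8"
  shows "side x p = side x r"
  using dB_of_dA[OF assms(1), of x] dB_of_dA[OF assms(2), of x] dAB_lipschitz[OF connected assms(1,2), of x] assms(3-6)
  unfolding act_def side_def by linarith

text \<open>The delicate case is a label active at exactly two of the three points: being close to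
  the third, these two lie away from the midpoint and on the same side, so the transport between
  them is trivial.\<close>

lemma Ea_comp:
  assumes M: "p \<in> realization X" "q \<in> realization X" "r \<in> realization X"
    and d: "cube_dist X p q < 1/8" "cube_dist X q r < 1/8" "cube_dist X p r < 1/8"
  shows "Ea x p q (Ea x q r y) = Ea x p r y"
proof -
  note L = dAB_lipschitz(1)[OF connected M(1,2), of x] dAB_lipschitz(1)[OF connected M(2,3), of x]
    dAB_lipschitz(1)[OF connected M(1,3), of x]
  consider "act x p" "act x q" "act x r" | "act x p" "act x q" "\<not> act x r" | "act x p" "\<not> act x q" "act x r"
    | "\<not> act x p" "act x q" "act x r" | "\<not> act x p" "\<not> act x q" | "\<not> act x p" "\<not> act x r" | "\<not> act x q" "\<not> act x r"
    by blast
  then show ?thesis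
  proof cases
    case 1 then show ?thesis by (simp add: Ea_def E_comp)
  next
    case 2
    then have "dA x p \<le> 3/8" using L d unfolding act_def by linarith
    then have "side x p = side x q" using same_side[OF M(1,2) d(1)] 2 by blast
    then show ?thesis using 2 by (simp add: Ea_def E_def)
  next
    case 3
    then have "dA x p \<le> 3/8" using L d unfolding act_def by linarith
    then have "side x p = side x r" using same_side[OF M(1,3) d(3)] 3 by blast
    then show ?thesis using 3 by (simp add: Ea_def E_def)
  next
    case 4
    then have "dA x q \<le> 3/8" using L d unfolding act_def by linarith
    then have "side x q = side x r" using same_side[OF M(2,3) d(2)] 4 by blast
    then show ?thesis using 4 by (simp add: Ea_def E_def)
  qed (auto simp: Ea_def)
qed

lemma Ea_supp: "y \<in> supp x \<Longrightarrow> Ea x p q y \<in> supp x"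
  by (auto simp: Ea_def E_def Psi_supp)

text \<open>If a label active at \<open>p\<close> or \<open>q\<close> has \<open>y\<close> in its
  support, this one label governs all three transports at \<open>y\<close>, and the law reduces to
  that for \<open>Ea\<close>; otherwise all three fix \<open>y\<close>.\<close>

lemma T_comp:
  assumes M: "p \<in> realization X" "q \<in> realization X" "r \<in> realization X"
    and d: "cube_dist X p q < 1/8" "cube_dist X q r < 1/8" "cube_dist X p r < 1/8"
  shows "T p q \<circ> T q r = T p r"
proof
  fix y
  show "(T p q \<circ> T q r) y = T p r y"
  proof (cases "\<exists>x. (act x p \<or> act x q) \<and> y \<in> supp x")
    case True
    then obtain x where x: "act x p \<or> act x q" "y \<in> supp x" by blast
    have "dA x p \<noteq> 0" "dA x q \<noteq> 0"
      using x(1) dAB_lipschitz(1)[OF connected M(1,2), of x] d(1) unfolding act_def by auto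
    then show ?thesis
      using x T_eq[OF M(1)] T_eq[OF M(2)] Ea_supp Ea_comp[OF M d] by simp
  next
    case False
    have "T p q y = y" "T q r y = y" "T p r y = y" by (rule T_fix; use False in blast)+
    then show ?thesis by simp
  qed
qed

lemma T_refl: "T p p = id"
  by (rule ext) (auto simp: T_def Ea_def E_def)

definition mu :: "'c \<Rightarrow> 'r \<Rightarrow> 'r" where
  "mu e = Psi (pos e) (lab e)"

lemma T_edge:
  assumes e: "e \<in> oriented_edges X" and s: "s \<in> {0..1}"
  shows "T (point X e [s]) (point X e [s']) = Ea (lab e) (point X e [s]) (point X e [s'])"
proof
  fix y
  let ?p = "point X e [s]"
  have other: "x = lab e" if "act x ?p" for x
    using dA_edge(2)[OF e, of x s] that unfolding act_def by fastforce
  show "T ?p (point X e [s']) y = Ea (lab e) ?p (point X e [s']) y"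
  proof (cases "y \<in> supp (lab e) \<and> act (lab e) ?p")
    case True
    then have "dA (lab e) ?p \<noteq> 0" unfolding act_def by auto
    then show ?thesis using True T_eq edge_points(1)[OF e s] by blast
  next
    case False
    then have "Ea (lab e) ?p (point X e [s']) y = y" by (auto simp: Ea_def E_def Psi_out)
    then show ?thesis using T_fix other False by metis
  qed
qed

text \<open>At the midpoint itself, \<open>side\<close> agrees with the end point of positive edges and the starting
  point of negative ones; hence the asymmetric comparison.\<close>

lemma transport_edge:
  assumes e: "e \<in> oriented_edges X"
    and F: "\<And>p q. \<lbrakk>p \<in> realization X; q \<in> realization X; cube_dist X p q < 1/8\<rbrakk> \<Longrightarrow> F p \<circ> T p q = F q"
  shows "F (point X (terminal X e) []) = F (point X (initial X e) []) \<circ> mu e"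
proof -
  define cr where "cr s = (if pos e then s \<ge> 1/2 else s > (1/2 :: real))" for s
  let ?q = "\<lambda>s. point X e [s]"
  have Ea: "Ea (lab e) (?q s) (?q s') = (if cr s = cr s' then id else mu e)"
    if s: "s \<in> {0..1}" "s' \<in> {0..1}" "s \<le> s'" "s' - s < 1/8" for s s'
  proof -
    have side: "side (lab e) (?q u) \<longleftrightarrow> (if pos e then u \<ge> 1/2 else u \<le> 1/2)" if "act (lab e) (?q u)" for u
      using that dA_edge[OF e] unfolding act_def side_def by (auto simp: tent_def wave_def min_def split: if_splits)
    \<comment> \<open>Two points separated by the midpoint lie within 1/8 of it, hence in the middle
      half.\<close>
    have "act (lab e) (?q s) \<and> act (lab e) (?q s')" if "cr s \<noteq> cr s'"
      using that s unfolding act_def dA_edge(1)[OF e] cr_def tent_def by (auto split: if_splits)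
    then show ?thesis
      using side[of s] side[of s'] s unfolding Ea_def E_def mu_def cr_def by auto
  qed
  \<comment> \<open>Ten steps of length 1/10 < 1/8 each; exactly one of them crosses the
    midpoint.\<close>
  have "F (?q (real k / 10)) = F (?q 0) \<circ> (if cr (real k / 10) then mu e else id)" if "k \<le> 10" for k
    using that
  proof (induction k)
    case 0 show ?case by (simp add: cr_def)
  next
    case (Suc k)
    let ?s = "real k / 10" and ?t = "real (Suc k) / 10"
    have "?t - ?s = 1/10" by (simp add: diff_divide_distrib[symmetric])
    then have "?s \<le> ?t" "?t - ?s < 1/8" by linarith+
    moreover have "?s \<in> {0..1}" "?t \<in> {0..1}" using Suc.prems by auto
    ultimately have s: "?s \<in> {0..1}" "?t \<in> {0..1}" "?s \<le> ?t" "?t - ?s < 1/8" by blast+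
    have "cube_dist X (?q ?s) (?q ?t) < 1/8" using edge_points(2)[OF e s(1,2)] s by linarith
    then have "F (?q ?t) = F (?q ?s) \<circ> T (?q ?s) (?q ?t)"
      using F edge_points(1)[OF e] s by metis
    also have "\<dots> = F (?q 0) \<circ> (if cr ?s then mu e else id) \<circ> (if cr ?s = cr ?t then id else mu e)"
    proof -
      have IH: "F (?q ?s) = F (?q 0) \<circ> (if cr ?s then mu e else id)"
        by (rule Suc.IH) (use Suc.prems in simp)
      show ?thesis by (simp only: IH T_edge[OF e s(1)] Ea[OF s])
    qed
    also have "\<dots> = F (?q 0) \<circ> (if cr ?t then mu e else id)"
      using s(3) by (auto simp: cr_def)
    finally show ?case .
  qed
  from this[of 10] have "F (?q 1) = F (?q 0) \<circ> mu e" by (simp add: cr_def)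
  then show ?thesis using edge_points(3,4)[OF e, of 0] by simp
qed

definition mprod :: "'c list \<Rightarrow> 'r \<Rightarrow> 'r" where
  "mprod es = foldr (\<lambda>e f. mu e \<circ> f) es id"

lemma developing_map:
  assumes "v0 \<in> vertices X"
  obtains F where "F v0 = id" "\<And>v es w. epath X v es w \<Longrightarrow> F w = F v \<circ> mprod es"
proof -
  obtain F where F: "F (point X v0 []) = id"
    "\<And>p q. \<lbrakk>p \<in> realization X; q \<in> realization X; cube_dist X p q < 1/8\<rbrakk> \<Longrightarrow> F p \<circ> T p q = F q"
    using CAT0_integrate_cocycle[OF CAT0_real vertex_point[OF assms], of "1/8" T] T_refl T_comp by auto
  have "F (point X w []) = F (point X v []) \<circ> mprod es" if "epath X v es w" for v es w
    using that
  proof (induction es arbitrary: v)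
    case (Cons e es)
    have "F (point X w []) = F (point X (terminal X e) []) \<circ> mprod es"
      by (rule Cons.IH) (use Cons.prems in simp)
    also have "\<dots> = F (point X v []) \<circ> mu e \<circ> mprod es"
      using transport_edge[of e F] F(2) Cons.prems by auto
    finally show ?case by (simp add: mprod_def comp_assoc)
  qed (simp add: mprod_def)
  then show ?thesis using that[of "\<lambda>v. F (point X v [])"] F(1) by blast
qed

end

section \<open>Free cocompact actions that preserve the labels\<close>

locale labelled_action = labelled_complex X lab pos crs
  for X :: "'c cube_complex" and lab :: "'c \<Rightarrow> 'l" and pos crs +
  fixes H :: "('a, 'b) monoid_scheme" and \<phi> :: "'a \<Rightarrow> 'c \<Rightarrow> 'c"
  assumes CAT0: "CAT0_cube_complex X"
    and action: "cubical_action H X \<phi>"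
    and free: "free_action H X \<phi>"
    and cocompact: "cocompact_action H X \<phi>"
    and label_inv: "g \<in> carrier H \<Longrightarrow> e \<in> oriented_edges X \<Longrightarrow> lab (\<phi> g e) = lab e \<and> pos (\<phi> g e) = pos e"
begin

sublocale group_action H "charts X" \<phi>
  using action by (simp add: cubical_action_def)

lemma group_H: "group H"
  using group_hom group_hom.axioms(1) by blast

lemma act_chart:
  assumes "g \<in> carrier H" "c \<in> charts X"
  shows "\<phi> g c \<in> charts X" "cdim X (\<phi> g c) = cdim X c"
    "face_map m (cdim X c) f \<Longrightarrow> \<phi> g (restr X c f) = restr X (\<phi> g c) f"
  using action assms element_image[OF assms] by (auto simp: cubical_action_def)

lemma act_edge:
  assumes "g \<in> carrier H" "e \<in> oriented_edges X"
  shows "\<phi> g e \<in> oriented_edges X" "initial X (\<phi> g e) = \<phi> g (initial X e)" "terminal X (\<phi> g e) = \<phi> g (terminal X e)"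
  using act_chart(1,2)[OF assms(1) edge_in(1)[OF assms(2)]] edge_in[OF assms(2)] face_map_small(2)
    act_chart(3)[OF assms(1) edge_in(1)[OF assms(2)], of 0 "[End False]"]
    act_chart(3)[OF assms(1) edge_in(1)[OF assms(2)], of 0 "[End True]"]
  by (auto simp: oriented_edges_def initial_def terminal_def)

lemma act_vertex: "g \<in> carrier H \<Longrightarrow> v \<in> vertices X \<Longrightarrow> \<phi> g v \<in> vertices X"
  using act_chart by (auto simp: vertices_def)

lemma act_epath:
  assumes "g \<in> carrier H" "epath X v es w"
  shows "epath X (\<phi> g v) (map (\<phi> g) es) (\<phi> g w)"
  using assms(2)
proof (induction es arbitrary: v)
  case (Cons e es)
  then show ?case using act_edge[OF assms(1)] by auto
qed simp

lemma dA_act: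
  assumes g: "g \<in> carrier H" and p: "p \<in> realization X"
  shows "dA x (act_point \<phi> g p) = dA x p"
proof -
  obtain c t where c: "p = point X c t" "c \<in> charts X" using p by (auto simp: realization_def)
  note a = act_chart[OF g c(2)]
  have lb: "lb (\<phi> g c) j = lb c j" and ps: "ps (\<phi> g c) j = ps c j" if "j < cdim X c" for j
  proof -
    have "\<phi> g (restr X c (edge_face (cdim X c) j False {})) = restr X (\<phi> g c) (edge_face (cdim X c) j False {})"
      by (rule a(3)[OF face_map_edge_face[OF that]])
    then show "lb (\<phi> g c) j = lb c j" "ps (\<phi> g c) j = ps c j"
      using label_inv[OF g edge_faces(1)[OF c(2) that, of False "{}"]] a(2) by (auto simp: lb_def ps_def)
  qed
  have "V tent x (\<phi> g c, t) = V tent x (c, t)"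
  proof (cases "\<exists>j<cdim X c. lb c j = x")
    case True
    then obtain j where j: "j < cdim X c" "lb c j = x" by blast
    then show ?thesis using V_at[OF c(2) j] V_at[of "\<phi> g c" j x] a lb ps by (simp add: oc_def)
  next
    case False
    then have "V tent x (c, t) = 0" by (intro V_none) auto
    moreover have "V tent x (\<phi> g c, t) = 0" by (rule V_none) (use False a lb in auto)
    ultimately show ?thesis by simp
  qed
  then show ?thesis
    using act_point_point[OF action g is_complex c(2)] c(1) by (simp add: dAB_point)
qed

text \<open>The midpoint of an edge has \<open>dA\<close> equal to 1/2 for its label. Some translate
  of it lies in the compact set, within 1/4 of one of finitely many centres, where \<open>dA\<close>
  is therefore still nonzero; and at each centre only finitely many labels are nonzero.\<close>

lemma finite_labels: "finite (lab ` oriented_edges X)"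
proof -
  have conn: "cube_connected X" and CAT: "CAT0 (realization X) (cube_dist X)"
    using CAT0 by (auto simp: CAT0_cube_complex_def)
  interpret M: Metric_space "realization X" "cube_dist X" using CAT by (simp add: CAT0_def)
  obtain K where K: "compactin M.mtopology K" "(\<Union>g\<in>carrier H. act_point \<phi> g ` K) = realization X"
    using cocompact unfolding cocompact_action_def compact_in_complex_def by blast
  have KM: "K \<subseteq> realization X" using compactin_subset_topspace[OF K(1)] by simp
  have "\<exists>\<F>. finite \<F> \<and> \<F> \<subseteq> (\<lambda>p. M.mball p (1/4)) ` K \<and> K \<subseteq> \<Union>\<F>"
  proof (rule compactinD[OF K(1)])
    show "K \<subseteq> \<Union>((\<lambda>p. M.mball p (1/4)) ` K)" using KM by (auto simp: M.centre_in_mball_iff)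
  qed (auto simp: M.openin_mball)
  then obtain P where P: "finite P" "P \<subseteq> K" "K \<subseteq> (\<Union>p\<in>P. M.mball p (1/4))"
    using finite_subset_image by (metis (no_types, lifting))
  have "lab ` oriented_edges X \<subseteq> (\<Union>p\<in>P. {x. dA x p \<noteq> 0})"
  proof
    fix x assume "x \<in> lab ` oriented_edges X"
    then obtain e where e: "e \<in> oriented_edges X" "x = lab e" by blast
    have "point X e [1/2] \<in> realization X" by (rule edge_points(1)[OF e(1)]) simp
    then obtain g k where gk: "g \<in> carrier H" "k \<in> K" "point X e [1/2] = act_point \<phi> g k" using K(2) by blast
    then obtain p where p: "p \<in> P" "k \<in> M.mball p (1/4)" using P(3) by blast
    have k: "k \<in> realization X" "p \<in> realization X" "cube_dist X p k < 1/4" using p(2) by auto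
    have "dA x k = 1/2"
      using dA_act[OF gk(1) k(1), of x] dA_edge(1)[OF e(1), of "1/2"] gk(3) e(2) by (simp add: tent_def)
    then have "dA x p \<noteq> 0" using dAB_lipschitz(1)[OF conn k(2,1), of x] k(3) by auto
    then show "x \<in> (\<Union>p\<in>P. {x. dA x p \<noteq> 0})" using p(1) by blast
  qed
  moreover have "finite (\<Union>p\<in>P. {x. dA x p \<noteq> 0})" using P finite_active KM by blast
  ultimately show ?thesis using finite_subset by blast
qed

text \<open>\<open>C\<close> stands for the carrier of either group, so that the smooth and the
  piecewise linear case share one argument: elements of \<open>H\<close> go to finite products of
  pushes. Injectivity is reduced to a trivial kernel.\<close>

theorem embeds_in:
  assumes push: "push \<beta> \<beta>'"
    and C: "id \<in> C" "\<And>f g. f \<in> C \<Longrightarrow> g \<in> C \<Longrightarrow> f \<circ> g \<in> C"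
      "\<And>code \<sigma> x. push_code \<beta> \<beta>' crs code \<Longrightarrow> push_code.Psi \<beta> \<beta>' code \<sigma> (x::'l) \<in> C"
  shows "\<exists>\<rho>. \<rho> \<in> hom H \<lparr>carrier = C, monoid.mult = (\<circ>), one = id\<rparr> \<and> inj_on \<rho> (carrier H)"
proof -
  obtain code where code:
    "\<And>k x s x' s'. code k = Some (x, s) \<Longrightarrow> code (Suc k) = Some (x', s') \<Longrightarrow> x \<noteq> x' \<and> \<not> crs x x'"
    "\<And>y s w. fst ` set ((y, s) # w) \<subseteq> lab ` oriented_edges X \<Longrightarrow>
        \<exists>K. \<forall>i<length (pchain crs y s w). code (K + i) = Some (pchain crs y s w ! i)"
  proof (rule universal_code[OF countable_finite[OF finite_labels], of crs thesis])
    fix code :: "nat \<Rightarrow> ('l \<times> bool) option"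
    assume 1: "\<And>k x s x' s'. code k = Some (x, s) \<Longrightarrow> code (Suc k) = Some (x', s') \<Longrightarrow> x \<noteq> x' \<and> \<not> crs x x'"
      and 2: "\<And>y s w. fst ` set ((y, s) # w) \<subseteq> lab ` oriented_edges X \<Longrightarrow>
        \<exists>K. \<forall>i<length (pchain crs y s w). code (K + i) = Some (pchain crs y s w ! i)"
    show thesis by (rule that[of code, OF 1 2])
  qed
  interpret push \<beta> \<beta>' by (rule push)
  interpret P: push_code \<beta> \<beta>' crs code
    by standard (use crs_sym crs_irrefl code(1) in blast)+
  interpret R: local_rep X lab pos crs P.Psi P.supp
    by standard (rule P.Psi_cancel P.Psi_out P.Psi_supp P.supp_disjoint CAT0; assumption?)+
  obtain v0 where v0: "v0 \<in> vertices X" using vertex_exists R.charts_ne by blast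
  obtain F where F: "F v0 = id" "\<And>v es w. epath X v es w \<Longrightarrow> F w = F v \<circ> R.mprod es"
    using R.developing_map[OF v0] by blast
  \<comment> \<open>A path to \<open>g h v0\<close> is a path to \<open>g v0\<close> followed by the
    translate by \<open>g\<close> of one to \<open>h v0\<close>. Translation keeps labels, so this
    map is multiplicative.\<close>
  define \<rho> where "\<rho> g = F (\<phi> g v0)" for g
  have path: "\<exists>es. epath X v0 es (\<phi> g v0)" if "g \<in> carrier H" for g
    using vertices_connected[OF R.connected v0 act_vertex[OF that v0]] unfolding conn_def .
  have edges: "set es \<subseteq> oriented_edges X" if "epath X v es w" for v es w
    using that by (induction es arbitrary: v) auto
  have mprod_act: "R.mprod (map (\<phi> g) es) = R.mprod es" if "g \<in> carrier H" "set es \<subseteq> oriented_edges X" for g es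
    using that(2) label_inv[OF that(1)] by (induction es) (auto simp: R.mprod_def R.mu_def)
  have \<rho>_path: "\<rho> g = R.mprod es" if "epath X v0 es (\<phi> g v0)" for g es
    using F that by (simp add: \<rho>_def)
  have in_C: "\<rho> g \<in> C" if g: "g \<in> carrier H" for g
  proof -
    obtain es where es: "epath X v0 es (\<phi> g v0)" using path[OF g] by blast
    have "R.mprod es \<in> C"
    proof (induction es)
      case Nil
      have "R.mprod [] = id" by (simp add: R.mprod_def)
      then show ?case using C(1) by metis
    next
      case (Cons a es)
      have "R.mprod (a # es) = P.Psi (pos a) (lab a) \<circ> R.mprod es" by (simp add: R.mprod_def R.mu_def)
      then show ?case using C(2)[OF C(3)[OF P.push_code_axioms] Cons.IH] by metis
    qed
    then show ?thesis using \<rho>_path[OF es] by simp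
  qed
  have mult: "\<rho> (g \<otimes>\<^bsub>H\<^esub> h) = \<rho> g \<circ> \<rho> h" if gh: "g \<in> carrier H" "h \<in> carrier H" for g h
  proof -
    obtain es where es: "epath X v0 es (\<phi> h v0)" using path[OF gh(2)] by blast
    have "epath X (\<phi> g v0) (map (\<phi> g) es) (\<phi> (g \<otimes>\<^bsub>H\<^esub> h) v0)"
      using act_epath[OF gh(1) es] composition_rule[of v0 g h] v0 gh by (simp add: vertices_def)
    then have "\<rho> (g \<otimes>\<^bsub>H\<^esub> h) = \<rho> g \<circ> R.mprod (map (\<phi> g) es)" unfolding \<rho>_def by (rule F(2))
    then show ?thesis using mprod_act[OF gh(1) edges[OF es]] \<rho>_path[OF es] by simp
  qed
  have nontrivial: "g = \<one>\<^bsub>H\<^esub>" if g: "g \<in> carrier H" and id: "\<rho> g = id" for g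
  proof -
    obtain es0 where "epath X v0 es0 (\<phi> g v0)" using path[OF g] by blast
    then obtain es where es: "epath X v0 es (\<phi> g v0)" "reduced crs (word es)"
      by (rule reduced_path_exists)
    have fold: "R.mprod es y = fold (\<lambda>(x, \<sigma>). P.Psi \<sigma> x) (rev (word es)) y" for es y
      by (induction es) (auto simp: R.mprod_def R.mu_def)
    have "es = []"
    proof (rule ccontr)
      assume "es \<noteq> []"
      then obtain y s w where w: "rev (word es) = (y, s) # w" by (cases "rev (word es)") auto
      have "fst ` set (word es) \<subseteq> lab ` oriented_edges X" using edges[OF es(1)] by auto
      then have "fst ` set ((y, s) # w) \<subseteq> lab ` oriented_edges X" using w by (metis set_rev)
      then obtain K where K: "\<forall>i<length (pchain crs y s w). code (K + i) = Some (pchain crs y s w ! i)"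
        using code(2) by blast
      have "R.mprod es (2 * real K + 1/2) \<noteq> 2 * real K + 1/2"
        unfolding fold w using P.chain_moves[of y s w K] reduced_rev[OF es(2)] w K by auto
      then show False using id \<rho>_path[OF es(1)] by simp
    qed
    \<comment> \<open>The empty path ends where it starts, so \<open>g\<close> fixes the vertex
      \<open>v0\<close>.\<close>
    then show ?thesis using es(1) free_on_vertices[OF action free is_complex g v0] by simp
  qed
  interpret G: group H by (rule group_H)
  have "\<rho> \<one>\<^bsub>H\<^esub> = id"
  proof -
    have "\<phi> \<one>\<^bsub>H\<^esub> v0 = v0" using v0 id_eq_one by (metis (no_types, lifting) mem_Collect_eq restrict_apply' vertices_def)
    then show ?thesis using F(1) by (simp add: \<rho>_def)
  qed
  have "inj_on \<rho> (carrier H)"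
  proof (rule inj_onI)
    fix g h assume gh: "g \<in> carrier H" "h \<in> carrier H" "\<rho> g = \<rho> h"
    have "\<rho> (g \<otimes>\<^bsub>H\<^esub> inv\<^bsub>H\<^esub> h) = \<rho> (h \<otimes>\<^bsub>H\<^esub> inv\<^bsub>H\<^esub> h)"
      using gh by (metis G.inv_closed mult)
    then have "g \<otimes>\<^bsub>H\<^esub> inv\<^bsub>H\<^esub> h = \<one>\<^bsub>H\<^esub>" using gh \<open>\<rho> \<one>\<^bsub>H\<^esub> = id\<close> nontrivial by simp
    then show "g = h" using gh by (metis G.inv_closed G.inv_equality G.inv_inv)
  qed
  moreover have "\<rho> \<in> hom H \<lparr>carrier = C, monoid.mult = (\<circ>), one = id\<rparr>"
    using in_C mult by (auto simp: hom_def)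
  ultimately show ?thesis by blast
qed

end

section \<open>Special quotients\<close>

context complex
begin

text \<open>Reflecting the second coordinate of the square exchanges the two edges. Orientations are
  required to pass along \<open>parallel\<close> in one direction only; symmetry supplies the
  converse.\<close>

lemma parallel_sym:
  assumes "parallel X e e'"
  shows "parallel X e' e"
proof -
  obtain s where s: "s \<in> squares X" "e = restr X s [Coord 0 False, End False]" "e' = restr X s [Coord 0 False, End True]"
    using assms unfolding parallel_def by blast
  have sc: "s \<in> charts X" "cdim X s = 2" using s by (auto simp: squares_def)
  let ?f = "[Coord 0 False, Coord 1 True]"
  have "\<exists>!j. j < 2 \<and> (\<exists>b. ?f ! j = Coord i b)" if "i < 2" for i
    by (rule ex1I[of _ i]) (use that in \<open>auto simp: less_2_cases_iff\<close>)
  then have f: "face_map 2 (cdim X s) ?f"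
    unfolding sc face_map_def by simp
  let ?s = "restr X s ?f"
  have "?s \<in> squares X" using restr_in[OF sc(1) f] by (simp add: squares_def)
  moreover have "restr X ?s [Coord 0 False, End b] = restr X s [Coord 0 False, End (\<not> b)]" for b
    using restr_restr[OF sc(1) f face_map_small(3)] by (simp add: comp_face_def)
  ultimately show ?thesis unfolding parallel_def s by (intro bexI[of _ ?s]) auto
qed

lemma form_corner_sym:
  assumes "form_corner X e e'"
  shows "form_corner X e' e"
proof -
  obtain s where s: "s \<in> squares X" "axes X s = [e, e']" and ne: "e \<noteq> e'"
    using assms unfolding form_corner_def by blast
  have sc: "s \<in> charts X" "cdim X s = 2" using s by (auto simp: squares_def)
  let ?f = "[Coord 1 False, Coord 0 False]"
  have "?f = square_face 2 1 0 {}" by (simp add: square_face_def upt_rec numeral_2_eq_2)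
  then have f: "face_map 2 (cdim X s) ?f"
    using face_map_square_face[of 1 2 0 "{}"] sc by simp
  let ?s = "restr X s ?f"
  have q: "?s \<in> squares X" using restr_in[OF sc(1) f] by (simp add: squares_def)
  have "axes X ?s = [e', e]"
    using square_axes[OF q] square_axes[OF s(1)] s(2)
      restr_restr[OF sc(1) f face_map_small(3)] restr_restr[OF sc(1) f face_map_small(4)]
    by (simp add: comp_face_def)
  then show ?thesis using q ne unfolding form_corner_def by auto
qed

lemma square_corner:
  assumes "s \<in> squares X" "axes X s = [e, e']"
  shows "e \<in> oriented_edges X" "e' \<in> oriented_edges X" "initial X e = origin X s" "initial X e' = origin X s"
proof -
  have sc: "s \<in> charts X" "cdim X s = 2" using assms by (auto simp: squares_def)
  have "e = restr X s (edge_face (cdim X s) 0 False {})" "e' = restr X s (edge_face (cdim X s) 1 False {})"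
    using assms(2) square_axes[OF assms(1)] square_edges[OF assms(1)] sc by auto
  then show "e \<in> oriented_edges X" "e' \<in> oriented_edges X" "initial X e = origin X s" "initial X e' = origin X s"
    using edge_faces[OF sc(1), of 0 False "{}"] edge_faces[OF sc(1), of 1 False "{}"] sc by (auto simp: origin_eq)
qed

end

locale special_quotient =
  fixes X :: "'c cube_complex" and H :: "('a, 'b) monoid_scheme" and \<phi> :: "'a \<Rightarrow> 'c \<Rightarrow> 'c"
  assumes CAT0: "CAT0_cube_complex X"
    and action: "cubical_action H X \<phi>"
    and free: "free_action H X \<phi>"
    and cocompact: "cocompact_action H X \<phi>"
    and special: "special (quotient_complex H X \<phi>)"
begin

sublocale X: complex X
  by standard (use CAT0 in \<open>simp add: CAT0_cube_complex_def\<close>)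

sublocale group_action H "charts X" \<phi>
  using action by (simp add: cubical_action_def)

abbreviation Y :: "'c set cube_complex" where "Y \<equiv> quotient_complex H X \<phi>"

sublocale Y: complex Y
  by standard (use special in \<open>simp add: special_def nonpositively_curved_def\<close>)

definition q :: "'c \<Rightarrow> 'c set" where
  "q c = orbit H \<phi> c"

lemma act_chart:
  assumes "g \<in> carrier H" "c \<in> charts X"
  shows "\<phi> g c \<in> charts X" "cdim X (\<phi> g c) = cdim X c"
    "face_map m (cdim X c) f \<Longrightarrow> \<phi> g (restr X c f) = restr X (\<phi> g c) f"
  using action assms element_image[OF assms] by (auto simp: cubical_action_def)

lemma charts_Y: "charts Y = q ` charts X"
  by (auto simp: quotient_complex_def orbits_def q_def)

lemma q_mem: "c' \<in> q c \<longleftrightarrow> (\<exists>g\<in>carrier H. c' = \<phi> g c)"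
  by (auto simp: q_def orbit_def)

lemma one_act: "c \<in> charts X \<Longrightarrow> \<phi> \<one>\<^bsub>H\<^esub> c = c"
  using id_eq_one by (metis restrict_apply')

lemma group_H: "group H"
  using group_hom group_hom.axioms(1) by blast

lemma q_self: "c \<in> charts X \<Longrightarrow> c \<in> q c"
  using one_act group_H unfolding q_mem by (metis group.is_monoid monoid.one_closed)

lemma q_act:
  assumes "g \<in> carrier H" "c \<in> charts X"
  shows "q (\<phi> g c) = q c"
proof -
  interpret G: group H by (rule group_H)
  have "\<phi> h (\<phi> g c) = \<phi> (h \<otimes>\<^bsub>H\<^esub> g) c" if "h \<in> carrier H" for h
    using composition_rule[OF assms(2) that assms(1)] by simp
  moreover have "\<phi> h c = \<phi> (h \<otimes>\<^bsub>H\<^esub> inv\<^bsub>H\<^esub> g) (\<phi> g c)" if "h \<in> carrier H" for h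
    using that assms composition_rule[OF assms(2), of "h \<otimes>\<^bsub>H\<^esub> inv\<^bsub>H\<^esub> g" g] by (simp add: G.m_assoc)
  ultimately show ?thesis unfolding set_eq_iff q_mem using assms(1) G.m_closed G.inv_closed by metis
qed

lemma q_eqD:
  assumes "c' \<in> charts X" "q c = q c'"
  obtains g where "g \<in> carrier H" "\<phi> g c = c'"
  using q_self[OF assms(1)] assms(2) q_mem by metis

lemma cdim_q: "c \<in> charts X \<Longrightarrow> cdim Y (q c) = cdim X c"
proof -
  assume c: "c \<in> charts X"
  have "cdim X x = cdim X c" if "x \<in> q c" for x using that act_chart(2)[OF _ c] by (auto simp: q_mem)
  then have "cdim X ` q c \<subseteq> {cdim X c}" by auto
  moreover have "cdim X c \<in> cdim X ` q c" using q_self[OF c] by (rule imageI)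
  ultimately have "cdim X ` q c = {cdim X c}" by blast
  then show ?thesis by (simp add: quotient_complex_def)
qed

lemma restr_q:
  assumes "c \<in> charts X" "face_map m (cdim X c) f"
  shows "restr Y (q c) f = q (restr X c f)"
proof -
  have "(\<lambda>c. restr X c f) ` q c = q (restr X c f)"
    using act_chart(3)[OF _ assms] by (fastforce simp: q_mem image_iff)
  then show ?thesis by (simp add: quotient_complex_def)
qed

lemma q_edge:
  assumes "e \<in> oriented_edges X"
  shows "q e \<in> oriented_edges Y" "rev_edge Y (q e) = q (rev_edge X e)"
    "initial Y (q e) = q (initial X e)" "terminal Y (q e) = q (terminal X e)"
proof -
  note e = X.edge_in[OF assms]
  show "q e \<in> oriented_edges Y" using e cdim_q charts_Y by (simp add: oriented_edges_def)
  show "rev_edge Y (q e) = q (rev_edge X e)" "initial Y (q e) = q (initial X e)" "terminal Y (q e) = q (terminal X e)"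
    unfolding rev_edge_def initial_def terminal_def
    using restr_q[OF e(1)] face_map_small(1,2) e(2) by metis+
qed

lemma q_square: "s \<in> squares X \<Longrightarrow> q s \<in> squares Y"
  using cdim_q charts_Y by (simp add: squares_def)

lemma axes_q: "c \<in> charts X \<Longrightarrow> axes Y (q c) = map q (axes X c)"
  unfolding X.axes_eq Y.axes_eq by (simp add: cdim_q restr_q[OF _ face_map_edge_face])

lemma squares_Y: "S \<in> squares Y \<Longrightarrow> \<exists>s\<in>squares X. S = q s"
  using charts_Y cdim_q by (fastforce simp: squares_def)

definition lab :: "'c \<Rightarrow> 'c set set" where
  "lab e = {E. same_hyperplane Y (q e) E}"

definition sd :: "'c set set \<Rightarrow> 'c set set" where
  "sd A = (SOME S. consistent_orientation Y A S)"

definition pos :: "'c \<Rightarrow> bool" where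
  "pos e \<longleftrightarrow> q e \<in> sd (lab e)"

text \<open>The restriction to hyperplanes secures irreflexivity: an arbitrary set of edges may
  cross itself.\<close>

definition crs :: "'c set set \<Rightarrow> 'c set set \<Rightarrow> bool" where
  "crs A B \<longleftrightarrow> A \<in> hyperplanes Y \<and> B \<in> hyperplanes Y \<and> cross Y A B"

lemma lab_hyperplane: "e \<in> oriented_edges X \<Longrightarrow> lab e \<in> hyperplanes Y"
  using q_edge(1) unfolding hyperplanes_def lab_def by blast

lemma q_in_lab: "q e \<in> lab e"
  by (simp add: lab_def same_hyperplane_def)

lemma sd_consistent: "A \<in> hyperplanes Y \<Longrightarrow> consistent_orientation Y A (sd A)"
  using special unfolding special_def two_sided_def sd_def by (metis someI_ex)

lemma lab_eqI:
  assumes "same_hyperplane Y (q e) (q e')"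
  shows "lab e = lab e'"
  unfolding lab_def
proof (intro Collect_cong iffI)
  show "same_hyperplane Y (q e') E" if "same_hyperplane Y (q e) E" for E
    using equivclp_trans[OF equivclp_sym[OF assms[unfolded same_hyperplane_def]]] that
    unfolding same_hyperplane_def by blast
  show "same_hyperplane Y (q e) E" if "same_hyperplane Y (q e') E" for E
    using equivclp_trans[OF assms[unfolded same_hyperplane_def]] that
    unfolding same_hyperplane_def by blast
qed

lemma no_self_cross: "A \<in> hyperplanes Y \<Longrightarrow> \<not> cross Y A A"
  using special unfolding special_def by blast

lemma label_rev:
  assumes "e \<in> oriented_edges X"
  shows "lab (rev_edge X e) = lab e \<and> pos (rev_edge X e) = (\<not> pos e)"
proof
  have "same_hyperplane Y (q e) (q (rev_edge X e))"
    unfolding same_hyperplane_def using q_edge[OF assms] by (intro r_into_equivclp) auto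
  then show l: "lab (rev_edge X e) = lab e" using lab_eqI by metis
  show "pos (rev_edge X e) = (\<not> pos e)"
    using sd_consistent[OF lab_hyperplane[OF assms]] q_in_lab[of e] q_edge(2)[OF assms]
    unfolding pos_def l consistent_orientation_def by metis
qed

lemma label_parallel:
  assumes "parallel X e e'"
  shows "lab e' = lab e \<and> pos e' = pos e"
proof
  obtain s where s: "s \<in> squares X" "e = restr X s [Coord 0 False, End False]" "e' = restr X s [Coord 0 False, End True]"
    using assms unfolding parallel_def by blast
  have sc: "s \<in> charts X" "cdim X s = 2" using s by (auto simp: squares_def)
  have "restr Y (q s) [Coord 0 False, End b] = q (restr X s [Coord 0 False, End b])" for b
    using restr_q[OF sc(1), of 1] face_map_small(3) sc(2) by simp
  then have p: "parallel Y (q e) (q e')"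
    using q_square[OF s(1)] unfolding parallel_def s by (intro bexI[of _ "q s"]) auto
  then have "same_hyperplane Y (q e) (q e')"
    unfolding same_hyperplane_def by (intro r_into_equivclp) auto
  then show l: "lab e' = lab e" using lab_eqI by metis
  have e: "e \<in> oriented_edges X"
    using X.restr_in[OF sc(1), of 1] face_map_small(3) sc(2) unfolding s oriented_edges_def by simp
  show "pos e' = pos e"
    using sd_consistent[OF lab_hyperplane[OF e]] p Y.parallel_sym[OF p]
    unfolding pos_def l consistent_orientation_def by metis
qed

lemma corner_labels_cross:
  assumes "s \<in> squares X" "axes X s = [e, e']"
  shows "crs (lab e) (lab e')"
proof -
  have sc: "s \<in> charts X" using assms by (simp add: squares_def)
  note e = X.square_corner[OF assms]
  have ax: "axes Y (q s) = [q e, q e']" using axes_q[OF sc] assms(2) by simp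
  have qs: "q s \<in> charts Y" using sc charts_Y by blast
  have "origin Y (q s) \<in> vertices Y"
    unfolding Y.origin_eq vertices_def using Y.restr_in[OF qs face_map_vertex_face] by simp
  \<comment> \<open>A corner requires two different edges of the quotient; here the simplicial links
    of the quotient enter.\<close>
  then have "distinct (axes Y (q s))"
    using special qs unfolding special_def nonpositively_curved_def simplicial_link_def by blast
  then have "form_corner Y (q e) (q e')"
    using ax q_square[OF assms(1)] unfolding form_corner_def by auto
  then show ?thesis
    using lab_hyperplane e q_in_lab unfolding crs_def cross_def by blast
qed

text \<open>An element carrying one edge to the other fixes their common initial vertex, hence is
  the identity by freeness.\<close>

lemma quotient_injective:
  assumes e: "e \<in> oriented_edges X" "e' \<in> oriented_edges X" "initial X e = initial X e'" and "q e = q e'"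
  shows "e = e'"
proof -
  obtain g where g: "g \<in> carrier H" "\<phi> g e = e'" using q_eqD[OF X.edge_in(1)[OF e(2)] assms(4)] .
  have "\<phi> g (initial X e) = initial X e'"
    using act_chart(3)[OF g(1) X.edge_in(1)[OF e(1)], of 0 "[End False]"] face_map_small(2) X.edge_in(2)[OF e(1)] g(2)
    by (simp add: initial_def)
  then have "g = \<one>\<^bsub>H\<^esub>"
    using free_on_vertices[OF action free X.is_complex g(1) X.rev_in(5)[OF e(1)]] e(3) by simp
  then show ?thesis using g one_act X.edge_in(1)[OF e(1)] by simp
qed

text \<open>Otherwise the images in the quotient are distinct and form no corner, as their
  hyperplane does not cross itself. So they osculate directly: at the initial vertex if the sign is
  positive, at the terminal vertex of the reversed edges if it is negative.\<close>

lemma same_label_unique: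
  assumes e: "e \<in> oriented_edges X" "e' \<in> oriented_edges X" "initial X e = initial X e'"
    and l: "lab e = lab e'" "pos e = pos e'"
  shows "e = e'"
proof (rule quotient_injective[OF e], rule ccontr)
  assume ne: "q e \<noteq> q e'"
  let ?A = "lab e"
  have A: "?A \<in> hyperplanes Y" by (rule lab_hyperplane[OF e(1)])
  note co = sd_consistent[OF A]
  have nc: "\<not> form_corner Y (q e) (q e')"
    using no_self_cross[OF A] q_in_lab[of e] q_in_lab[of e'] l(1) unfolding cross_def by metis
  have nso: "\<not> directly_self_osculates Y ?A" using special A unfolding special_def by blast
  note qe = Y.rev_in[OF q_edge(1)[OF e(1)]] and qe' = Y.rev_in[OF q_edge(1)[OF e(2)]]
  have i: "initial Y (q e) = initial Y (q e')" using q_edge(3) e by metis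
  show False
  proof (cases "pos e")
    case True
    then have "q e \<in> sd ?A" "q e' \<in> sd ?A" using l by (auto simp: pos_def)
    then show False using nso co nc i ne unfolding directly_self_osculates_def by blast
  next
    case False
    then have "q e \<notin> sd ?A" "q e' \<notin> sd ?A" using l by (auto simp: pos_def)
    then have r: "rev_edge Y (q e) \<in> sd ?A" "rev_edge Y (q e') \<in> sd ?A"
      using co q_in_lab[of e] q_in_lab[of e'] l(1) unfolding consistent_orientation_def by metis+
    have "rev_edge Y (q e) \<noteq> rev_edge Y (q e')" using ne qe(2) qe'(2) by metis
    moreover have "terminal Y (rev_edge Y (q e)) = terminal Y (rev_edge Y (q e'))" using qe(4) qe'(4) i by metis
    moreover have "\<not> form_corner Y (rev_edge Y (rev_edge Y (q e))) (rev_edge Y (rev_edge Y (q e')))"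
      using nc qe(2) qe'(2) by simp
    ultimately show False using nso co r unfolding directly_self_osculates_def by blast
  qed
qed

text \<open>Absence of inter-osculation gives a square in the quotient with the two edges as axes. A
  lift of it can be translated to have \<open>e\<close> as first axis, and then
  \<open>quotient_injective\<close> forces the second to be \<open>e'\<close>.\<close>

lemma crossing_corner:
  assumes e: "e \<in> oriented_edges X" "e' \<in> oriented_edges X" "initial X e = initial X e'" and c: "crs (lab e) (lab e')"
  shows "\<exists>s\<in>squares X. axes X s = [e, e']"
proof -
  have ne: "lab e \<noteq> lab e'" using c no_self_cross unfolding crs_def by metis
  have "\<not> inter_osculate Y (lab e) (lab e')" using special c unfolding special_def crs_def by blast
  then have "form_corner Y (q e) (q e')"
    using ne c q_in_lab[of e] q_in_lab[of e'] q_edge(3)[OF e(1)] q_edge(3)[OF e(2)] e(3)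
    unfolding inter_osculate_def crs_def by metis
  then obtain s where s: "s \<in> squares X" "axes Y (q s) = [q e, q e']"
    using squares_Y unfolding form_corner_def by metis
  have sc: "s \<in> charts X" "cdim X s = 2" using s(1) by (auto simp: squares_def)
  obtain a b where ab: "axes X s = [a, b]" "q a = q e" "q b = q e'"
    using axes_q[OF sc(1)] s(2) by auto
  obtain g where g: "g \<in> carrier H" "\<phi> g a = e" using q_eqD[OF X.edge_in(1)[OF e(1)] ab(2)] .
  have gs: "\<phi> g s \<in> squares X" using act_chart[OF g(1) sc(1)] sc by (simp add: squares_def)
  have "axes X (\<phi> g s) = map (\<phi> g) (axes X s)"
    using act_chart(2)[OF g(1) sc(1)] act_chart(3)[OF g(1) sc(1) face_map_edge_face] by (simp add: X.axes_eq)
  then have ax: "axes X (\<phi> g s) = [e, \<phi> g b]" using ab g by simp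
  note sq = X.square_corner[OF gs ax] and b = X.square_corner(2)[OF s(1) ab(1)]
  have "q (\<phi> g b) = q e'" using q_act[OF g(1) X.edge_in(1)[OF b]] ab by simp
  then have "\<phi> g b = e'" using quotient_injective[OF sq(2) e(2)] sq e(3) by metis
  then show ?thesis using gs ax by blast
qed

sublocale labelled_action X lab pos crs H \<phi>
proof
  show "crs x y \<Longrightarrow> crs y x" for x y
    unfolding crs_def cross_def using Y.form_corner_sym by blast
  show "\<not> crs x x" for x unfolding crs_def using no_self_cross by blast
  show "lab (\<phi> g e) = lab e \<and> pos (\<phi> g e) = pos e" if "g \<in> carrier H" "e \<in> oriented_edges X" for g e
    using q_act[OF that(1) X.edge_in(1)[OF that(2)]] by (simp add: lab_def pos_def)
qed (use label_rev label_parallel corner_labels_cross same_label_unique crossing_corner CAT0 action free cocompact in blast)+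

end

theorem corollary4:
  fixes G :: "('a, 'b) monoid_scheme"
  assumes "group G"
    and "virtually_special TYPE('c) G"
  shows "\<exists>H. finite_index_subgroup H G \<and>
           (\<exists>\<rho>. \<rho> \<in> hom (G\<lparr>carrier := H\<rparr>) Diff_plus \<and> inj_on \<rho> H) \<and>
           (\<exists>\<sigma>. \<sigma> \<in> hom (G\<lparr>carrier := H\<rparr>) PL_plus \<and> inj_on \<sigma> H)"
proof -
  obtain H X \<phi> where H: "finite_index_subgroup H G"
    and *: "CAT0_cube_complex (X :: 'c cube_complex)" "cubical_action (G\<lparr>carrier := H\<rparr>) X \<phi>"
      "free_action (G\<lparr>carrier := H\<rparr>) X \<phi>" "cocompact_action (G\<lparr>carrier := H\<rparr>) X \<phi>"
      "special (quotient_complex (G\<lparr>carrier := H\<rparr>) X \<phi>)"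
    using assms(2) unfolding virtually_special_def by (elim exE conjE) (rule that)
  interpret special_quotient X "G\<lparr>carrier := H\<rparr>" \<phi>
    by standard (fact *)+
  have "\<exists>\<rho>. \<rho> \<in> hom (G\<lparr>carrier := H\<rparr>) Diff_plus \<and> inj_on \<rho> H"
  proof -
    obtain \<beta> \<beta>' :: "real \<Rightarrow> real" where b: "smooth \<beta>" "smooth \<beta>'" "push \<beta> \<beta>'"
      by (rule smooth_push)
    have eq: "\<lparr>carrier = carrier Diff_plus, monoid.mult = (\<circ>), one = id\<rparr> = Diff_plus"
      by (simp add: Diff_plus_def)
    show ?thesis
      using embeds_in[OF b(3) id_in_Diff_plus Diff_plus_comp push_code.Psi_in_Diff_plus[OF _ b(1,2)]]
      unfolding eq by simp
  qed
  moreover have "\<exists>\<sigma>. \<sigma> \<in> hom (G\<lparr>carrier := H\<rparr>) PL_plus \<and> inj_on \<sigma> H"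
  proof -
    obtain \<beta> \<beta>' :: "real \<Rightarrow> real" where b: "half_affine \<beta>" "half_affine \<beta>'" "push \<beta> \<beta>'"
      by (rule piecewise_linear_push)
    have eq: "\<lparr>carrier = carrier PL_plus, monoid.mult = (\<circ>), one = id\<rparr> = PL_plus"
      by (simp add: PL_plus_def)
    show ?thesis
      using embeds_in[OF b(3) id_in_PL_plus PL_plus_comp push_code.Psi_in_PL_plus[OF _ b(1,2)]]
      unfolding eq by simp
  qed
  ultimately show ?thesis using H by blast
qed

end
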